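(* Let $d\ge 3$, let $m=\binom d2$, and let $E\subset\mathbb R^d$ be compact. If $\dim_{\mathrm H}(E)>d-1$, then there exist a Borel probability measure $\mu$ supported on $E$ and a Borel set $E_\mu\subset\operatorname{supp}\mu$ with $\mu(E_\mu)=1$ such that, for every $x\in E_\mu$, \[ (\Phi_{d-1,x})_\#\mu^{d-1}\ll\mathcal L^m . \] Consequently, \[ \mathcal L^m\bigl(\Delta^{\mathrm{nd}}_{d-1,x}(E)\bigr)>0\qquad(x\in E_\mu). \]
   Context: $\mathcal L^m$ is Lebesgue measure on $\mathbb R^m$, $\mu^{j}$ is the $j$-fold product measure, $f_\#$ denotes pushforward, and $\dim_{\mathrm H}$ is Hausdorff dimension. For $1\le j<d$, $t_j=\binom{j+1}{2}$ and $x\in\mathbb R^d$, put $z_0=x$ and define the pinned squared-distance map $\Phi_{j,x}:(\mathbb R^d)^j\to\mathbb R^{t_j}$ by $\Phi_{j,x}(z_1,\dots,z_j)=(|z_a-z_b|^2)_{0\le a<b\le j}$. For $j=d-1$, $t_{d-1}=\binom d2=m$. The set $\Delta^{\mathrm{nd}}_{j,x}(E)\subset\mathbb R^{t_j}$ is the set of distance tuples $(|z_a-z_b|)_{0\le a<b\le j}$ with $z_0=x$, $z_1,\dots,z_j\in E$ and $z_0,\dots,z_j$ affinely independent. *)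

theory Defs
  imports "HOL-Probability.Probability"
begin

section \<open>Hausdorff dimension\<close>

text \<open>
  The \<open>s\<close>-th power of the diameter, with the usual conventions \<open>0\<^sup>0 = 1\<close> for nonempty sets and
  value \<open>0\<close> on the empty set (note that \<open>0 powr 0 = 0\<close> in the library).
\<close>
definition diam_powr :: "real \<Rightarrow> 'a::metric_space set \<Rightarrow> ennreal" where
  "diam_powr s U =
     (if U = {} then 0 else if s = 0 then 1 else ennreal (diameter U powr s))"

text \<open>The covering sets are required to be bounded, since \<open>diameter\<close> is only meaningful for these.\<close>
definition hausdorff_content :: "real \<Rightarrow> real \<Rightarrow> 'a::metric_space set \<Rightarrow> ennreal" where
  "hausdorff_content s \<delta> A =
     Inf {(\<Sum>i. diam_powr s (U i)) | U :: nat \<Rightarrow> 'a set.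
            A \<subseteq> (\<Union>i. U i) \<and> (\<forall>i. bounded (U i) \<and> diameter (U i) \<le> \<delta>)}"

definition hausdorff_measure :: "real \<Rightarrow> 'a::metric_space set \<Rightarrow> ennreal" where
  "hausdorff_measure s A = (SUP \<delta>\<in>{0<..}. hausdorff_content s \<delta> A)"

definition hausdorff_dim :: "'a::metric_space set \<Rightarrow> ennreal" where
  "hausdorff_dim A = Inf {ennreal s | s. 0 \<le> s \<and> hausdorff_measure s A = 0}"


section \<open>Topological support of a measure\<close>

definition msupport :: "'a::topological_space measure \<Rightarrow> 'a set" where
  "msupport M = {x. \<forall>U. open U \<and> x \<in> U \<longrightarrow> emeasure M U > 0}"


section \<open>Pinned distance maps\<close>

text \<open>
  \<open>\<real>\<close> to the power \<open>t\<^sub>j\<close> is realised as the space of extensional functions on the index set of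
  all pairs \<open>a < b \<le> j\<close>; \<open>lborel_pairs j\<close> is Lebesgue measure on (the Borel sets of) it.
\<close>
definition pairs :: "nat \<Rightarrow> (nat \<times> nat) set" where
  "pairs j = {(a, b). a < b \<and> b \<le> j}"

definition lborel_pairs :: "nat \<Rightarrow> (nat \<times> nat \<Rightarrow> real) measure" where
  "lborel_pairs j = Pi\<^sub>M (pairs j) (\<lambda>_. lborel)"

text \<open>Points of the \<open>j\<close>-fold power are functions on \<open>{1..j}\<close>; the update \<open>z(0 := x)\<close> is \<open>z\<^sub>0 = x\<close>.\<close>
definition pinned_sqdist :: "nat \<Rightarrow> 'a::metric_space \<Rightarrow> (nat \<Rightarrow> 'a) \<Rightarrow> nat \<times> nat \<Rightarrow> real" where
  "pinned_sqdist j x z =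
     (\<lambda>(a, b)\<in>pairs j. (dist ((z(0 := x)) a) ((z(0 := x)) b))\<^sup>2)"

text \<open>
  \<open>affine_dependent\<close> is a property of sets, so affine independence of the tuple
  \<open>z\<^sub>0, \<dots>, z\<^sub>j\<close> also needs that the points are distinct.
\<close>
definition nondeg_pinned_dists :: "nat \<Rightarrow> 'a::euclidean_space \<Rightarrow> 'a set \<Rightarrow> (nat \<times> nat \<Rightarrow> real) set" where
  "nondeg_pinned_dists j x E =
     {(\<lambda>(a, b)\<in>pairs j. dist (z a) (z b)) | z.
        z 0 = x \<and> (\<forall>i\<in>{1..j}. z i \<in> E) \<and> inj_on z {0..j} \<and> \<not> affine_dependent (z ` {0..j})}"

lemma finite_pairs: "finite (pairs j)"
  by (rule finite_subset[of _ "{..j} \<times> {..j}"]) (auto simp: pairs_def)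

lemma card_pairs: "card (pairs j) = (j + 1) choose 2"
proof (induction j)
  case 0
  have "pairs 0 = {}" by (auto simp: pairs_def)
  then show ?case by simp
next
  case (Suc j)
  have "pairs (Suc j) = pairs j \<union> (\<lambda>a. (a, Suc j)) ` {..j}"
    by (auto simp: pairs_def)
  moreover have "pairs j \<inter> (\<lambda>a. (a, Suc j)) ` {..j} = {}"
    by (auto simp: pairs_def)
  ultimately have "card (pairs (Suc j)) = card (pairs j) + card ((\<lambda>a. (a, Suc j)) ` {..j})"
    by (simp add: card_Un_disjoint finite_pairs)
  also have "card ((\<lambda>a. (a, Suc j)) ` {..j}) = Suc j"
    by (subst card_image) (auto simp: inj_on_def)
  finally show ?case using Suc by (simp add: numeral_2_eq_2)
qed

lemma measurable_pinned_sqdist: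
  fixes \<mu> :: "'a::euclidean_space measure"
  assumes [measurable_cong]: "sets \<mu> = sets borel"
  shows "pinned_sqdist j x \<in> measurable (Pi\<^sub>M {1..j} (\<lambda>_. \<mu>)) (lborel_pairs j)"
proof -
  have comp: "(\<lambda>z. (z(0 := x)) a) \<in> borel_measurable (Pi\<^sub>M {1..j} (\<lambda>_. \<mu>))" if "a \<le> j" for a
  proof (cases "a = 0")
    case False
    then have "(\<lambda>z. z a) \<in> measurable (Pi\<^sub>M {1..j} (\<lambda>_. \<mu>)) \<mu>"
      using that by (intro measurable_component_singleton) auto
    also have "measurable (Pi\<^sub>M {1..j} (\<lambda>_. \<mu>)) \<mu> = borel_measurable (Pi\<^sub>M {1..j} (\<lambda>_. \<mu>))"
      by (rule measurable_cong_sets) (use assms in auto)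
    finally show ?thesis using False by simp
  qed simp
  show ?thesis
    unfolding pinned_sqdist_def lborel_pairs_def
  proof (rule measurable_restrict)
    fix p assume "p \<in> pairs j"
    then obtain a b where p: "p = (a, b)" and ab: "a \<le> j" "b \<le> j"
      by (auto simp: pairs_def)
    show "(\<lambda>z. case p of (a, b) \<Rightarrow> (dist ((z(0 := x)) a) ((z(0 := x)) b))\<^sup>2)
            \<in> measurable (Pi\<^sub>M {1..j} (\<lambda>_. \<mu>)) lborel"
      unfolding p prod.case measurable_lborel1
      by (intro borel_measurable_power borel_measurable_dist comp ab)
  qed
qed

end

theory Submission
  imports Defs
begin

text \<open>
  Let \<open>d\<close> be the dimension and \<open>\<mu>\<close> a Frostman measure on \<open>E\<close> with exponent \<open>\<tau> > d - 1\<close>. Adding one vertex \<open>w\<close>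
  at a time, it suffices by Fubini that for \<open>\<mu>\<close>-almost all \<open>y\<^sub>0, \<dots>, y\<^bsub>d-2\<^esub>\<close> the map
  \<open>w \<mapsto> (|w - y\<^sub>a|\<^sup>2)\<^sub>a\<close> pushes \<open>\<mu>\<close> to an absolutely continuous measure. This follows if, for a sequence of
  scales \<open>\<epsilon>\<close>, the \<open>\<mu> \<times> \<mu>\<close>-mass of the pairs \<open>w, w'\<close> with \<open>||w - y\<^sub>a|\<^sup>2 - |w' - y\<^sub>a|\<^sup>2| < \<epsilon>\<close> for all \<open>a\<close>
  is \<open>O(\<epsilon>\<^bsup>d-1\<^esup>)\<close>. For Lebesgue-almost all \<open>y\<close> this holds, since the condition puts each \<open>y\<^sub>a\<close> into a slab of
  width about \<open>\<epsilon> / |w - w'|\<close> and the \<open>(d - 1)\<close>-energy of \<open>\<mu>\<close> is finite.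

  The condition depends only on the affine hull of \<open>y\<close>. This allows to replace the Lebesgue-random points by
  \<open>\<mu>\<close>-random ones, one after the other: the first along lines, as \<open>\<mu>\<close> has absolutely continuous projections
  along almost every direction, and the others along rays from \<open>y\<^sub>0\<close>, as the radial projections of \<open>\<mu>\<close> from
  \<open>\<mu>\<close>-almost every centre are absolutely continuous. Both rest on the fact that the law of \<open>(v, x + s v)\<close>,
  with \<open>x\<close> distributed by \<open>\<mu>\<close> and \<open>v, s\<close> by Lebesgue measure, has a square integrable density.
\<close>

section \<open>Almost everywhere statements in finite products\<close>

text \<open>The obstacle is that the Frostman condition is weak on slabs: covering by balls bounds
  the mass of a slab of width \<delta> only by a multiple of \<delta>^(\<tau> - (d - 1)).
  Lebesgue-random points pay the full factor \<epsilon> / |w - w'| for each slab, and d - 1 such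
  factors produce exactly the kernel |w - w'|^-(d - 1), which is \<mu>-integrable because \<tau> > d
  - 1. Replacing Lebesgue-random points by \<mu>-random ones transfers null sets, not estimates. The
  energy bound is therefore treated as a yes-or-no property with an unspecified constant: it may
  then change its constant whenever the points move inside their affine hull. A sequence of scales
  is all that can be asked for, since the energy is bounded in the mean over y and Fatou's lemma
  controls only a lower limit; absolute continuity of the limit survives along any scales tending to
  0. The first replacement takes the direction of its line from a second point that is still
  Lebesgue-random. Such a point exists because d - 1 >= 2.\<close>

lemma (in product_sigma_finite) AE_PiM_Un:
  assumes "I \<inter> J = {}" "finite I" "finite J"
    and P: "Measurable.pred (Pi\<^sub>M (I \<union> J) M) P"
  shows "(AE y in Pi\<^sub>M (I \<union> J) M. P y) \<longleftrightarrow> (AE x in Pi\<^sub>M I M. AE y in Pi\<^sub>M J M. P (merge I J (x, y)))"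
proof -
  interpret I: finite_product_sigma_finite M I by standard fact
  interpret J: finite_product_sigma_finite M J by standard fact
  interpret IJ: pair_sigma_finite "Pi\<^sub>M I M" "Pi\<^sub>M J M" ..
  have [measurable]: "Measurable.pred (Pi\<^sub>M I M \<Otimes>\<^sub>M Pi\<^sub>M J M) (\<lambda>z. P (merge I J z))"
    by (rule measurable_compose[OF measurable_merge P])
  have "(AE y in Pi\<^sub>M (I \<union> J) M. P y) \<longleftrightarrow>
      (AE y in distr (Pi\<^sub>M I M \<Otimes>\<^sub>M Pi\<^sub>M J M) (Pi\<^sub>M (I \<union> J) M) (merge I J). P y)"
    by (simp only: distr_merge[OF assms(1-3)])
  also have "\<dots> \<longleftrightarrow> (AE z in Pi\<^sub>M I M \<Otimes>\<^sub>M Pi\<^sub>M J M. P (merge I J z))"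
    using P by (intro AE_distr_iff) (auto simp: pred_def)
  also have "\<dots> \<longleftrightarrow> (AE x in Pi\<^sub>M I M. AE y in Pi\<^sub>M J M. P (merge I J (x, y)))"
    by (subst IJ.AE_pair_iff[of "\<lambda>x y. P (merge I J (x, y))"]) auto
  finally show ?thesis .
qed

lemma (in product_sigma_finite) AE_PiM_insert:
  assumes "finite I" "i \<notin> I"
    and P: "Measurable.pred (Pi\<^sub>M (insert i I) M) P"
  shows "(AE y in Pi\<^sub>M (insert i I) M. P y) \<longleftrightarrow> (AE x in Pi\<^sub>M I M. AE t in M i. P (x(i := t)))"
proof -
  interpret I: finite_product_sigma_finite M I by standard fact
  interpret J: finite_product_sigma_finite M "{i}" by standard simp
  have P': "Measurable.pred (Pi\<^sub>M (I \<union> {i}) M) P"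
    using P by simp
  have "(AE y in Pi\<^sub>M (insert i I) M. P y) \<longleftrightarrow> (AE y in Pi\<^sub>M (I \<union> {i}) M. P y)"
    by (simp only: Un_insert_right Un_empty_right)
  also have "\<dots> \<longleftrightarrow> (AE x in Pi\<^sub>M I M. AE y in Pi\<^sub>M {i} M. P (merge I {i} (x, y)))"
    by (rule AE_PiM_Un[OF _ _ _ P']) (use assms in auto)
  also have "\<dots> \<longleftrightarrow> (AE x in Pi\<^sub>M I M. AE t in M i. P (x(i := t)))"
  proof (rule AE_cong)
    fix x assume x: "x \<in> space (Pi\<^sub>M I M)"
    have *: "merge I {i} (x, y) = x(i := y i)" for y
      using x \<open>i \<notin> I\<close> by (auto simp: merge_def space_PiM PiE_def extensional_def)
    have "(\<lambda>t. x(i := t)) \<in> measurable (M i) (Pi\<^sub>M (insert i I) M)"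
      using x by (intro measurable_fun_upd[where J=I]) auto
    from measurable_compose[OF this P] have m: "Measurable.pred (M i) (\<lambda>t. P (x(i := t)))" .
    have "(AE t in M i. P (x(i := t))) \<longleftrightarrow> (AE t in distr (Pi\<^sub>M {i} M) (M i) (\<lambda>y. y i). P (x(i := t)))"
      by (simp only: distr_singleton)
    also have "\<dots> \<longleftrightarrow> (AE y in Pi\<^sub>M {i} M. P (x(i := y i)))"
      using m by (intro AE_distr_iff) (auto simp: pred_def)
    finally show "(AE y in Pi\<^sub>M {i} M. P (merge I {i} (x, y))) \<longleftrightarrow> (AE t in M i. P (x(i := t)))"
      by (simp add: *)
  qed
  finally show ?thesis .
qed

text \<open>Serves to discard surplus coordinates: the product splits over J and I - J, and the
  statement does not see the second factor.\<close>

lemma (in product_sigma_finite) AE_PiM_restrict: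
  assumes "J \<subseteq> I" "finite I" and P: "Measurable.pred (Pi\<^sub>M J M) P"
    and AE: "AE y in Pi\<^sub>M J M. P y"
  shows "AE y in Pi\<^sub>M I M. P (restrict y J)"
proof -
  have fin: "finite J" "finite (I - J)" using assms finite_subset by auto
  have eq: "I = J \<union> (I - J)" using assms by auto
  have m: "Measurable.pred (Pi\<^sub>M (J \<union> (I - J)) M) (\<lambda>y. P (restrict y J))"
    by (rule measurable_compose[OF measurable_restrict_subset P]) auto
  have "AE x in Pi\<^sub>M J M. AE y in Pi\<^sub>M (I - J) M. P (restrict (merge J (I - J) (x, y)) J)"
    using AE AE_space
  proof eventually_elim
    case (elim x)
    then have "restrict (merge J (I - J) (x, y)) J = x" for y
      by (auto simp: merge_def space_PiM PiE_def extensional_def fun_eq_iff)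
    with elim show ?case by simp
  qed
  then have "AE y in Pi\<^sub>M (J \<union> (I - J)) M. P (restrict y J)"
    by (subst AE_PiM_Un[OF _ _ _ m]) (use fin in auto)
  then show ?thesis by (simp only: eq[symmetric])
qed

section \<open>Limits of square-bounded approximations\<close>

text \<open>A Young inequality with a generous constant. Whether b is below or above c a, one of the
  two terms alone dominates, which avoids expanding a square with subtraction in
  \<open>ennreal\<close>.\<close>

lemma ennreal_mult_le_squares:
  fixes a b c :: ennreal
  assumes "0 < c" "c < \<top>"
  shows "a * b \<le> c * a\<^sup>2 + b\<^sup>2 / c"
proof (cases "b \<le> c * a")
  case True
  then have "a * b \<le> c * a\<^sup>2" 
    by (metis mult.left_commute mult_left_mono power2_eq_square zero_le)
  then show ?thesis by (rule order_trans) simp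
next
  case False
  then have "a \<le> b / c"
    using assms
    by (metis ennreal_mult_divide_eq divide_right_mono_ennreal linear mult.commute not_gr_zero order_less_imp_not_eq2 top.not_eq_extremum)
  then have "a * b \<le> b\<^sup>2 / c"
    by (metis mult.commute mult_right_mono power2_eq_square ennreal_times_divide zero_le)
  then show ?thesis by (rule order_trans) simp
qed

lemma outer_regular_null:
  fixes M :: "'a::polish_space measure"
  assumes "finite_measure M" "sets M = sets borel" "A \<in> sets borel" "0 < e"
  obtains U where "open U" "A \<subseteq> U" "emeasure M (U - A) < e"
proof -
  interpret finite_measure M by fact
  have fin: "emeasure M A \<noteq> \<infinity>" by simp
  then have "emeasure M A < emeasure M A + e"
    using assms(4) by (cases "emeasure M A"; cases e) (auto simp: ennreal_plus[symmetric] simp del: ennreal_plus intro!: ennreal_lessI)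
  also have "emeasure M A = (INF U \<in> {U. A \<subseteq> U \<and> open U}. emeasure M U)"
    by (rule outer_regular) (use assms in auto)
  finally obtain U where U: "A \<subseteq> U" "open U" "emeasure M U < emeasure M A + e"
    unfolding INF_less_iff using assms
    by (metis (no_types, lifting) \<open>emeasure M A = (INF U \<in> {U. A \<subseteq> U \<and> open U}. emeasure M U)\<close> mem_Collect_eq)
  have "emeasure M (U - A) = emeasure M U - emeasure M A"
    using U assms by (intro emeasure_Diff) auto
  also have "\<dots> < e"
    using U(3) assms(4) by (cases "emeasure M U" rule: ennreal_cases; cases "emeasure M A" rule: ennreal_cases; cases e rule: ennreal_cases) 
      (auto simp: ennreal_plus[symmetric] ennreal_minus ennreal_less_iff simp del: ennreal_plus intro!: ennreal_lessI)
  finally show ?thesis using that U by blast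
qed

lemma sum_liminf_le:
  fixes a :: "'i \<Rightarrow> nat \<Rightarrow> ennreal"
  assumes "finite K"
  shows "(\<Sum>k\<in>K. liminf (a k)) \<le> liminf (\<lambda>n. \<Sum>k\<in>K. a k n)"
  using nn_integral_liminf[of "\<lambda>n k. a k n" "count_space K"] assms
  by (simp add: nn_integral_count_space_finite)

text \<open>An abstract mollification: g n stands for the density of \<rho> smoothed at the n-th
  scale. Of weak convergence only the lower bound on open sets is required, which is the half that
  Fatou's lemma delivers.\<close>

locale square_bounded_approx =
  fixes \<rho> L :: "'a::polish_space measure" and g :: "nat \<Rightarrow> 'a \<Rightarrow> ennreal" and C :: ennreal
  assumes fin: "finite_measure \<rho>" "finite_measure L"
    and sets_eq: "sets \<rho> = sets borel" "sets L = sets borel"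
    and g_meas [measurable]: "\<And>n. g n \<in> borel_measurable borel"
    and g_sq: "\<And>n. (\<integral>\<^sup>+x. (g n x)\<^sup>2 \<partial>L) \<le> C" and C: "C < \<top>"
    and le_liminf: "\<And>U. open U \<Longrightarrow> emeasure \<rho> U \<le> liminf (\<lambda>n. \<integral>\<^sup>+x. g n x * indicator U x \<partial>L)"
begin

declare sets_eq [measurable_cong]

lemma emeasure_open_le:
  assumes "open U" "0 < c" "c < \<top>"
  shows "emeasure \<rho> U \<le> c * C + emeasure L U / c"
proof -
  have [measurable]: "U \<in> sets borel" using assms by simp
  have "(\<integral>\<^sup>+x. g n x * indicator U x \<partial>L) \<le> c * C + emeasure L U / c" for n
  proof -
    have "(\<integral>\<^sup>+x. g n x * indicator U x \<partial>L) \<le> (\<integral>\<^sup>+x. c * (g n x)\<^sup>2 + (indicator U x)\<^sup>2 / c \<partial>L)"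
      by (intro nn_integral_mono ennreal_mult_le_squares assms)
    also have "\<dots> = c * (\<integral>\<^sup>+x. (g n x)\<^sup>2 \<partial>L) + (\<integral>\<^sup>+x. indicator U x \<partial>L) / c"
      by (simp add: nn_integral_add nn_integral_cmult nn_integral_divide power2_eq_square flip: indicator_inter_arith)
    also have "\<dots> \<le> c * C + emeasure L U / c"
      by (intro add_mono mult_left_mono g_sq) auto
    finally show ?thesis .
  qed
  then have "liminf (\<lambda>n. \<integral>\<^sup>+x. g n x * indicator U x \<partial>L) \<le> c * C + emeasure L U / c"
    by (intro Liminf_le) auto
  with le_liminf[OF assms(1)] show ?thesis by (rule order_trans)
qed

lemma absolutely_continuous_limit: "absolutely_continuous L \<rho>"
  unfolding absolutely_continuous_def
proof
  fix N assume N: "N \<in> null_sets L"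
  then have [measurable]: "N \<in> sets borel" using sets_eq by auto
  have "emeasure \<rho> N \<le> ennreal (1 / real (Suc n)) * (C + 1)" for n
  proof -
    let ?c = "ennreal (1 / real (Suc n))"
    have c: "0 < ?c" "?c < \<top>" by auto
    \<comment> \<open>An excess of order c^2 makes both terms of \<open>emeasure_open_le\<close>, c
      C and L(U) / c, of order c.\<close>
    obtain U where U: "open U" "N \<subseteq> U" "emeasure L (U - N) < ?c * ?c"
      by (rule outer_regular_null[of L N "?c * ?c"]) (use sets_eq fin c in \<open>auto simp: ennreal_zero_less_mult_iff\<close>)
    have "emeasure L U = emeasure L (U - N)"
      using U N by (intro emeasure_Diff_null_set[symmetric]) (auto simp: sets_eq)
    with U have lU: "emeasure L U \<le> ?c * ?c" by auto
    have "emeasure \<rho> N \<le> emeasure \<rho> U" using U by (intro emeasure_mono) (auto simp: sets_eq)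
    also have "\<dots> \<le> ?c * C + emeasure L U / ?c" by (intro emeasure_open_le U c)
    also have "emeasure L U / ?c \<le> ?c"
      using divide_right_mono_ennreal[OF lU, of ?c] c by (metis ennreal_mult_divide_eq not_gr_zero top.not_eq_extremum)
    finally show ?thesis by (simp add: distrib_left add_left_mono)
  qed
  moreover have "(\<lambda>n. ennreal (1 / real (Suc n)) * (C + 1)) \<longlonglongrightarrow> 0"
  proof -
    obtain r where r: "C + 1 = ennreal r" "0 \<le> r"
      using C by (cases "C + 1" rule: ennreal_cases) (auto simp: ennreal_add_eq_top)
    have "(\<lambda>n. 1 / real (Suc n) * r) \<longlonglongrightarrow> 0 * r"
      by (intro tendsto_mult tendsto_const LIMSEQ_Suc[OF lim_1_over_n])
    then have "(\<lambda>n. ennreal (1 / real (Suc n) * r)) \<longlonglongrightarrow> ennreal 0"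
      by (intro tendsto_ennrealI) simp
    then show ?thesis using r by (simp add: ennreal_mult[symmetric])
  qed
  ultimately have "emeasure \<rho> N \<le> 0"
    by (intro LIMSEQ_le_const[where x = 0]) auto
  then show "N \<in> null_sets \<rho>" by (auto intro!: null_setsI simp: sets_eq)
qed

text \<open>A duality argument: h is tested against \<rho> and the square of h is absorbed on the
  left. Since the approximation is known on open sets only, the level sets of h are enlarged to open
  sets, at the price of the additive 1.\<close>

lemma simple_le_density_square:
  assumes [measurable]: "f \<in> borel_measurable borel" and dens: "\<rho> = density L f"
    and h: "simple_function borel h" and h_le: "\<And>x. h x \<le> f x" and h_fin: "\<And>x. h x < \<top>"
  shows "(\<integral>\<^sup>+x. (h x)\<^sup>2 \<partial>L) \<le> 8 * C + 1"
proof -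
  interpret L: finite_measure L by (rule fin)
  define K where "K = range h"
  have finK: "finite K" using simple_functionD(1)[OF h] by (simp add: K_def)
  define A where "A = (\<lambda>k. h -` {k})"
  have [measurable]: "h \<in> borel_measurable borel" using h by (rule borel_measurable_simple_function)
  have A_meas [measurable]: "A k \<in> sets borel" for k
    using measurable_sets[of h borel borel "{k}"] by (simp add: A_def)
  have h_eq: "h x = (\<Sum>k\<in>K. k * indicator (A k) x)" for x
  proof -
    have "(\<Sum>k\<in>K. k * indicator (A k) x) = (\<Sum>k\<in>{h x}. k * indicator (A k) x)"
      using finK by (intro sum.mono_neutral_right) (auto simp: K_def A_def indicator_def)
    then show ?thesis by (simp add: A_def)
  qed
  have K_fin: "k < \<top>" if "k \<in> K" for k using that h_fin by (auto simp: K_def)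
  \<comment> \<open>Y bounds both h and its enlargement \<phi> everywhere; the summand 1 keeps it
    positive for the division in e.\<close>
  define Y where "Y = (\<Sum>k\<in>K. k) + 1"
  have "(\<Sum>k\<in>K. k) \<noteq> \<top>"
    using K_fin finK by (auto simp: less_top)
  then have Y: "0 < Y" "Y < \<top>" by (auto simp: Y_def ennreal_add_eq_top less_top[symmetric] intro: add_nonneg_pos)
  define m where "m = of_nat (card K) + (1::ennreal)"
  have m: "0 < m" "m < \<top>" by (auto simp: m_def ennreal_add_eq_top less_top[symmetric] intro: add_nonneg_pos)
  \<comment> \<open>Chosen so that the total excess D of the open sets satisfies Y^2 L(D) <= 1, so
    the enlargement costs a constant whatever h is.\<close>
  define e where "e = 1 / (Y\<^sup>2 * m)"
  have Ym: "Y\<^sup>2 * m < \<top>" "0 < Y\<^sup>2 * m" 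
    using Y m by (auto simp: ennreal_mult_less_top power2_eq_square ennreal_zero_less_mult_iff)
  have e: "0 < e" using Ym by (auto simp: e_def ennreal_zero_less_divide)
  have "\<exists>U. open U \<and> A k \<subseteq> U \<and> emeasure L (U - A k) < e" for k
    by (rule outer_regular_null[of L "A k" e]) (use sets_eq fin e in auto)
  then obtain U where U: "\<And>k. open (U k)" "\<And>k. A k \<subseteq> U k" "\<And>k. emeasure L (U k - A k) < e"
    by metis
  have [measurable]: "U k \<in> sets borel" for k using U by auto
  define \<phi> where "\<phi> = (\<lambda>x. \<Sum>k\<in>K. k * indicator (U k) x)"
  define D where "D = (\<Union>k\<in>K. U k - A k)"
  have [measurable]: "\<phi> \<in> borel_measurable borel" unfolding \<phi>_def by measurable
  have [measurable]: "D \<in> sets borel" using finK by (auto simp: D_def)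
  have phi_le: "\<phi> x \<le> h x + Y * indicator D x" for x
  proof (cases "x \<in> D")
    case True
    have "\<phi> x \<le> (\<Sum>k\<in>K. k)" unfolding \<phi>_def by (intro sum_mono) (auto simp: indicator_def)
    also have "\<dots> \<le> Y" by (simp add: Y_def)
    finally show ?thesis using True by (simp add: add_increasing)
  next
    case False
    then have "\<phi> x = h x" unfolding h_eq \<phi>_def using U(2)
      by (intro sum.cong) (auto simp: indicator_def D_def)
    then show ?thesis by simp
  qed
  have "emeasure L D \<le> (\<Sum>k\<in>K. emeasure L (U k - A k))"
    unfolding D_def using finK by (intro emeasure_subadditive_finite) (auto simp: sets_eq)
  also have "\<dots> \<le> (\<Sum>k\<in>K. e)" by (intro sum_mono less_imp_le U)
  also have "\<dots> = of_nat (card K) * e" by simp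
  also have "\<dots> \<le> m * e" by (intro mult_right_mono) (auto simp: m_def)
  finally have D_le: "emeasure L D \<le> m * e" .
  have YD: "Y\<^sup>2 * emeasure L D \<le> 1"
  proof -
    have "Y\<^sup>2 * emeasure L D \<le> Y\<^sup>2 * (m * e)" by (intro mult_left_mono D_le) auto
    also have "\<dots> = (Y\<^sup>2 * m) * (1 / (Y\<^sup>2 * m))" by (simp add: e_def mult.assoc)
    also have "\<dots> \<le> 1" using Ym by (simp add: ennreal_times_divide ennreal_divide_self zero_less_iff_neq_zero)
    finally show ?thesis .
  qed
  have phi2: "(\<phi> x)\<^sup>2 \<le> 2 * (h x)\<^sup>2 + 2 * (Y\<^sup>2 * indicator D x)" for x
  proof (cases "x \<in> D")
    case True
    have "(\<phi> x)\<^sup>2 \<le> (h x + Y)\<^sup>2" using phi_le[of x] True by (intro power_mono) auto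
    also have "\<dots> \<le> 2 * (h x)\<^sup>2 + 2 * Y\<^sup>2"
    proof -
      have "(a + b)\<^sup>2 \<le> 2 * a\<^sup>2 + 2 * b\<^sup>2" if fin: "a < \<top>" "b < \<top>" for a b :: ennreal
      proof -
        obtain r q where ab: "a = ennreal r" "b = ennreal q" "0 \<le> r" "0 \<le> q"
          using fin by (cases a; cases b) auto
        have "(r + q)\<^sup>2 \<le> 2 * r\<^sup>2 + 2 * q\<^sup>2"
          using sum_squares_bound[of r q] by (simp add: power2_sum)
        then have "ennreal ((r + q)\<^sup>2) \<le> ennreal (2 * r\<^sup>2 + 2 * q\<^sup>2)" by (rule ennreal_leI)
        moreover have "(a + b)\<^sup>2 = ennreal ((r + q)\<^sup>2)" using ab by (simp add: ennreal_power flip: ennreal_plus)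
        moreover have "2 * a\<^sup>2 + 2 * b\<^sup>2 = ennreal (2 * r\<^sup>2 + 2 * q\<^sup>2)" using ab by (simp add: ennreal_power ennreal_mult)
        ultimately show ?thesis by simp
      qed
      then show ?thesis using h_fin Y by auto
    qed
    finally show ?thesis using True by simp
  next
    case False
    then have "(\<phi> x)\<^sup>2 \<le> (h x)\<^sup>2" using phi_le[of x] by (intro power_mono) auto
    also have "\<dots> \<le> 2 * (h x)\<^sup>2" by (simp add: mult_2)
    finally show ?thesis using False by simp
  qed
  define I where "I = (\<integral>\<^sup>+x. (h x)\<^sup>2 \<partial>L)"
  \<comment> \<open>Finiteness of I is what allows the term I / 2 to be moved to the left-hand side
    at the end.\<close>
  have I_fin: "I < \<top>"
  proof -
    have "h x \<le> Y" for x
    proof -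
      have "h x \<le> (\<Sum>k\<in>K. k)" using finK by (intro member_le_sum) (auto simp: K_def)
      then show ?thesis unfolding Y_def by (rule order_trans) simp
    qed
    then have "I \<le> (\<integral>\<^sup>+x. Y\<^sup>2 \<partial>L)" unfolding I_def by (intro nn_integral_mono power_mono) auto
    also have "\<dots> < \<top>"
    proof -
      have "emeasure L (space L) < \<top>" by (simp flip: less_top)
      then show ?thesis using Y by (simp add: ennreal_mult_less_top power2_eq_square)
    qed
    finally show ?thesis .
  qed
  have phiI: "(\<integral>\<^sup>+x. (\<phi> x)\<^sup>2 \<partial>L) \<le> 2 * I + 2"
  proof -
    have "(\<integral>\<^sup>+x. (\<phi> x)\<^sup>2 \<partial>L) \<le> (\<integral>\<^sup>+x. 2 * (h x)\<^sup>2 + 2 * (Y\<^sup>2 * indicator D x) \<partial>L)"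
      by (intro nn_integral_mono phi2)
    also have "\<dots> = 2 * I + 2 * (Y\<^sup>2 * emeasure L D)"
      by (simp add: nn_integral_add nn_integral_cmult I_def)
    also have "\<dots> \<le> 2 * I + 2 * 1" by (intro add_left_mono mult_left_mono YD) auto
    finally show ?thesis by simp
  qed
  have "I \<le> (\<integral>\<^sup>+x. f x * h x \<partial>L)"
    unfolding I_def power2_eq_square by (intro nn_integral_mono mult_right_mono h_le) auto
  also have "\<dots> = (\<integral>\<^sup>+x. h x \<partial>\<rho>)"
    unfolding dens by (subst nn_integral_density) auto
  also have "\<dots> = (\<Sum>k\<in>K. k * emeasure \<rho> (A k))"
    unfolding h_eq by (subst nn_integral_sum) (auto simp: nn_integral_cmult)
  also have "\<dots> \<le> (\<Sum>k\<in>K. liminf (\<lambda>n. k * (\<integral>\<^sup>+x. g n x * indicator (U k) x \<partial>L)))"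
  proof (intro sum_mono)
    fix k assume k: "k \<in> K"
    have "k * emeasure \<rho> (A k) \<le> k * emeasure \<rho> (U k)"
      by (intro mult_left_mono emeasure_mono U) (auto simp: sets_eq)
    also have "\<dots> \<le> k * liminf (\<lambda>n. \<integral>\<^sup>+x. g n x * indicator (U k) x \<partial>L)"
      by (intro mult_left_mono le_liminf U) auto
    also have "\<dots> = liminf (\<lambda>n. k * (\<integral>\<^sup>+x. g n x * indicator (U k) x \<partial>L))"
      by (rule Liminf_compose_continuous_mono[symmetric])
        (use K_fin[OF k] in \<open>auto intro!: ennreal_continuous_on_cmult continuous_on_id monoI mult_left_mono\<close>)
    finally show "k * emeasure \<rho> (A k) \<le> \<dots>" .
  qed
  also have "\<dots> \<le> liminf (\<lambda>n. \<Sum>k\<in>K. k * (\<integral>\<^sup>+x. g n x * indicator (U k) x \<partial>L))"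
    by (rule sum_liminf_le[OF finK])
  \<comment> \<open>The weight 4 in Young's inequality leaves only half of I on the right.\<close>
  also have "\<dots> \<le> 4 * C + (2 * I + 2) / 4"
  proof (intro Liminf_le always_eventually allI)
    fix n
    have "(\<Sum>k\<in>K. k * (\<integral>\<^sup>+x. g n x * indicator (U k) x \<partial>L)) = (\<integral>\<^sup>+x. g n x * \<phi> x \<partial>L)"
      unfolding \<phi>_def sum_distrib_left
      by (subst nn_integral_sum) (auto simp: nn_integral_cmult[symmetric] mult_ac)
    also have "\<dots> \<le> (\<integral>\<^sup>+x. 4 * (g n x)\<^sup>2 + (\<phi> x)\<^sup>2 / 4 \<partial>L)"
      by (intro nn_integral_mono ennreal_mult_le_squares) auto
    also have "\<dots> = 4 * (\<integral>\<^sup>+x. (g n x)\<^sup>2 \<partial>L) + (\<integral>\<^sup>+x. (\<phi> x)\<^sup>2 \<partial>L) / 4"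
      by (simp add: nn_integral_add nn_integral_cmult nn_integral_divide)
    also have "\<dots> \<le> 4 * C + (2 * I + 2) / 4"
      by (intro add_mono mult_left_mono g_sq divide_right_mono_ennreal phiI) auto
    finally show "(\<Sum>k\<in>K. k * (\<integral>\<^sup>+x. g n x * indicator (U k) x \<partial>L)) \<le> 4 * C + (2 * I + 2) / 4" .
  qed simp
  finally have "I \<le> 4 * C + (2 * I + 2) / 4" .
  moreover obtain i c where ic: "I = ennreal i" "C = ennreal c" "0 \<le> i" "0 \<le> c"
    using I_fin C by (cases I; cases C) auto
  moreover have "4 * C + (2 * I + 2) / 4 = ennreal (4 * c + (2 * i + 2) / 4)"
    using ic by (simp add: ennreal_mult divide_ennreal[symmetric])
  ultimately have "i \<le> 4 * c + (2 * i + 2) / 4"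
    by (simp add: ennreal_le_iff del: ennreal_plus)
  then have "i \<le> 8 * c + 1" by (simp add: field_simps)
  then have "ennreal i \<le> ennreal (8 * c + 1)" by (rule ennreal_leI)
  then show ?thesis using ic by (simp add: I_def[symmetric] ennreal_mult)
qed

lemma density_square_integrable:
  obtains f where "f \<in> borel_measurable borel" "\<rho> = density L f" "(\<integral>\<^sup>+x. (f x)\<^sup>2 \<partial>L) < \<top>"
proof -
  interpret L: finite_measure L by (rule fin)
  obtain f where f: "f \<in> borel_measurable L" "density L f = \<rho>"
    using L.Radon_Nikodym[OF absolutely_continuous_limit] sets_eq by auto
  have f' [measurable]: "f \<in> borel_measurable borel" using f(1) by simp
  obtain h where h: "\<And>i. simple_function borel (h i)" "incseq h" "\<And>i x. h i x < \<top>" "\<And>x. (SUP i. h i x) = f x"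
    using borel_measurable_implies_simple_function_sequence'[OF f'] by blast
  have [measurable]: "h i \<in> borel_measurable borel" for i using h(1) by (rule borel_measurable_simple_function)
  have sq: "(f x)\<^sup>2 \<le> liminf (\<lambda>i. (h i x)\<^sup>2)" for x
  proof -
    have inc: "incseq (\<lambda>i. (h i x)\<^sup>2)"
      using h(2) by (auto simp: incseq_def le_fun_def intro!: power_mono)
    have "(f x)\<^sup>2 = (SUP i. SUP j. h i x * h j x)"
      by (simp add: power2_eq_square h(4)[symmetric] SUP_mult_left_ennreal SUP_mult_right_ennreal mult.commute)
    also have "\<dots> \<le> (SUP i. (h i x)\<^sup>2)"
    proof (intro SUP_least)
      fix i j
      have "h i x * h j x \<le> h (max i j) x * h (max i j) x"
        using h(2) by (intro mult_mono) (auto simp: incseq_def le_fun_def)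
      also have "\<dots> \<le> (SUP i. (h i x)\<^sup>2)"
        unfolding power2_eq_square by (rule SUP_upper) simp
      finally show "h i x * h j x \<le> (SUP i. (h i x)\<^sup>2)" .
    qed
    also have "\<dots> = liminf (\<lambda>i. (h i x)\<^sup>2)"
      using LIMSEQ_SUP[OF inc] by (simp add: lim_imp_Liminf)
    finally show ?thesis .
  qed
  have "(\<integral>\<^sup>+x. (f x)\<^sup>2 \<partial>L) \<le> (\<integral>\<^sup>+x. liminf (\<lambda>i. (h i x)\<^sup>2) \<partial>L)"
    by (intro nn_integral_mono sq)
  also have "\<dots> \<le> liminf (\<lambda>i. \<integral>\<^sup>+x. (h i x)\<^sup>2 \<partial>L)"
    by (rule nn_integral_liminf) auto
  also have "\<dots> \<le> 8 * C + 1"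
    by (intro Liminf_le always_eventually allI simple_le_density_square[of f])
      (use f f' h in \<open>auto simp: h(4)[symmetric] intro: SUP_upper\<close>)
  also have "\<dots> < \<top>" using C by (simp add: ennreal_add_eq_top ennreal_mult_eq_top_iff less_top[symmetric])
  finally show ?thesis using that[of f] f by auto
qed

end

section \<open>Frostman measures and their ray measures\<close>

lemma nn_integral_swap:
  assumes "sigma_finite_measure M" "sigma_finite_measure N"
    and "(\<lambda>z. f (fst z) (snd z)) \<in> borel_measurable (M \<Otimes>\<^sub>M N)"
  shows "(\<integral>\<^sup>+x. \<integral>\<^sup>+y. f x y \<partial>N \<partial>M) = (\<integral>\<^sup>+y. \<integral>\<^sup>+x. f x y \<partial>M \<partial>N)"
proof -
  interpret M: sigma_finite_measure M by fact
  interpret N: sigma_finite_measure N by fact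
  interpret pair_sigma_finite M N ..
  show ?thesis using Fubini[OF assms(3)] by simp
qed

lemma nn_integral_ball_indicator:
  fixes a :: "'b::euclidean_space"
  assumes "0 \<le> r"
  shows "(\<integral>\<^sup>+p. indicator {..<r} (norm (a - p)) \<partial>lborel) = ennreal (unit_ball_vol DIM('b) * r ^ DIM('b))"
proof -
  have "(\<integral>\<^sup>+p. indicator {..<r} (norm (a - p)) \<partial>lborel) = (\<integral>\<^sup>+p. indicator (ball a r) p \<partial>lborel)"
    by (intro nn_integral_cong) (auto simp: indicator_def dist_norm)
  then show ?thesis using assms by (simp add: emeasure_ball)
qed

text \<open>The kernels below have exponent \<tau> - d. The upper bound on \<tau> makes them
  decreasing, the lower bound makes the exponent exceed -1 and the kernels integrable on an
  interval.\<close>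

locale frostman_measure = prob_space \<mu>
  for \<mu> :: "'a::euclidean_space measure" +
  fixes R0 \<tau> c :: real
  assumes sets_mu: "sets \<mu> = sets borel"
    and tau: "real DIM('a) - 1 < \<tau>" "\<tau> < real DIM('a)"
    and R0: "0 < R0" and c: "0 < c"
    and mu_ball: "\<And>x r. 0 < r \<Longrightarrow> emeasure \<mu> (ball x r) \<le> ennreal (c * r powr \<tau>)"
    and mu_supp: "AE x in \<mu>. norm x < R0"
begin

declare sets_mu [measurable_cong]

lemma sigma_finite_mu: "sigma_finite_measure \<mu>" ..

lemma space_mu [simp]: "space \<mu> = UNIV"
  using sets_eq_imp_space_eq[OF sets_mu] by simp

text \<open>Where the integrand does not vanish, z is within e + R|\<sigma>| <= 2a of x, so the
  z-integral gives a^\<tau>. The vector v is confined to a ball of radius R or e / |\<sigma>|,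
  whichever is smaller, that is R e / a. The product is of order e^d a^(\<tau> - d), and this
  decreases in a >= R|\<sigma>|.\<close>

lemma strip_energy:
  assumes "0 < R" "0 < e" "\<sigma> \<noteq> 0"
  shows "(\<integral>\<^sup>+z. \<integral>\<^sup>+v. indicator {..<R} (norm v) * indicator {..<e} (norm (x - z + \<sigma> *\<^sub>R v)) \<partial>lborel \<partial>\<mu>)
    \<le> ennreal (unit_ball_vol DIM('a) * c * R ^ DIM('a) * 2 powr \<tau> * R powr (\<tau> - DIM('a)) * e ^ DIM('a) * \<bar>\<sigma>\<bar> powr (\<tau> - DIM('a)))"
proof -
  let ?d = "DIM('a)" and ?w = "unit_ball_vol (real DIM('a))"
  define a where "a = max e (R * \<bar>\<sigma>\<bar>)"
  have a: "0 < a" "e \<le> a" "R * \<bar>\<sigma>\<bar> \<le> a" using assms by (auto simp: a_def)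
  have inner: "(\<integral>\<^sup>+v. indicator {..<R} (norm v) * indicator {..<e} (norm (x - z + \<sigma> *\<^sub>R v)) \<partial>lborel)
      \<le> ennreal (?w * (R * e / a) ^ ?d) * indicator (ball x (2 * a)) z" for z
  proof (cases "norm (x - z) < 2 * a")
    case False
    have "indicator {..<R} (norm v) * indicator {..<e} (norm (x - z + \<sigma> *\<^sub>R v)) = (0::ennreal)" for v
    proof (rule ccontr)
      assume "\<not> ?thesis"
      then have "norm v < R" "norm (x - z + \<sigma> *\<^sub>R v) < e" by (auto simp: indicator_def split: if_splits)
      moreover have "norm (x - z) \<le> norm (x - z + \<sigma> *\<^sub>R v) + norm (\<sigma> *\<^sub>R v)"
        by (metis add_diff_cancel norm_triangle_ineq4)
      moreover have "norm (\<sigma> *\<^sub>R v) \<le> \<bar>\<sigma>\<bar> * R"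
        using \<open>norm v < R\<close> by (simp add: mult_left_mono)
      ultimately show False using False a by (simp add: mult.commute)
    qed
    then show ?thesis by (simp only: nn_integral_const) simp
  next
    case True
    have "(\<integral>\<^sup>+v. indicator {..<R} (norm v) * indicator {..<e} (norm (x - z + \<sigma> *\<^sub>R v)) \<partial>lborel)
        \<le> ennreal (?w * (R * e / a) ^ ?d)"
    proof (cases "R * \<bar>\<sigma>\<bar> \<le> e")
      case True
      then have "a = e" by (simp add: a_def)
      have "(\<integral>\<^sup>+v. indicator {..<R} (norm v) * indicator {..<e} (norm (x - z + \<sigma> *\<^sub>R v)) \<partial>lborel)
          \<le> (\<integral>\<^sup>+v. indicator (ball (0::'a) R) v \<partial>lborel)"
        by (intro nn_integral_mono) (auto simp: indicator_def)
      also have "\<dots> = ennreal (?w * R ^ ?d)"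
        using assms by (simp add: emeasure_ball)
      finally show ?thesis using \<open>a = e\<close> assms by simp
    next
      case False
      then have a_eq: "a = R * \<bar>\<sigma>\<bar>" by (simp add: a_def)
      have "(\<integral>\<^sup>+v. indicator {..<R} (norm v) * indicator {..<e} (norm (x - z + \<sigma> *\<^sub>R v)) \<partial>lborel)
          \<le> (\<integral>\<^sup>+v. indicator (ball ((1/\<sigma>) *\<^sub>R (z - x)) (e / \<bar>\<sigma>\<bar>)) v \<partial>lborel)"
      proof (intro nn_integral_mono)
        fix v
        have "v \<in> ball ((1/\<sigma>) *\<^sub>R (z - x)) (e / \<bar>\<sigma>\<bar>)" if "norm (x - z + \<sigma> *\<^sub>R v) < e"
        proof -
          have "(1/\<sigma>) *\<^sub>R (z - x) - v = - (1/\<sigma>) *\<^sub>R (x - z + \<sigma> *\<^sub>R v)"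
            using assms by (simp add: algebra_simps)
          then have "norm ((1/\<sigma>) *\<^sub>R (z - x) - v) = norm (x - z + \<sigma> *\<^sub>R v) / \<bar>\<sigma>\<bar>"
            by simp
          also have "\<dots> < e / \<bar>\<sigma>\<bar>" using that assms by (simp add: divide_strict_right_mono)
          finally show ?thesis by (simp add: dist_norm)
        qed
        then show "indicator {..<R} (norm v) * indicator {..<e} (norm (x - z + \<sigma> *\<^sub>R v))
          \<le> (indicator (ball ((1/\<sigma>) *\<^sub>R (z - x)) (e / \<bar>\<sigma>\<bar>)) v :: ennreal)"
          by (auto simp: indicator_def)
      qed
      also have "\<dots> = ennreal (?w * (e / \<bar>\<sigma>\<bar>) ^ ?d)"
        using assms by (simp add: emeasure_ball)
      finally show ?thesis using a_eq assms by simp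
    qed
    with True show ?thesis by (simp add: dist_norm)
  qed
  have "(\<integral>\<^sup>+z. \<integral>\<^sup>+v. indicator {..<R} (norm v) * indicator {..<e} (norm (x - z + \<sigma> *\<^sub>R v)) \<partial>lborel \<partial>\<mu>)
     \<le> (\<integral>\<^sup>+z. ennreal (?w * (R * e / a) ^ ?d) * indicator (ball x (2 * a)) z \<partial>\<mu>)"
    by (intro nn_integral_mono inner)
  also have "\<dots> = ennreal (?w * (R * e / a) ^ ?d) * emeasure \<mu> (ball x (2 * a))"
    by (subst nn_integral_cmult_indicator) auto
  also have "\<dots> \<le> ennreal (?w * (R * e / a) ^ ?d) * ennreal (c * (2 * a) powr \<tau>)"
    using a by (intro mult_left_mono mu_ball) auto
  also have "\<dots> = ennreal (?w * (R * e / a) ^ ?d * (c * (2 * a) powr \<tau>))"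
    using a assms by (intro ennreal_mult[symmetric]) (auto intro!: mult_nonneg_nonneg less_imp_le[OF c])
  also have "?w * (R * e / a) ^ ?d * (c * (2 * a) powr \<tau>) = ?w * c * R ^ ?d * 2 powr \<tau> * e ^ ?d * a powr (\<tau> - ?d)"
    using a by (simp add: power_divide power_mult_distrib powr_mult powr_diff powr_realpow)
  also have "a powr (\<tau> - ?d) \<le> (R * \<bar>\<sigma>\<bar>) powr (\<tau> - ?d)"
    using a assms tau by (intro powr_mono2') auto
  also have "(R * \<bar>\<sigma>\<bar>) powr (\<tau> - ?d) = R powr (\<tau> - ?d) * \<bar>\<sigma>\<bar> powr (\<tau> - ?d)"
    using assms by (simp add: powr_mult)
  finally show ?thesis 
    using assms c by (simp add: mult_ac ennreal_leI mult_left_mono)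
qed

text \<open>The exponent is larger than -1 exactly because \<tau> > d - 1. The bound 4 is the
  largest distance between two points of [-2, 2].\<close>

lemma singular_kernel_bound:
  obtains W where "W < \<top>"
    "\<And>s. \<bar>s\<bar> \<le> 2 \<Longrightarrow> (\<integral>\<^sup>+t. indicator {-2..2} t * ennreal (\<bar>s - t\<bar> powr (\<tau> - DIM('a))) \<partial>lborel) \<le> W"
proof
  let ?p = "\<tau> - real DIM('a)"
  define V where "V = (\<integral>\<^sup>+t. ennreal (t powr ?p) * indicator {0..4} t \<partial>lborel)"
  have "((\<lambda>x. x powr ?p) has_integral (4 powr (?p + 1) / (?p + 1))) {0..4}"
    using tau by (intro has_integral_powr_from_0) auto
  then have "V = ennreal (4 powr (?p + 1) / (?p + 1))"
    unfolding V_def by (intro nn_integral_has_integral_lebesgue') auto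
  then show "2 * V < \<top>" by (simp add: ennreal_mult_less_top)
  fix s :: real assume s: "\<bar>s\<bar> \<le> 2"
  have "(\<integral>\<^sup>+t. indicator {-2..2} t * ennreal (\<bar>s - t\<bar> powr ?p) \<partial>lborel)
    \<le> (\<integral>\<^sup>+t. ennreal ((s - t) powr ?p) * indicator {0..4} (s - t) + ennreal ((t - s) powr ?p) * indicator {0..4} (t - s) \<partial>lborel)"
    using s by (intro nn_integral_mono) (auto simp: indicator_def abs_if)
  also have "\<dots> = (\<integral>\<^sup>+t. ennreal ((s - t) powr ?p) * indicator {0..4} (s - t) \<partial>lborel) + (\<integral>\<^sup>+t. ennreal ((t - s) powr ?p) * indicator {0..4} (t - s) \<partial>lborel)"
    by (intro nn_integral_add) auto
  also have "(\<integral>\<^sup>+t. ennreal ((s - t) powr ?p) * indicator {0..4} (s - t) \<partial>lborel) = V"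
    using nn_integral_real_affine[of "\<lambda>t. ennreal (t powr ?p) * indicator {0..4} t" "-1" s]
    by (simp add: V_def)
  also have "(\<integral>\<^sup>+t. ennreal ((t - s) powr ?p) * indicator {0..4} (t - s) \<partial>lborel) = V"
    using nn_integral_real_affine[of "\<lambda>t. ennreal (t powr ?p) * indicator {0..4} t" "1" "-s"]
    by (simp add: V_def)
  finally show "(\<integral>\<^sup>+t. indicator {-2..2} t * ennreal (\<bar>s - t\<bar> powr ?p) \<partial>lborel) \<le> 2 * V"
    by (simp add: mult_2)
qed

text \<open>The interval [-2, 2] contains the shifts s in [0, 1] used for radial projections and all
  differences s - t with t in [1, 2].\<close>

definition seg :: "real measure" where
  "seg = density lborel (indicator {-2..2})"

definition rays :: "('a \<times> real) measure" where
  "rays = \<mu> \<Otimes>\<^sub>M seg"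

lemma sets_seg [measurable_cong]: "sets seg = sets borel"
  by (simp add: seg_def)

lemma finite_seg: "finite_measure seg"
  by (rule finite_measureI) (simp add: seg_def emeasure_density)

lemma sets_rays [measurable_cong]: "sets rays = sets borel"
  unfolding rays_def by (simp add: borel_prod[symmetric] sets_mu sets_seg cong: sets_pair_measure_cong)

lemma finite_rays: "finite_measure rays"
proof -
  interpret S: finite_measure seg by (rule finite_seg)
  interpret pair_sigma_finite \<mu> seg ..
  show ?thesis unfolding rays_def
    by (rule finite_measureI) (simp add: space_pair_measure emeasure_pair_measure_Times S.emeasure_finite ennreal_mult_eq_top_iff S.emeasure_pair_measure_Times)
qed

lemma nn_integral_rays:
  assumes "(\<lambda>z. h (fst z) (snd z)) \<in> borel_measurable (borel \<Otimes>\<^sub>M borel)"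
  shows "(\<integral>\<^sup>+\<theta>. h (fst \<theta>) (snd \<theta>) \<partial>rays) = (\<integral>\<^sup>+x. \<integral>\<^sup>+s. indicator {-2..2} s * h x s \<partial>lborel \<partial>\<mu>)"
proof -
  interpret S: finite_measure seg by (rule finite_seg)
  interpret pair_sigma_finite \<mu> seg ..
  have m: "(\<lambda>z. h (fst z) (snd z)) \<in> borel_measurable (\<mu> \<Otimes>\<^sub>M seg)"
    using assms by (simp add: sets_mu sets_seg cong: measurable_cong_sets sets_pair_measure_cong)
  have "h x \<in> borel_measurable borel" for x
    using measurable_compose_Pair1[OF _ assms, of x] by simp
  then have "(\<integral>\<^sup>+s. h x s \<partial>seg) = (\<integral>\<^sup>+s. indicator {-2..2} s * h x s \<partial>lborel)" for x
    unfolding seg_def by (subst nn_integral_density) auto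
  then show ?thesis
    unfolding rays_def using S.nn_integral_fst[OF m] by simp
qed

definition ray_pt :: "'a \<times> real \<Rightarrow> 'a \<Rightarrow> 'a" where
  "ray_pt \<theta> v = fst \<theta> + snd \<theta> *\<^sub>R v"

lemma ray_pt_measurable [measurable]: "(\<lambda>z. ray_pt (f z) (g z)) \<in> borel_measurable M"
  if [measurable]: "f \<in> borel_measurable M" "g \<in> borel_measurable M"
proof -
  have "continuous_on UNIV (\<lambda>z::('a \<times> real) \<times> 'a. fst (fst z) + snd (fst z) *\<^sub>R snd z)"
    by (intro continuous_intros)
  then have "(\<lambda>z::('a \<times> real) \<times> 'a. fst (fst z) + snd (fst z) *\<^sub>R snd z) \<in> borel_measurable borel"
    by (rule borel_measurable_continuous_onI)
  from measurable_compose[OF borel_measurable_Pair[OF that] this]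
  show ?thesis by (simp add: ray_pt_def)
qed

text \<open>For fixed parameters the two ray points differ by x - z + (s - t) v, so
  \<open>strip_energy\<close> applies with \<sigma> = s - t and leaves a kernel in s - t that is
  integrable. The order e^d is the one a law with square integrable density has to show.\<close>

lemma rays_energy:
  assumes "0 < R"
  obtains K where "K < \<top>"
    "\<And>e. 0 < e \<Longrightarrow> (\<integral>\<^sup>+\<theta>. \<integral>\<^sup>+\<theta>'. \<integral>\<^sup>+v. indicator {..<R} (norm v) *
       indicator {..<e} (norm (ray_pt \<theta> v - ray_pt \<theta>' v)) \<partial>lborel \<partial>rays \<partial>rays) \<le> K * ennreal (e ^ DIM('a))"
proof -
  let ?p = "\<tau> - real DIM('a)"
  obtain W where W: "W < \<top>"
    "\<And>s. \<bar>s\<bar> \<le> 2 \<Longrightarrow> (\<integral>\<^sup>+t. indicator {-2..2} t * ennreal (\<bar>s - t\<bar> powr ?p) \<partial>lborel) \<le> W"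
    using singular_kernel_bound by metis
  define k where "k = unit_ball_vol DIM('a) * c * R ^ DIM('a) * 2 powr \<tau> * R powr ?p"
  have k: "0 \<le> k" using assms c by (auto simp: k_def)
  define F where "F = (\<lambda>e \<theta> \<theta>'. \<integral>\<^sup>+v. indicator {..<R} (norm v) *
       indicator {..<e} (norm (ray_pt \<theta> v - ray_pt \<theta>' v)) \<partial>lborel)"
  have inner: "(\<integral>\<^sup>+\<theta>'. F e (x, s) \<theta>' \<partial>rays) \<le> ennreal (k * e ^ DIM('a)) * W" if "0 < e" "\<bar>s\<bar> \<le> 2" for e x s
  proof -
    have m: "(\<lambda>z. F e (x, s) (fst z, snd z)) \<in> borel_measurable (borel \<Otimes>\<^sub>M borel)"
      unfolding F_def by measurable
    have "(\<integral>\<^sup>+\<theta>'. F e (x, s) \<theta>' \<partial>rays) = (\<integral>\<^sup>+z. \<integral>\<^sup>+t. indicator {-2..2} t * F e (x, s) (z, t) \<partial>lborel \<partial>\<mu>)"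
      using nn_integral_rays[OF m] by simp
    also have "\<dots> = (\<integral>\<^sup>+t. \<integral>\<^sup>+z. indicator {-2..2} t * F e (x, s) (z, t) \<partial>\<mu> \<partial>lborel)"
      by (intro nn_integral_swap sigma_finite_mu sigma_finite_lborel) (use m in measurable)
    also have "\<dots> = (\<integral>\<^sup>+t. indicator {-2..2} t * (\<integral>\<^sup>+z. F e (x, s) (z, t) \<partial>\<mu>) \<partial>lborel)"
      by (intro nn_integral_cong nn_integral_cmult) (unfold F_def, measurable)
    also have "\<dots> \<le> (\<integral>\<^sup>+t. indicator {-2..2} t * ennreal (k * e ^ DIM('a) * \<bar>s - t\<bar> powr ?p) \<partial>lborel)"
    proof (intro nn_integral_mono_AE)
      \<comment> \<open>\<open>strip_energy\<close> excludes \<sigma> = 0, that is t = s, which is a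
        Lebesgue null set.\<close>
      have "AE t in lborel. t \<noteq> s" by (rule AE_lborel_singleton)
      then show "AE t in lborel. indicator {-2..2} t * (\<integral>\<^sup>+z. F e (x, s) (z, t) \<partial>\<mu>)
          \<le> indicator {-2..2} t * ennreal (k * e ^ DIM('a) * \<bar>s - t\<bar> powr ?p)"
      proof eventually_elim
        case (elim t)
        have "norm (ray_pt (x, s) v - ray_pt (z, t) v) = norm (x - z + (s - t) *\<^sub>R v)" for z v
          by (simp add: ray_pt_def algebra_simps)
        then have "(\<integral>\<^sup>+z. F e (x, s) (z, t) \<partial>\<mu>) \<le> ennreal (k * e ^ DIM('a) * \<bar>s - t\<bar> powr ?p)"
          unfolding F_def using strip_energy[OF assms \<open>0 < e\<close>, of "s - t" x] elim by (simp add: k_def)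
        then show ?case by (rule mult_left_mono) simp
      qed
    qed
    also have "\<dots> = (\<integral>\<^sup>+t. ennreal (k * e ^ DIM('a)) * (indicator {-2..2} t * ennreal (\<bar>s - t\<bar> powr ?p)) \<partial>lborel)"
      using k that by (intro nn_integral_cong) (simp add: ennreal_mult mult_ac)
    also have "\<dots> = ennreal (k * e ^ DIM('a)) * (\<integral>\<^sup>+t. indicator {-2..2} t * ennreal (\<bar>s - t\<bar> powr ?p) \<partial>lborel)"
      by (rule nn_integral_cmult) measurable
    also have "\<dots> \<le> ennreal (k * e ^ DIM('a)) * W"
      using W that by (intro mult_left_mono) auto
    finally show ?thesis .
  qed
  show ?thesis
  proof
    show "4 * (ennreal k * W) < \<top>" using W by (simp add: ennreal_mult_less_top)
    fix e :: real assume e: "0 < e"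
    interpret rays: finite_measure rays by (rule finite_rays)
    have m: "(\<lambda>\<theta>. \<integral>\<^sup>+\<theta>'. F e \<theta> \<theta>' \<partial>rays) \<in> borel_measurable borel"
    proof (rule rays.borel_measurable_nn_integral)
      show "(\<lambda>(x, y). F e x y) \<in> borel_measurable (borel \<Otimes>\<^sub>M rays)"
        unfolding F_def by measurable
    qed
    have m': "(\<lambda>z. \<integral>\<^sup>+\<theta>'. F e (fst z, snd z) \<theta>' \<partial>rays) \<in> borel_measurable (borel \<Otimes>\<^sub>M borel)"
      using m by (simp add: borel_prod)
    have "(\<integral>\<^sup>+\<theta>. \<integral>\<^sup>+\<theta>'. F e \<theta> \<theta>' \<partial>rays \<partial>rays) =
       (\<integral>\<^sup>+x. \<integral>\<^sup>+s. indicator {-2..2} s * (\<integral>\<^sup>+\<theta>'. F e (x, s) \<theta>' \<partial>rays) \<partial>lborel \<partial>\<mu>)"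
      using nn_integral_rays[OF m'] by simp
    also have "\<dots> \<le> (\<integral>\<^sup>+x. \<integral>\<^sup>+(s::real). indicator {-2..2} s * (ennreal (k * e ^ DIM('a)) * W) \<partial>lborel \<partial>\<mu>)"
      using inner[OF e] by (intro nn_integral_mono) (auto simp: indicator_def)
    also have "\<dots> = 4 * (ennreal (k * e ^ DIM('a)) * W)"
      using emeasure_space_1 by (simp add: nn_integral_multc)
    also have "\<dots> = 4 * (ennreal k * W) * ennreal (e ^ DIM('a))"
      using k e by (simp add: ennreal_mult mult_ac)
    finally show "(\<integral>\<^sup>+\<theta>. \<integral>\<^sup>+\<theta>'. \<integral>\<^sup>+v. indicator {..<R} (norm v) *
       indicator {..<e} (norm (ray_pt \<theta> v - ray_pt \<theta>' v)) \<partial>lborel \<partial>rays \<partial>rays)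
       \<le> 4 * (ennreal k * W) * ennreal (e ^ DIM('a))"
      unfolding F_def .
  qed
qed

lemma dist_ray_pt_less:
  assumes "norm x < R0" "\<bar>s\<bar> \<le> 2" "norm v < R"
  shows "norm (ray_pt (x, s) v) < R0 + 2 * R"
proof -
  have "norm (ray_pt (x, s) v) \<le> norm x + \<bar>s\<bar> * norm v"
    unfolding ray_pt_def by (simp add: norm_triangle_le)
  also have "\<bar>s\<bar> * norm v \<le> 2 * R"
    using assms by (intro mult_mono) auto
  finally show ?thesis using assms by simp
qed

text \<open>
  The law of \<open>(v, x + s v)\<close>, with \<open>x\<close> distributed by \<open>\<mu>\<close> and \<open>v, s\<close> by Lebesgue measure, has a
  square integrable density. This is where \<open>\<tau> > d - 1\<close> enters.
\<close>
lemma rays_density: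
  assumes R: "0 < R"
  obtains f :: "'a \<times> 'a \<Rightarrow> ennreal" where "f \<in> borel_measurable borel" "(\<integral>\<^sup>+y. (f y)\<^sup>2 \<partial>lborel) < \<top>"
    "\<And>h. h \<in> borel_measurable borel \<Longrightarrow>
      (\<integral>\<^sup>+v. \<integral>\<^sup>+\<theta>. indicator {..<R} (norm v) * h (v, ray_pt \<theta> v) \<partial>rays \<partial>lborel) = (\<integral>\<^sup>+y. f y * h y \<partial>lborel)"
proof -
  interpret rays: finite_measure rays by (rule finite_rays)
  interpret P: pair_sigma_finite "lborel :: 'a measure" rays ..
  let ?d = "DIM('a)"
  define w where "w = unit_ball_vol (real ?d)"
  have w: "0 < w" by (simp add: w_def)
  define B where "B = density lborel (\<lambda>v::'a. indicator {..<R} (norm v) :: ennreal)"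
  have setsB [measurable_cong]: "sets B = sets borel" by (simp add: B_def)
  have finB: "finite_measure B"
  proof (rule finite_measureI)
    have "emeasure B (space B) = (\<integral>\<^sup>+v. indicator {..<R} (norm v) \<partial>(lborel :: 'a measure))"
      unfolding B_def by (subst emeasure_density) auto
    also have "\<dots> = (\<integral>\<^sup>+v. indicator (ball (0::'a) R) v \<partial>lborel)"
      by (intro nn_integral_cong) (auto simp: indicator_def)
    also have "\<dots> < \<infinity>" using R by (simp add: emeasure_ball)
    finally show "emeasure B (space B) \<noteq> \<infinity>" by simp
  qed
  interpret B: finite_measure B by (rule finB)
  interpret PB: pair_sigma_finite B rays ..
  define \<rho> where "\<rho> = distr (B \<Otimes>\<^sub>M rays) borel (\<lambda>(v, \<theta>). (v, ray_pt \<theta> v))"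
  have nn_rho: "(\<integral>\<^sup>+y. h y \<partial>\<rho>) = (\<integral>\<^sup>+v. \<integral>\<^sup>+\<theta>. indicator {..<R} (norm v) * h (v, ray_pt \<theta> v) \<partial>rays \<partial>lborel)"
    if [measurable]: "h \<in> borel_measurable borel" for h
  proof -
    have "(\<integral>\<^sup>+y. h y \<partial>\<rho>) = (\<integral>\<^sup>+v. \<integral>\<^sup>+\<theta>. h (v, ray_pt \<theta> v) \<partial>rays \<partial>B)"
      unfolding \<rho>_def by (simp add: nn_integral_distr rays.nn_integral_fst[symmetric])
    also have "\<dots> = (\<integral>\<^sup>+v. indicator {..<R} (norm v) * (\<integral>\<^sup>+\<theta>. h (v, ray_pt \<theta> v) \<partial>rays) \<partial>lborel)"
      unfolding B_def by (subst nn_integral_density) auto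
    also have "\<dots> = (\<integral>\<^sup>+v. \<integral>\<^sup>+\<theta>. indicator {..<R} (norm v) * h (v, ray_pt \<theta> v) \<partial>rays \<partial>lborel)"
      by (intro nn_integral_cong nn_integral_cmult[symmetric]) measurable
    finally show ?thesis .
  qed
  \<comment> \<open>Ray points have norm below R0 + 2 R and the smoothing radius is at most 1, so
    the smoothed law does not leave D.\<close>
  define Q where "Q = R0 + 2 * R + 1"
  define D where "D = (ball 0 R \<times> ball 0 Q :: ('a \<times> 'a) set)"
  have [measurable]: "D \<in> sets borel" by (auto simp: D_def intro!: borel_open open_Times)
  define L where "L = density lborel (indicator D :: _ \<Rightarrow> ennreal)"
  have setsL [measurable_cong]: "sets L = sets borel" by (simp add: L_def)
  have finL: "finite_measure L"
  proof (rule finite_measureI)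
    have "emeasure L (space L) = emeasure lborel D"
      unfolding L_def by (simp add: emeasure_density)
    also have "\<dots> = emeasure lborel (ball (0::'a) R) * emeasure lborel (ball (0::'a) Q)"
      unfolding D_def lborel_prod[symmetric] by (rule lborel.emeasure_pair_measure_Times) auto
    also have "\<dots> < \<infinity>" using R R0 by (simp add: emeasure_ball Q_def ennreal_mult_less_top)
    finally show "emeasure L (space L) \<noteq> \<infinity>" by simp
  qed
  have nn_L: "(\<integral>\<^sup>+y. h y \<partial>L) = (\<integral>\<^sup>+v. \<integral>\<^sup>+p. indicator D (v, p) * h (v, p) \<partial>lborel \<partial>lborel)"
    if [measurable]: "h \<in> borel_measurable borel" for h
  proof -
    have m: "(\<lambda>y. indicator D y * h y) \<in> borel_measurable (lborel \<Otimes>\<^sub>M lborel)"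
      unfolding lborel_prod by measurable
    have "(\<integral>\<^sup>+y. h y \<partial>L) = (\<integral>\<^sup>+y. indicator D y * h y \<partial>lborel)"
      unfolding L_def by (subst nn_integral_density) auto
    also have "\<dots> = (\<integral>\<^sup>+y. indicator D y * h y \<partial>(lborel \<Otimes>\<^sub>M lborel))"
      by (simp only: lborel_prod)
    also have "\<dots> = (\<integral>\<^sup>+v. \<integral>\<^sup>+p. indicator D (v, p) * h (v, p) \<partial>lborel \<partial>lborel)"
      by (rule lborel.nn_integral_fst[OF m, symmetric])
    finally show ?thesis .
  qed
  define e where "e = (\<lambda>n. 1 / real (Suc n))"
  have e: "0 < e n" "e n \<le> 1" for n by (auto simp: e_def)
  have e_lim: "e \<longlonglongrightarrow> 0" unfolding e_def by (rule LIMSEQ_Suc[OF lim_1_over_n])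
  define k where "k = (\<lambda>n. ennreal (1 / (w * e n ^ ?d)))"
  have k_eq: "k n * ennreal (w * e n ^ ?d) = 1" for n
    using w e[of n] by (simp add: k_def ennreal_mult[symmetric] ennreal_1[symmetric] del: ennreal_1)
  \<comment> \<open>Smoothing takes place over balls in the second coordinate only, since v already
    has Lebesgue measure as its law.\<close>
  define g where "g = (\<lambda>n y. k n * (\<integral>\<^sup>+\<theta>. indicator {..<R} (norm (fst y)) * indicator {..<e n} (norm (ray_pt \<theta> (fst y) - snd y)) \<partial>rays))"
  have g_meas [measurable]: "g n \<in> borel_measurable borel" for n
  proof -
    have "(\<lambda>z. indicator {..<R} (norm (fst (fst z))) * indicator {..<e n} (norm (ray_pt (snd z) (fst (fst z)) - snd (fst z))) :: ennreal)
        \<in> borel_measurable ((borel \<Otimes>\<^sub>M borel) \<Otimes>\<^sub>M rays)"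
      by measurable
    then have [measurable]: "(\<lambda>y. \<integral>\<^sup>+\<theta>. indicator {..<R} (norm (fst y)) * indicator {..<e n} (norm (ray_pt \<theta> (fst y) - snd y)) \<partial>rays) 
        \<in> borel_measurable (borel \<Otimes>\<^sub>M borel)"
      by (intro rays.borel_measurable_nn_integral) (simp add: split_beta')
    have "g n \<in> borel_measurable (borel \<Otimes>\<^sub>M borel)" unfolding g_def by measurable
    then show ?thesis by (simp only: borel_prod)
  qed
  obtain K where K: "K < \<top>"
    "\<And>e. 0 < e \<Longrightarrow> (\<integral>\<^sup>+\<theta>. \<integral>\<^sup>+\<theta>'. \<integral>\<^sup>+v. indicator {..<R} (norm v) *
       indicator {..<e} (norm (ray_pt \<theta> v - ray_pt \<theta>' v)) \<partial>lborel \<partial>rays \<partial>rays) \<le> K * ennreal (e ^ ?d)"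
    by (rule rays_energy[OF R]) (rule that)
  have ball_int: "(\<integral>\<^sup>+p. indicator {..<r} (norm (a - p)) \<partial>lborel) = ennreal (w * r ^ ?d)" if "0 \<le> r" for a :: 'a and r
    unfolding w_def using that by (rule nn_integral_ball_indicator)
  have g_sq: "(\<integral>\<^sup>+y. (g n y)\<^sup>2 \<partial>L) \<le> ennreal (2 ^ ?d / w) * K" for n
  proof -
    define u where "u = (\<lambda>v p \<theta>. indicator {..<R} (norm v) * indicator {..<e n} (norm (ray_pt \<theta> v - p)) :: ennreal)"
    have [measurable]: "(\<lambda>z. u (v z) (p z) (\<theta> z)) \<in> borel_measurable M" 
      if [measurable]: "v \<in> borel_measurable M" "p \<in> borel_measurable M" "\<theta> \<in> borel_measurable M" for M :: "'z measure" and v p \<theta>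
      unfolding u_def by measurable
    have sq: "(\<integral>\<^sup>+\<theta>. u v p \<theta> \<partial>rays)\<^sup>2 = (\<integral>\<^sup>+\<theta>. \<integral>\<^sup>+\<theta>'. u v p \<theta> * u v p \<theta>' \<partial>rays \<partial>rays)" for v p
      by (simp add: power2_eq_square nn_integral_cmult nn_integral_multc)
    have "(\<integral>\<^sup>+y. (g n y)\<^sup>2 \<partial>L) \<le> (\<integral>\<^sup>+v. \<integral>\<^sup>+p. (g n (v, p))\<^sup>2 \<partial>lborel \<partial>lborel)"
      by (subst nn_L) (auto intro!: nn_integral_mono simp: indicator_def)
    also have "\<dots> = (\<integral>\<^sup>+v. \<integral>\<^sup>+p. (k n)\<^sup>2 * (\<integral>\<^sup>+\<theta>. \<integral>\<^sup>+\<theta>'. u v p \<theta> * u v p \<theta>' \<partial>rays \<partial>rays) \<partial>lborel \<partial>lborel)"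
      unfolding sq[symmetric] by (simp add: g_def u_def power_mult_distrib)
    also have "\<dots> = (k n)\<^sup>2 * (\<integral>\<^sup>+v. \<integral>\<^sup>+p. \<integral>\<^sup>+\<theta>. \<integral>\<^sup>+\<theta>'. u v p \<theta> * u v p \<theta>' \<partial>rays \<partial>rays \<partial>lborel \<partial>lborel)"
      by (simp add: nn_integral_cmult)
    also have "(\<integral>\<^sup>+v. \<integral>\<^sup>+p. \<integral>\<^sup>+\<theta>. \<integral>\<^sup>+\<theta>'. u v p \<theta> * u v p \<theta>' \<partial>rays \<partial>rays \<partial>lborel \<partial>lborel)
        = (\<integral>\<^sup>+v. \<integral>\<^sup>+\<theta>. \<integral>\<^sup>+p. \<integral>\<^sup>+\<theta>'. u v p \<theta> * u v p \<theta>' \<partial>rays \<partial>lborel \<partial>rays \<partial>lborel)"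
      by (intro nn_integral_cong nn_integral_swap sigma_finite_lborel rays.sigma_finite_measure_axioms) measurable
    also have "\<dots> = (\<integral>\<^sup>+v. \<integral>\<^sup>+\<theta>. \<integral>\<^sup>+\<theta>'. \<integral>\<^sup>+p. u v p \<theta> * u v p \<theta>' \<partial>lborel \<partial>rays \<partial>rays \<partial>lborel)"
      by (intro nn_integral_cong nn_integral_swap sigma_finite_lborel rays.sigma_finite_measure_axioms) measurable
    also have "\<dots> \<le> (\<integral>\<^sup>+v. \<integral>\<^sup>+\<theta>. \<integral>\<^sup>+\<theta>'. ennreal (w * e n ^ ?d) * (indicator {..<R} (norm v) * indicator {..<2 * e n} (norm (ray_pt \<theta> v - ray_pt \<theta>' v))) \<partial>rays \<partial>rays \<partial>lborel)"
    proof (intro nn_integral_mono)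
      fix v \<theta> \<theta>'
      \<comment> \<open>Two ray points within e n of a common p are within 2 e n of each other. This
        turns the square of g n into the energy at scale 2 e n, and integrating out p contributes
        one ball volume.\<close>
      have "u v p \<theta> * u v p \<theta>' \<le> indicator {..<R} (norm v) * indicator {..<2 * e n} (norm (ray_pt \<theta> v - ray_pt \<theta>' v)) * indicator {..<e n} (norm (ray_pt \<theta> v - p))" for p
      proof -
        have "norm (ray_pt \<theta> v - ray_pt \<theta>' v) \<le> norm (ray_pt \<theta> v - p) + norm (ray_pt \<theta>' v - p)"
          by norm
        then show ?thesis by (auto simp: u_def indicator_def)
      qed
      then have "(\<integral>\<^sup>+p. u v p \<theta> * u v p \<theta>' \<partial>lborel) \<le> (\<integral>\<^sup>+p. indicator {..<R} (norm v) * indicator {..<2 * e n} (norm (ray_pt \<theta> v - ray_pt \<theta>' v)) * indicator {..<e n} (norm (ray_pt \<theta> v - p)) \<partial>lborel)"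
        by (intro nn_integral_mono)
      also have "\<dots> = indicator {..<R} (norm v) * indicator {..<2 * e n} (norm (ray_pt \<theta> v - ray_pt \<theta>' v)) * ennreal (w * e n ^ ?d)"
        using ball_int[of "e n"] e[of n] by (simp add: nn_integral_cmult)
      finally show "(\<integral>\<^sup>+p. u v p \<theta> * u v p \<theta>' \<partial>lborel) \<le> ennreal (w * e n ^ ?d) * (indicator {..<R} (norm v) * indicator {..<2 * e n} (norm (ray_pt \<theta> v - ray_pt \<theta>' v)))"
        by (simp add: mult_ac)
    qed
    also have "\<dots> = ennreal (w * e n ^ ?d) * (\<integral>\<^sup>+v. \<integral>\<^sup>+\<theta>. \<integral>\<^sup>+\<theta>'. indicator {..<R} (norm v) * indicator {..<2 * e n} (norm (ray_pt \<theta> v - ray_pt \<theta>' v)) \<partial>rays \<partial>rays \<partial>lborel)"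
      by (simp add: nn_integral_cmult)
    also have "(\<integral>\<^sup>+v. \<integral>\<^sup>+\<theta>. \<integral>\<^sup>+\<theta>'. indicator {..<R} (norm v) * indicator {..<2 * e n} (norm (ray_pt \<theta> v - ray_pt \<theta>' v)) \<partial>rays \<partial>rays \<partial>lborel)
        = (\<integral>\<^sup>+\<theta>. \<integral>\<^sup>+v. \<integral>\<^sup>+\<theta>'. indicator {..<R} (norm v) * indicator {..<2 * e n} (norm (ray_pt \<theta> v - ray_pt \<theta>' v)) \<partial>rays \<partial>lborel \<partial>rays)"
      by (intro nn_integral_swap sigma_finite_lborel rays.sigma_finite_measure_axioms) measurable
    also have "\<dots> = (\<integral>\<^sup>+\<theta>. \<integral>\<^sup>+\<theta>'. \<integral>\<^sup>+v. indicator {..<R} (norm v) * indicator {..<2 * e n} (norm (ray_pt \<theta> v - ray_pt \<theta>' v)) \<partial>lborel \<partial>rays \<partial>rays)"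
      by (intro nn_integral_cong nn_integral_swap sigma_finite_lborel rays.sigma_finite_measure_axioms) measurable
    also have "\<dots> \<le> K * ennreal ((2 * e n) ^ ?d)" using e by (intro K) simp
    finally have "(\<integral>\<^sup>+y. (g n y)\<^sup>2 \<partial>L) \<le> (k n)\<^sup>2 * (ennreal (w * e n ^ ?d) * (K * ennreal ((2 * e n) ^ ?d)))"
      by (simp add: mult_left_mono)
    also have "\<dots> = (k n * ennreal (w * e n ^ ?d)) * (k n * ennreal ((2 * e n) ^ ?d)) * K"
      by (simp add: power2_eq_square mult_ac)
    also have "k n * ennreal ((2 * e n) ^ ?d) = ennreal (2 ^ ?d / w)"
      using w e[of n] by (simp add: k_def ennreal_mult[symmetric] power_mult_distrib)
    finally show ?thesis by (simp add: k_eq)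
  qed
  have lim: "emeasure \<rho> U \<le> liminf (\<lambda>n. \<integral>\<^sup>+y. g n y * indicator U y \<partial>L)" if U: "open U" for U
  proof -
    have [measurable]: "U \<in> sets borel" using U by simp
    define \<phi> where "\<phi> = (\<lambda>n v \<theta>. \<integral>\<^sup>+p. k n * indicator {..<R} (norm v) * indicator (D \<inter> U) (v, p) * indicator {..<e n} (norm (ray_pt \<theta> v - p)) \<partial>lborel)"
    have [measurable]: "(\<lambda>z. \<phi> n (v z) (\<theta> z)) \<in> borel_measurable M" 
      if [measurable]: "v \<in> borel_measurable M" "\<theta> \<in> borel_measurable M" for M :: "'z measure" and v \<theta> n
      unfolding \<phi>_def by measurable
    have key: "indicator {..<R} (norm v) * indicator U (v, ray_pt \<theta> v) \<le> liminf (\<lambda>n. \<phi> n v \<theta>)"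
      if \<theta>: "norm (fst \<theta>) < R0" "\<bar>snd \<theta>\<bar> \<le> 2" for v \<theta>
    proof (cases "norm v < R \<and> (v, ray_pt \<theta> v) \<in> U")
      case False
      then show ?thesis by (auto simp: indicator_def)
    next
      case True
      have nq: "norm (ray_pt \<theta> v) < R0 + 2 * R"
        using dist_ray_pt_less[of "fst \<theta>" "snd \<theta>" v R] \<theta> True by simp
      have "open ((\<lambda>p. (v, p)) -` U)" 
        by (intro open_vimage U continuous_intros)
      moreover have "ray_pt \<theta> v \<in> (\<lambda>p. (v, p)) -` U" using True by simp
      ultimately obtain r where r: "0 < r" "ball (ray_pt \<theta> v) r \<subseteq> (\<lambda>p. (v, p)) -` U"
        unfolding open_contains_ball by blast
      have "\<forall>\<^sub>F n in sequentially. e n < r"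
        using order_tendstoD(2)[OF e_lim r(1)] .
      then have "\<forall>\<^sub>F n in sequentially. 1 \<le> \<phi> n v \<theta>"
      proof eventually_elim
        case (elim n)
        have "indicator (D \<inter> U) (v, p) * indicator {..<e n} (norm (ray_pt \<theta> v - p)) = (indicator {..<e n} (norm (ray_pt \<theta> v - p)) :: ennreal)" for p
        proof (cases "norm (ray_pt \<theta> v - p) < e n")
          case lt: True
          then have "(v, p) \<in> U" using r elim by (auto simp: dist_norm subset_iff)
          moreover have "norm p < Q"
          proof -
            have "norm p \<le> norm (ray_pt \<theta> v) + norm (ray_pt \<theta> v - p)" by norm
            then show ?thesis using nq lt e(2)[of n] by (simp add: Q_def)
          qed
          ultimately show ?thesis using True by (auto simp: D_def indicator_def)
        qed (auto simp: indicator_def)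
        then have "\<phi> n v \<theta> = (\<integral>\<^sup>+p. k n * indicator {..<e n} (norm (ray_pt \<theta> v - p)) \<partial>lborel)"
          using True unfolding \<phi>_def by (simp add: mult.assoc)
        also have "\<dots> = k n * ennreal (w * e n ^ ?d)"
          using ball_int[of "e n" "ray_pt \<theta> v"] e[of n] by (simp add: nn_integral_cmult)
        finally show ?case by (simp add: k_eq)
      qed
      then have "1 \<le> liminf (\<lambda>n. \<phi> n v \<theta>)" by (rule Liminf_bounded)
      then show ?thesis using True by simp
    qed
    have AE_rays: "AE \<theta> in rays. norm (fst \<theta>) < R0 \<and> \<bar>snd \<theta>\<bar> \<le> 2"
    proof -
      interpret S: finite_measure seg by (rule finite_seg)
      interpret PS: pair_sigma_finite \<mu> seg ..
      have seg2: "AE s in seg. \<bar>s\<bar> \<le> 2"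
        unfolding seg_def by (subst AE_density) (auto simp: indicator_def)
      have "AE x in \<mu>. AE s in seg. norm (fst (x, s)) < R0 \<and> \<bar>snd (x, s)\<bar> \<le> 2"
        using mu_supp
      proof eventually_elim
        case (elim x)
        show ?case using seg2 by (rule eventually_mono) (use elim in simp)
      qed
      then show ?thesis unfolding rays_def
        by (intro PS.AE_pair_measure) measurable
    qed
    have "emeasure \<rho> U = (\<integral>\<^sup>+y. indicator U y \<partial>\<rho>)" by (simp add: \<rho>_def)
    also have "\<dots> = (\<integral>\<^sup>+v. \<integral>\<^sup>+\<theta>. indicator {..<R} (norm v) * indicator U (v, ray_pt \<theta> v) \<partial>rays \<partial>lborel)"
      by (rule nn_rho) simp
    also have "\<dots> \<le> (\<integral>\<^sup>+v. \<integral>\<^sup>+\<theta>. liminf (\<lambda>n. \<phi> n v \<theta>) \<partial>rays \<partial>lborel)"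
      by (intro nn_integral_mono nn_integral_mono_AE eventually_mono[OF AE_rays] key) auto
    also have "\<dots> = (\<integral>\<^sup>+z. liminf (\<lambda>n. \<phi> n (fst z) (snd z)) \<partial>(lborel \<Otimes>\<^sub>M rays))"
      by (subst rays.nn_integral_fst[symmetric]) measurable
    also have "\<dots> \<le> liminf (\<lambda>n. \<integral>\<^sup>+z. \<phi> n (fst z) (snd z) \<partial>(lborel \<Otimes>\<^sub>M rays))"
      by (rule nn_integral_liminf) measurable
    also have "(\<lambda>n. \<integral>\<^sup>+z. \<phi> n (fst z) (snd z) \<partial>(lborel \<Otimes>\<^sub>M rays)) = (\<lambda>n. \<integral>\<^sup>+y. g n y * indicator U y \<partial>L)"
    proof
      fix n
      have "(\<integral>\<^sup>+z. \<phi> n (fst z) (snd z) \<partial>(lborel \<Otimes>\<^sub>M rays)) = (\<integral>\<^sup>+v. \<integral>\<^sup>+\<theta>. \<phi> n v \<theta> \<partial>rays \<partial>lborel)"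
        by (subst rays.nn_integral_fst[symmetric]) measurable
      also have "\<dots> = (\<integral>\<^sup>+v. \<integral>\<^sup>+p. \<integral>\<^sup>+\<theta>. k n * indicator {..<R} (norm v) * indicator (D \<inter> U) (v, p) * indicator {..<e n} (norm (ray_pt \<theta> v - p)) \<partial>rays \<partial>lborel \<partial>lborel)"
        unfolding \<phi>_def
        by (intro nn_integral_cong nn_integral_swap sigma_finite_lborel rays.sigma_finite_measure_axioms) measurable
      also have "\<dots> = (\<integral>\<^sup>+v. \<integral>\<^sup>+p. indicator D (v, p) * (g n (v, p) * indicator U (v, p)) \<partial>lborel \<partial>lborel)"
      proof (intro nn_integral_cong)
        fix v p
        have "(\<integral>\<^sup>+\<theta>. k n * indicator {..<R} (norm v) * indicator (D \<inter> U) (v, p) * indicator {..<e n} (norm (ray_pt \<theta> v - p)) \<partial>rays)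
          = (\<integral>\<^sup>+\<theta>. (k n * indicator D (v, p) * indicator U (v, p)) * (indicator {..<R} (norm v) * indicator {..<e n} (norm (ray_pt \<theta> v - p))) \<partial>rays)"
          by (simp add: indicator_inter_arith mult_ac)
        also have "\<dots> = indicator D (v, p) * (g n (v, p) * indicator U (v, p))"
          unfolding g_def by (subst nn_integral_cmult) (auto simp: mult_ac)
        finally show "(\<integral>\<^sup>+\<theta>. k n * indicator {..<R} (norm v) * indicator (D \<inter> U) (v, p) * indicator {..<e n} (norm (ray_pt \<theta> v - p)) \<partial>rays)
          = indicator D (v, p) * (g n (v, p) * indicator U (v, p))" .
      qed
      also have "\<dots> = (\<integral>\<^sup>+y. g n y * indicator U y \<partial>L)"
        by (rule nn_L[symmetric]) measurable
      finally show "(\<integral>\<^sup>+z. \<phi> n (fst z) (snd z) \<partial>(lborel \<Otimes>\<^sub>M rays)) = (\<integral>\<^sup>+y. g n y * indicator U y \<partial>L)" .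
    qed
    finally show ?thesis .
  qed
  have finrho: "finite_measure \<rho>"
  proof -
    interpret F: finite_measure "B \<Otimes>\<^sub>M rays" 
      by (rule finite_measureI) (simp add: space_pair_measure rays.emeasure_pair_measure_Times ennreal_mult_eq_top_iff)
    show ?thesis unfolding \<rho>_def by (rule F.finite_measure_distr) measurable
  qed
  interpret square_bounded_approx \<rho> L g "ennreal (2 ^ ?d / w) * K"
  proof (rule square_bounded_approx.intro)
    show "finite_measure \<rho>" "finite_measure L" "sets L = sets borel" by fact+
    show "sets \<rho> = sets borel" by (simp add: \<rho>_def)
    show "g n \<in> borel_measurable borel" for n by (rule g_meas)
    show "(\<integral>\<^sup>+y. (g n y)\<^sup>2 \<partial>L) \<le> ennreal (2 ^ ?d / w) * K" for n by (rule g_sq)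
    show "ennreal (2 ^ ?d / w) * K < \<top>" using K(1) by (simp add: ennreal_mult_less_top)
    show "emeasure \<rho> U \<le> liminf (\<lambda>n. \<integral>\<^sup>+y. g n y * indicator U y \<partial>L)" if "open U" for U
      using that by (rule lim)
  qed
  obtain f0 where f0 [measurable]: "f0 \<in> borel_measurable borel" and f0': "\<rho> = density L f0" "(\<integral>\<^sup>+x. (f0 x)\<^sup>2 \<partial>L) < \<top>"
    by (rule density_square_integrable) (rule that)
  show ?thesis
  proof
    show "(\<lambda>y. indicator D y * f0 y) \<in> borel_measurable borel" by measurable
    have "(\<integral>\<^sup>+y. (indicator D y * f0 y)\<^sup>2 \<partial>lborel) = (\<integral>\<^sup>+y. (f0 y)\<^sup>2 \<partial>L)"
      unfolding L_def by (subst nn_integral_density) (auto intro!: nn_integral_cong simp: indicator_def)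
    then show "(\<integral>\<^sup>+y. (indicator D y * f0 y)\<^sup>2 \<partial>lborel) < \<top>" using f0' by simp
    fix h :: "'a \<times> 'a \<Rightarrow> ennreal" assume [measurable]: "h \<in> borel_measurable borel"
    have "(\<integral>\<^sup>+v. \<integral>\<^sup>+\<theta>. indicator {..<R} (norm v) * h (v, ray_pt \<theta> v) \<partial>rays \<partial>lborel) = (\<integral>\<^sup>+y. h y \<partial>\<rho>)"
      by (rule nn_rho[symmetric]) measurable
    also have "\<dots> = (\<integral>\<^sup>+y. indicator D y * f0 y * h y \<partial>lborel)"
      unfolding f0'(1) L_def by (simp add: nn_integral_density mult.assoc)
    finally show "(\<integral>\<^sup>+v. \<integral>\<^sup>+\<theta>. indicator {..<R} (norm v) * h (v, ray_pt \<theta> v) \<partial>rays \<partial>lborel) = \<dots>" .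
  qed
qed

end

section \<open>Transfer along lines and rays\<close>

lemma AE_const_nonnull:
  assumes "AE x in M. P" "emeasure M (space M) \<noteq> 0"
  shows P
  using assms eventually_const[of "ae_filter M" P] by (simp add: ae_filter_eq_bot_iff)

context frostman_measure
begin

lemma emeasure_seg: "emeasure seg (space seg) = 4"
  by (simp add: seg_def emeasure_density)

lemma AE_rays_fst: "AE \<theta> in rays. P (fst \<theta>) \<Longrightarrow> AE x in \<mu>. P x"
proof -
  assume A: "AE \<theta> in rays. P (fst \<theta>)"
  interpret S: finite_measure seg by (rule finite_seg)
  interpret PS: pair_sigma_finite \<mu> seg ..
  have "AE x in \<mu>. AE s in seg. P x"
    using PS.AE_pair[OF A[unfolded rays_def]] by simp
  then show ?thesis
    by (rule eventually_mono) (use AE_const_nonnull[where M=seg] emeasure_seg in auto)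
qed

text \<open>The joint law of v and x + s v is absolutely continuous, so the property holds at x + s
  v; invariance with t = -s carries it back to x. The auxiliary smoothing in s leaves no
  trace.\<close>

lemma line_transfer:
  assumes P [measurable]: "Measurable.pred (borel \<Otimes>\<^sub>M borel) (\<lambda>z. P (fst z) (snd z))"
    and AE: "AE y in lborel. AE v in lborel. P y v"
    and inv: "\<And>y v t. P y v \<Longrightarrow> P (y + t *\<^sub>R v) v"
  shows "AE x in \<mu>. AE v in lborel. P x v"
proof -
  interpret rays: finite_measure rays by (rule finite_rays)
  interpret V: pair_sigma_finite "lborel :: 'a measure" "lborel :: 'a measure" ..
  interpret MV: pair_sigma_finite \<mu> "lborel :: 'a measure" ..
  define N where "N = {z :: 'a \<times> 'a. \<not> P (snd z) (fst z)}"
  have [measurable]: "Measurable.pred (borel \<Otimes>\<^sub>M borel) (\<lambda>z. P (snd z) (fst z))"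
    using measurable_compose[OF measurable_Pair[OF measurable_snd measurable_fst] P] by simp
  have "{z \<in> space (borel \<Otimes>\<^sub>M borel). \<not> P (snd z) (fst z)} \<in> sets (borel \<Otimes>\<^sub>M borel)"
    by measurable
  moreover have "{z \<in> space (borel \<Otimes>\<^sub>M borel). \<not> P (snd z) (fst z)} = N"
    by (auto simp: N_def space_pair_measure)
  ultimately have N [measurable]: "N \<in> sets borel"
    by (simp only: borel_prod)
  have P': "{x \<in> space (lborel \<Otimes>\<^sub>M lborel). P (fst x) (snd x)} \<in> sets (lborel \<Otimes>\<^sub>M lborel)"
    by measurable
  have "AE v in lborel. AE y in lborel. P y v"
    using lborel_pair.AE_commute[OF P'] AE by simp
  moreover have "{z \<in> space (lborel \<Otimes>\<^sub>M lborel). z \<notin> N} \<in> sets (lborel \<Otimes>\<^sub>M lborel)"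
    unfolding lborel_prod by measurable
  ultimately have "AE z in lborel \<Otimes>\<^sub>M lborel. z \<notin> N"
    by (intro lborel_pair.AE_pair_measure) (simp_all add: N_def)
  then have N0: "AE z in lborel. z \<notin> N" by (simp only: lborel_prod)
  have R: "AE v in lborel. norm v < R \<longrightarrow> (AE x in \<mu>. P x v)" if R: "0 < R" for R
  proof -
    obtain f :: "'a \<times> 'a \<Rightarrow> ennreal" where [measurable]: "f \<in> borel_measurable borel" and
      "(\<integral>\<^sup>+y. (f y)\<^sup>2 \<partial>lborel) < \<top>" and f: "\<And>h. h \<in> borel_measurable borel \<Longrightarrow>
      (\<integral>\<^sup>+v. \<integral>\<^sup>+\<theta>. indicator {..<R} (norm v) * h (v, ray_pt \<theta> v) \<partial>rays \<partial>lborel) = (\<integral>\<^sup>+y. f y * h y \<partial>lborel)"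
      by (rule rays_density[OF R]) (rule that)
    have "(\<integral>\<^sup>+v. \<integral>\<^sup>+\<theta>. indicator {..<R} (norm v) * indicator N (v, ray_pt \<theta> v) \<partial>rays \<partial>lborel) = (\<integral>\<^sup>+y. f y * indicator N y \<partial>lborel)"
      by (rule f) measurable
    also have "\<dots> = 0"
      using N0 by (subst nn_integral_0_iff_AE) (auto elim: eventually_mono)
    finally have "AE v in lborel. (\<integral>\<^sup>+\<theta>. indicator {..<R} (norm v) * indicator N (v, ray_pt \<theta> v) \<partial>rays) = 0"
      by (subst (asm) nn_integral_0_iff_AE) measurable
    then show ?thesis
    proof eventually_elim
      case (elim v)
      show ?case
      proof
        assume v: "norm v < R"
        have "AE \<theta> in rays. indicator {..<R} (norm v) * indicator N (v, ray_pt \<theta> v) = (0::ennreal)"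
          using elim by (subst (asm) nn_integral_0_iff_AE) measurable
        then have "AE \<theta> in rays. P (fst \<theta>) v"
        proof eventually_elim
          case (elim \<theta>)
          then have "P (ray_pt \<theta> v) v" using v by (auto simp: N_def indicator_def split: if_splits)
          from inv[OF this, of "- snd \<theta>"] show ?case by (simp add: ray_pt_def)
        qed
        then show "AE x in \<mu>. P x v" by (rule AE_rays_fst)
      qed
    qed
  qed
  have "AE v in lborel. \<forall>n. norm v < real (Suc n) \<longrightarrow> (AE x in \<mu>. P x v)"
    unfolding AE_all_countable by (intro allI R) simp
  then have "AE v in lborel. AE x in \<mu>. P x v"
  proof eventually_elim
    case (elim v)
    obtain n where "norm v < real n" using reals_Archimedean2 by blast
    then show ?case using elim[rule_format, of n] by simp
  qed
  moreover have "{x \<in> space (\<mu> \<Otimes>\<^sub>M lborel). P (fst x) (snd x)} \<in> sets (\<mu> \<Otimes>\<^sub>M lborel)"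
    by measurable
  ultimately show ?thesis using MV.AE_commute by simp
qed

section \<open>Radial projections from typical centres\<close>

lemma measurable_rays_fst [measurable]: "fst \<in> measurable rays borel"
  and measurable_rays_snd [measurable]: "snd \<in> measurable rays borel"
  unfolding rays_def by measurable

text \<open>
  For small \<open>e\<close> the left-hand side approximates the mass of directions from \<open>\<mu>\<close>-typical points \<open>x\<close> to
  other points of \<open>\<mu>\<close> that lie in \<open>G\<close>. Shifting \<open>x\<close> along \<open>v\<close> by \<open>s \<in> [0, 1]\<close> makes the density \<open>f\<close>
  applicable twice.
\<close>
lemma direction_mass_bound:
  fixes f :: "'a \<times> 'a \<Rightarrow> ennreal"
  assumes R: "0 < R" and e: "0 < e" and cc: "0 < cc" "cc < \<top>"
    and [measurable]: "f \<in> borel_measurable borel" "G \<in> sets (borel \<Otimes>\<^sub>M borel)"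
    and f: "\<And>h. h \<in> borel_measurable borel \<Longrightarrow>
      (\<integral>\<^sup>+v. \<integral>\<^sup>+\<theta>. indicator {..<R} (norm v) * h (v, ray_pt \<theta> v) \<partial>rays \<partial>lborel) = (\<integral>\<^sup>+y. f y * h y \<partial>lborel)"
  defines "w \<equiv> unit_ball_vol (real DIM('a))"
  shows "(\<integral>\<^sup>+x. \<integral>\<^sup>+v. \<integral>\<^sup>+z. \<integral>\<^sup>+t. indicator {..<R} (norm v) * indicator G (x, v) *
       (indicator {1..2} t * indicator {..<e} (norm (z - x - t *\<^sub>R v))) \<partial>lborel \<partial>\<mu> \<partial>lborel \<partial>\<mu>)
    \<le> ennreal (w * e ^ DIM('a)) * (K * (\<integral>\<^sup>+x. \<integral>\<^sup>+v. indicator {..<R} (norm v) * indicator G (x, v) \<partial>lborel \<partial>\<mu>)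
        + (cc * (\<integral>\<^sup>+y. (f y)\<^sup>2 \<partial>lborel) + (\<integral>\<^sup>+y. (f y)\<^sup>2 * indicator {K<..} (f y) \<partial>lborel) / cc))"
proof -
  interpret rays: finite_measure rays by (rule finite_rays)
  let ?B = "\<lambda>v::'a. indicator {..<R} (norm v) :: ennreal"
  let ?I = "\<lambda>s::real. indicator {0..1} s :: ennreal"
  let ?e = "\<lambda>x::'a. indicator {..<e} (norm x) :: ennreal"
  let ?W = "ennreal (w * e ^ DIM('a))"
  have ball_int: "(\<integral>\<^sup>+p. ?e (a - p) \<partial>lborel) = ?W" "(\<integral>\<^sup>+p. ?e (p - a) \<partial>lborel) = ?W" for a
    using nn_integral_ball_indicator[of e a] e by (auto simp: w_def norm_minus_commute)
  have G [measurable]: "(\<lambda>z. indicator G (g z, h z) :: ennreal) \<in> borel_measurable M"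
    if [measurable]: "g \<in> borel_measurable M" "h \<in> borel_measurable M" for g h and M :: "'z measure"
    by measurable
  have fm [measurable]: "(\<lambda>z. f (g z, h z)) \<in> borel_measurable M"
    if [measurable]: "g \<in> borel_measurable M" "h \<in> borel_measurable M" for g h and M :: "'z measure"
    by measurable
  define fK where "fK = (\<lambda>y. f y * indicator {K<..} (f y))"
  have fK [measurable]: "fK \<in> borel_measurable borel" unfolding fK_def by measurable
  have fKm [measurable]: "(\<lambda>z. fK (g z, h z)) \<in> borel_measurable M"
    if [measurable]: "g \<in> borel_measurable M" "h \<in> borel_measurable M" for g h and M :: "'z measure"
    by measurable
  \<comment> \<open>The density f is square integrable but possibly unbounded. Below the level K it
    is replaced by K, which leaves the mass of G; the rest is small in the square mean for large K,
    and there G is dropped.\<close>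
  have f_split: "f y \<le> K + fK y" for y
    by (auto simp: fK_def indicator_def not_less intro: add_increasing2)
  \<comment> \<open>With r = s - t the difference z - x - t v becomes (z + r v) - (x + s v), a
    difference of two ray points. Here r lies in [-2, 0], inside the range of
    \<open>seg\<close>.\<close>
  have shift: "(\<integral>\<^sup>+z. \<integral>\<^sup>+t. indicator {1..2} t * ?e (z - x - t *\<^sub>R v) \<partial>lborel \<partial>\<mu>)
      \<le> (\<integral>\<^sup>+\<theta>. ?e (ray_pt \<theta> v - ray_pt (x, s) v) \<partial>rays)" if "s \<in> {0..1}" for x v s
  proof -
    have "(\<integral>\<^sup>+t. indicator {1..2} t * ?e (z - x - t *\<^sub>R v) \<partial>lborel)
       \<le> (\<integral>\<^sup>+r. indicator {-2..2} r * ?e (z + r *\<^sub>R v - (x + s *\<^sub>R v)) \<partial>lborel)" for z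
    proof -
      have "(\<integral>\<^sup>+r. indicator {-2..2} r * ?e (z + r *\<^sub>R v - (x + s *\<^sub>R v)) \<partial>lborel)
         = (\<integral>\<^sup>+t. indicator {-2..2} (s - t) * ?e (z + (s - t) *\<^sub>R v - (x + s *\<^sub>R v)) \<partial>lborel)"
        using nn_integral_real_affine[of "\<lambda>r. indicator {-2..2} r * ?e (z + r *\<^sub>R v - (x + s *\<^sub>R v))" "-1" s] by simp
      also have "\<dots> \<ge> (\<integral>\<^sup>+t. indicator {1..2} t * ?e (z - x - t *\<^sub>R v) \<partial>lborel)"
        using that by (intro nn_integral_mono) (auto simp: indicator_def algebra_simps)
      finally show ?thesis .
    qed
    then have "(\<integral>\<^sup>+z. \<integral>\<^sup>+t. indicator {1..2} t * ?e (z - x - t *\<^sub>R v) \<partial>lborel \<partial>\<mu>)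
      \<le> (\<integral>\<^sup>+z. \<integral>\<^sup>+r. indicator {-2..2} r * ?e (z + r *\<^sub>R v - (x + s *\<^sub>R v)) \<partial>lborel \<partial>\<mu>)"
      by (rule nn_integral_mono)
    also have "\<dots> = (\<integral>\<^sup>+\<theta>. ?e (fst \<theta> + snd \<theta> *\<^sub>R v - (x + s *\<^sub>R v)) \<partial>rays)"
      by (rule nn_integral_rays[symmetric]) measurable
    finally show ?thesis by (simp add: ray_pt_def)
  qed
  \<comment> \<open>The shifts s range over an interval of length 1, so averaging over them costs no
    constant.\<close>
  have unit: "(\<integral>\<^sup>+\<theta>. ?I (snd \<theta>) * h (fst \<theta>) \<partial>rays) = (\<integral>\<^sup>+x. h x \<partial>\<mu>)"
    if [measurable]: "h \<in> borel_measurable borel" for h :: "'a \<Rightarrow> ennreal"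
  proof -
    have "(\<integral>\<^sup>+\<theta>. ?I (snd \<theta>) * h (fst \<theta>) \<partial>rays) = (\<integral>\<^sup>+x. \<integral>\<^sup>+s. indicator {-2..2} s * (?I s * h x) \<partial>lborel \<partial>\<mu>)"
      by (rule nn_integral_rays) measurable
    also have "\<dots> = (\<integral>\<^sup>+x. \<integral>\<^sup>+s. h x * ?I s \<partial>lborel \<partial>\<mu>)"
      by (intro nn_integral_cong) (auto simp: indicator_def)
    also have "\<dots> = (\<integral>\<^sup>+x. h x \<partial>\<mu>)"
      by (simp add: nn_integral_cmult)
    finally show ?thesis .
  qed
  have "(\<integral>\<^sup>+x. \<integral>\<^sup>+v. \<integral>\<^sup>+z. \<integral>\<^sup>+t. ?B v * indicator G (x, v) * (indicator {1..2} t * ?e (z - x - t *\<^sub>R v)) \<partial>lborel \<partial>\<mu> \<partial>lborel \<partial>\<mu>)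
    = (\<integral>\<^sup>+x. \<integral>\<^sup>+v. ?B v * indicator G (x, v) * (\<integral>\<^sup>+z. \<integral>\<^sup>+t. indicator {1..2} t * ?e (z - x - t *\<^sub>R v) \<partial>lborel \<partial>\<mu>) \<partial>lborel \<partial>\<mu>)"
    by (simp add: nn_integral_cmult)
  also have "\<dots> = (\<integral>\<^sup>+\<theta>2. ?I (snd \<theta>2) * (\<integral>\<^sup>+v. ?B v * indicator G (fst \<theta>2, v) * (\<integral>\<^sup>+z. \<integral>\<^sup>+t. indicator {1..2} t * ?e (z - fst \<theta>2 - t *\<^sub>R v) \<partial>lborel \<partial>\<mu>) \<partial>lborel) \<partial>rays)"
    by (rule unit[symmetric]) measurable
  also have "\<dots> \<le> (\<integral>\<^sup>+\<theta>2. ?I (snd \<theta>2) * (\<integral>\<^sup>+v. ?B v * indicator G (fst \<theta>2, v) * (\<integral>\<^sup>+\<theta>. ?e (ray_pt \<theta> v - ray_pt \<theta>2 v) \<partial>rays) \<partial>lborel) \<partial>rays)"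
    using shift by (intro nn_integral_mono) (auto simp: indicator_def intro!: nn_integral_mono)
  also have "\<dots> \<le> (\<integral>\<^sup>+\<theta>2. ?I (snd \<theta>2) * (K * ?W * (\<integral>\<^sup>+v. ?B v * indicator G (fst \<theta>2, v) \<partial>lborel)
        + (\<integral>\<^sup>+v. \<integral>\<^sup>+q. ?B v * (fK (v, q) * ?e (q - ray_pt \<theta>2 v)) \<partial>lborel \<partial>lborel)) \<partial>rays)"
  proof (intro nn_integral_mono mult_left_mono)
    fix \<theta>2
    let ?h = "\<lambda>y. ?B (fst y) * (indicator G (fst \<theta>2, fst y) * ?e (snd y - ray_pt \<theta>2 (fst y)))"
    have "(\<lambda>y. ?h y) \<in> borel_measurable (borel \<Otimes>\<^sub>M borel)" by measurable
    then have h [measurable]: "?h \<in> borel_measurable borel" by (simp only: borel_prod)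
    have "(\<integral>\<^sup>+v. ?B v * indicator G (fst \<theta>2, v) * (\<integral>\<^sup>+\<theta>. ?e (ray_pt \<theta> v - ray_pt \<theta>2 v) \<partial>rays) \<partial>lborel)
       = (\<integral>\<^sup>+v. \<integral>\<^sup>+\<theta>. ?B v * ?h (v, ray_pt \<theta> v) \<partial>rays \<partial>lborel)"
      by (auto intro!: nn_integral_cong simp: indicator_def nn_integral_cmult[symmetric])
    \<comment> \<open>First use of the density: the pair v, z + r v becomes v, q distributed with
      density f, while x and s are kept fixed.\<close>
    also have "\<dots> = (\<integral>\<^sup>+y. f y * ?h y \<partial>lborel)" by (rule f) (rule h)
    also have "\<dots> = (\<integral>\<^sup>+y. f y * ?h y \<partial>(lborel \<Otimes>\<^sub>M lborel))" by (simp only: lborel_prod)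
    also have "\<dots> = (\<integral>\<^sup>+v. \<integral>\<^sup>+q. f (v, q) * ?h (v, q) \<partial>lborel \<partial>lborel)"
      by (rule lborel.nn_integral_fst[symmetric]) (unfold lborel_prod, measurable)
    also have "\<dots> \<le> (\<integral>\<^sup>+v. \<integral>\<^sup>+q. K * (?B v * indicator G (fst \<theta>2, v)) * ?e (q - ray_pt \<theta>2 v) + ?B v * (fK (v, q) * ?e (q - ray_pt \<theta>2 v)) \<partial>lborel \<partial>lborel)"
    proof (intro nn_integral_mono)
      fix v q
      show "f (v, q) * ?h (v, q) \<le> K * (?B v * indicator G (fst \<theta>2, v)) * ?e (q - ray_pt \<theta>2 v) + ?B v * (fK (v, q) * ?e (q - ray_pt \<theta>2 v))"
        using f_split[of "(v, q)"] by (auto simp: indicator_def)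
    qed
    also have "\<dots> = K * ?W * (\<integral>\<^sup>+v. ?B v * indicator G (fst \<theta>2, v) \<partial>lborel)
        + (\<integral>\<^sup>+v. \<integral>\<^sup>+q. ?B v * (fK (v, q) * ?e (q - ray_pt \<theta>2 v)) \<partial>lborel \<partial>lborel)"
    proof -
      have "(\<integral>\<^sup>+v. \<integral>\<^sup>+q. K * (?B v * indicator G (fst \<theta>2, v)) * ?e (q - ray_pt \<theta>2 v) + ?B v * (fK (v, q) * ?e (q - ray_pt \<theta>2 v)) \<partial>lborel \<partial>lborel)
        = (\<integral>\<^sup>+v. (K * ?W) * (?B v * indicator G (fst \<theta>2, v)) + (\<integral>\<^sup>+q. ?B v * (fK (v, q) * ?e (q - ray_pt \<theta>2 v)) \<partial>lborel) \<partial>lborel)"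
        by (intro nn_integral_cong) (simp add: nn_integral_add nn_integral_cmult ball_int mult_ac)
      also have "\<dots> = K * ?W * (\<integral>\<^sup>+v. ?B v * indicator G (fst \<theta>2, v) \<partial>lborel)
        + (\<integral>\<^sup>+v. \<integral>\<^sup>+q. ?B v * (fK (v, q) * ?e (q - ray_pt \<theta>2 v)) \<partial>lborel \<partial>lborel)"
        by (subst nn_integral_add) (auto simp: nn_integral_cmult)
      finally show ?thesis .
    qed
    finally show "(\<integral>\<^sup>+v. ?B v * indicator G (fst \<theta>2, v) * (\<integral>\<^sup>+\<theta>. ?e (ray_pt \<theta> v - ray_pt \<theta>2 v) \<partial>rays) \<partial>lborel)
      \<le> K * ?W * (\<integral>\<^sup>+v. ?B v * indicator G (fst \<theta>2, v) \<partial>lborel)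
        + (\<integral>\<^sup>+v. \<integral>\<^sup>+q. ?B v * (fK (v, q) * ?e (q - ray_pt \<theta>2 v)) \<partial>lborel \<partial>lborel)" .
  qed simp
  also have "\<dots> = (\<integral>\<^sup>+\<theta>2. ?I (snd \<theta>2) * (K * ?W * (\<integral>\<^sup>+v. ?B v * indicator G (fst \<theta>2, v) \<partial>lborel)) \<partial>rays)
        + (\<integral>\<^sup>+\<theta>2. ?I (snd \<theta>2) * (\<integral>\<^sup>+v. \<integral>\<^sup>+q. ?B v * (fK (v, q) * ?e (q - ray_pt \<theta>2 v)) \<partial>lborel \<partial>lborel) \<partial>rays)"
    unfolding distrib_left by (rule nn_integral_add) measurable
  also have "(\<integral>\<^sup>+\<theta>2. ?I (snd \<theta>2) * (K * ?W * (\<integral>\<^sup>+v. ?B v * indicator G (fst \<theta>2, v) \<partial>lborel)) \<partial>rays)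
      = (\<integral>\<^sup>+x. K * ?W * (\<integral>\<^sup>+v. ?B v * indicator G (x, v) \<partial>lborel) \<partial>\<mu>)"
    by (rule unit) measurable
  also have "\<dots> = ?W * (K * (\<integral>\<^sup>+x. \<integral>\<^sup>+v. ?B v * indicator G (x, v) \<partial>lborel \<partial>\<mu>))"
    by (simp add: nn_integral_cmult mult_ac)
  also have "(\<integral>\<^sup>+\<theta>2. ?I (snd \<theta>2) * (\<integral>\<^sup>+v. \<integral>\<^sup>+q. ?B v * (fK (v, q) * ?e (q - ray_pt \<theta>2 v)) \<partial>lborel \<partial>lborel) \<partial>rays)
      \<le> ?W * (cc * (\<integral>\<^sup>+y. (f y)\<^sup>2 \<partial>lborel) + (\<integral>\<^sup>+y. (f y)\<^sup>2 * indicator {K<..} (f y) \<partial>lborel) / cc)"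
  proof -
    let ?\<psi> = "\<lambda>y. \<integral>\<^sup>+q. fK (fst y, q) * ?e (q - snd y) \<partial>lborel"
    have "?\<psi> \<in> borel_measurable (borel \<Otimes>\<^sub>M borel)" by measurable
    then have psi [measurable]: "?\<psi> \<in> borel_measurable borel" by (simp only: borel_prod)
    have "(\<integral>\<^sup>+\<theta>2. ?I (snd \<theta>2) * (\<integral>\<^sup>+v. \<integral>\<^sup>+q. ?B v * (fK (v, q) * ?e (q - ray_pt \<theta>2 v)) \<partial>lborel \<partial>lborel) \<partial>rays)
      \<le> (\<integral>\<^sup>+\<theta>2. \<integral>\<^sup>+v. ?B v * ?\<psi> (v, ray_pt \<theta>2 v) \<partial>lborel \<partial>rays)"
      by (intro nn_integral_mono) (auto simp: indicator_def nn_integral_cmult intro!: nn_integral_mono)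
    also have "\<dots> = (\<integral>\<^sup>+v. \<integral>\<^sup>+\<theta>2. ?B v * ?\<psi> (v, ray_pt \<theta>2 v) \<partial>rays \<partial>lborel)"
      by (intro nn_integral_swap sigma_finite_lborel rays.sigma_finite_measure_axioms) measurable
    \<comment> \<open>Second use of the density, now for the pair v, x + s v, which becomes v,
      p.\<close>
    also have "\<dots> = (\<integral>\<^sup>+y. f y * ?\<psi> y \<partial>lborel)" by (rule f) (rule psi)
    also have "\<dots> = (\<integral>\<^sup>+y. f y * ?\<psi> y \<partial>(lborel \<Otimes>\<^sub>M lborel))" by (simp only: lborel_prod)
    also have "\<dots> = (\<integral>\<^sup>+v. \<integral>\<^sup>+p. f (v, p) * ?\<psi> (v, p) \<partial>lborel \<partial>lborel)"
      by (rule lborel.nn_integral_fst[symmetric]) (unfold lborel_prod, measurable)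
    also have "\<dots> = (\<integral>\<^sup>+v. \<integral>\<^sup>+p. \<integral>\<^sup>+q. ?e (q - p) * (f (v, p) * fK (v, q)) \<partial>lborel \<partial>lborel \<partial>lborel)"
      by (auto intro!: nn_integral_cong simp: nn_integral_cmult[symmetric] mult_ac)
    \<comment> \<open>Once the two factors are separated by Young's inequality, each term contains
      only one of p and q; the other is integrated over a ball of radius e and yields ?W.\<close>
    also have "\<dots> \<le> (\<integral>\<^sup>+v. \<integral>\<^sup>+p. \<integral>\<^sup>+q. (cc * (f (v, p))\<^sup>2) * ?e (q - p) + (fK (v, q))\<^sup>2 / cc * ?e (q - p) \<partial>lborel \<partial>lborel \<partial>lborel)"
      using ennreal_mult_le_squares[OF cc] by (intro nn_integral_mono) (auto simp: indicator_def)
    also have "\<dots> = (\<integral>\<^sup>+v. (\<integral>\<^sup>+p. \<integral>\<^sup>+q. (cc * (f (v, p))\<^sup>2) * ?e (q - p) \<partial>lborel \<partial>lborel) + (\<integral>\<^sup>+p. \<integral>\<^sup>+q. (fK (v, q))\<^sup>2 / cc * ?e (q - p) \<partial>lborel \<partial>lborel) \<partial>lborel)"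
      by (simp add: nn_integral_add)
    also have "\<dots> = (\<integral>\<^sup>+v. (\<integral>\<^sup>+p. \<integral>\<^sup>+q. (cc * (f (v, p))\<^sup>2) * ?e (q - p) \<partial>lborel \<partial>lborel) + (\<integral>\<^sup>+q. \<integral>\<^sup>+p. (fK (v, q))\<^sup>2 / cc * ?e (q - p) \<partial>lborel \<partial>lborel) \<partial>lborel)"
      by (intro nn_integral_cong arg_cong2[where f="(+)"] refl nn_integral_swap sigma_finite_lborel) measurable
    also have "\<dots> = (\<integral>\<^sup>+v. (\<integral>\<^sup>+p. cc * (f (v, p))\<^sup>2 * ?W \<partial>lborel) + (\<integral>\<^sup>+q. (fK (v, q))\<^sup>2 / cc * ?W \<partial>lborel) \<partial>lborel)"
      by (simp add: nn_integral_cmult ball_int)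
    also have "\<dots> = ?W * (cc * (\<integral>\<^sup>+v. \<integral>\<^sup>+p. (f (v, p))\<^sup>2 \<partial>lborel \<partial>lborel) + (\<integral>\<^sup>+v. \<integral>\<^sup>+q. (fK (v, q))\<^sup>2 \<partial>lborel \<partial>lborel) / cc)"
      by (simp add: nn_integral_add nn_integral_cmult nn_integral_multc nn_integral_divide distrib_left mult_ac)
    also have "(\<integral>\<^sup>+v. \<integral>\<^sup>+p. (f (v, p))\<^sup>2 \<partial>lborel \<partial>lborel) = (\<integral>\<^sup>+y. (f y)\<^sup>2 \<partial>(lborel \<Otimes>\<^sub>M lborel))"
      by (rule lborel.nn_integral_fst) (unfold lborel_prod, measurable)
    also have "(\<integral>\<^sup>+v. \<integral>\<^sup>+q. (fK (v, q))\<^sup>2 \<partial>lborel \<partial>lborel) = (\<integral>\<^sup>+y. (fK y)\<^sup>2 \<partial>(lborel \<Otimes>\<^sub>M lborel))"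
      by (rule lborel.nn_integral_fst) (unfold lborel_prod, measurable)
    also have "(\<lambda>y. (fK y)\<^sup>2) = (\<lambda>y. (f y)\<^sup>2 * indicator {K<..} (f y))"
      by (auto simp: fK_def indicator_def)
    finally show ?thesis by (simp only: lborel_prod)
  qed
  finally show ?thesis by (simp add: distrib_left add_left_mono)
qed

end

lemma tail_tendsto_0:
  fixes f :: "'b \<Rightarrow> ennreal"
  assumes [measurable]: "f \<in> borel_measurable M" and I: "(\<integral>\<^sup>+y. (f y)\<^sup>2 \<partial>M) < \<top>"
  shows "(\<lambda>K. \<integral>\<^sup>+y. (f y)\<^sup>2 * indicator {of_nat K<..} (f y) \<partial>M) \<longlonglongrightarrow> 0"
proof -
  have "AE y in M. (f y)\<^sup>2 \<noteq> \<infinity>"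
    using I by (intro nn_integral_PInf_AE) auto
  then have "AE y in M. (\<lambda>K. (f y)\<^sup>2 * indicator {of_nat K<..} (f y)) \<longlonglongrightarrow> 0"
  proof eventually_elim
    case (elim y)
    then have "f y < \<top>" by (auto simp: power2_eq_square ennreal_mult_eq_top_iff less_top)
    then obtain n where n: "f y < of_nat n" by (metis ennreal_Ex_less_of_nat)
    have "\<forall>\<^sub>F K in sequentially. (f y)\<^sup>2 * indicator {of_nat K<..} (f y) = 0"
      using eventually_ge_at_top[of n]
    proof eventually_elim
      case (elim K)
      then have "f y < of_nat K" using n by (meson less_le_trans of_nat_mono)
      then show ?case by (auto simp: indicator_def dest: less_asym)
    qed
    then show ?case by (rule tendsto_eventually)
  qed
  then have "(\<lambda>K. \<integral>\<^sup>+y. (f y)\<^sup>2 * indicator {of_nat K<..} (f y) \<partial>M) \<longlonglongrightarrow> (\<integral>\<^sup>+y. 0 \<partial>M)"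
    by (intro nn_integral_dominated_convergence[where w="\<lambda>y. (f y)\<^sup>2"])
      (use I in \<open>auto simp: indicator_def less_top[symmetric]\<close>)
  then show ?thesis by simp
qed

context frostman_measure
begin

text \<open>The left-hand side is the mass of G under the law of (x, (z - x) / t) with t spread over
  [1, 2]. Because G is open, the mollified masses bounded by \<open>direction_mass_bound\<close>
  dominate it in the lower limit.\<close>

lemma direction_measure_open_le:
  fixes f :: "'a \<times> 'a \<Rightarrow> ennreal"
  assumes R: "2 * R0 < R" and cc: "0 < cc" "cc < \<top>"
    and [measurable]: "f \<in> borel_measurable borel" and G: "open G"
    and f: "\<And>h. h \<in> borel_measurable borel \<Longrightarrow>
      (\<integral>\<^sup>+v. \<integral>\<^sup>+\<theta>. indicator {..<R} (norm v) * h (v, ray_pt \<theta> v) \<partial>rays \<partial>lborel) = (\<integral>\<^sup>+y. f y * h y \<partial>lborel)"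
  shows "(\<integral>\<^sup>+x. \<integral>\<^sup>+z. \<integral>\<^sup>+t. indicator {1..2} t * indicator G (x, (1 / t) *\<^sub>R (z - x)) \<partial>lborel \<partial>\<mu> \<partial>\<mu>)
    \<le> 2 ^ DIM('a) * (K * (\<integral>\<^sup>+x. \<integral>\<^sup>+v. indicator {..<R} (norm v) * indicator G (x, v) \<partial>lborel \<partial>\<mu>)
        + (cc * (\<integral>\<^sup>+y. (f y)\<^sup>2 \<partial>lborel) + (\<integral>\<^sup>+y. (f y)\<^sup>2 * indicator {K<..} (f y) \<partial>lborel) / cc))"
proof -
  let ?d = "DIM('a)"
  have R_pos: "0 < R" using R R0 by simp
  have [measurable]: "G \<in> sets (borel \<Otimes>\<^sub>M borel)" using borel_open[OF G] by (simp only: borel_prod)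
  define w where "w = unit_ball_vol (real ?d)"
  have w: "0 < w" by (simp add: w_def)
  define e where "e = (\<lambda>n. 1 / real (Suc n))"
  have e: "0 < e n" for n by (auto simp: e_def)
  have e_lim: "e \<longlonglongrightarrow> 0" unfolding e_def by (rule LIMSEQ_Suc[OF lim_1_over_n])
  \<comment> \<open>As t <= 2, the condition |z - x - t v| < e n holds on the ball of radius e n / 2
    around (z - x) / t. The factor k n is the inverse of the volume of this ball, which explains the
    2^d in the result.\<close>
  define k where "k = (\<lambda>n. ennreal (2 ^ ?d / (w * e n ^ ?d)))"
  define S where "S = K * (\<integral>\<^sup>+x. \<integral>\<^sup>+v. indicator {..<R} (norm v) * indicator G (x, v) \<partial>lborel \<partial>\<mu>)
        + (cc * (\<integral>\<^sup>+y. (f y)\<^sup>2 \<partial>lborel) + (\<integral>\<^sup>+y. (f y)\<^sup>2 * indicator {K<..} (f y) \<partial>lborel) / cc)"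
  define \<phi> where "\<phi> = (\<lambda>n x z t. \<integral>\<^sup>+v. k n * (indicator {..<R} (norm v) * indicator G (x, v) *
       (indicator {1..2} t * indicator {..<e n} (norm (z - x - t *\<^sub>R v)))) \<partial>lborel)"
  have phi [measurable]: "(\<lambda>y. \<phi> n (x y) (z y) (t y)) \<in> borel_measurable M"
    if [measurable]: "x \<in> borel_measurable M" "z \<in> borel_measurable M" "t \<in> borel_measurable M"
    for M :: "'z measure" and x z t n
    unfolding \<phi>_def by measurable
  have key: "indicator {1..2} t * indicator G (x, (1 / t) *\<^sub>R (z - x)) \<le> liminf (\<lambda>n. \<phi> n x z t)"
    if xz: "norm x < R0" "norm z < R0" for x z and t :: real
  proof (cases "t \<in> {1..2} \<and> (x, (1 / t) *\<^sub>R (z - x)) \<in> G")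
    case False
    then show ?thesis by (auto simp: indicator_def)
  next
    case True
    define v0 where "v0 = (1 / t) *\<^sub>R (z - x)"
    have t: "1 \<le> t" "t \<le> 2" using True by auto
    have "norm v0 = norm (z - x) / t" using t by (simp add: v0_def)
    also have "\<dots> \<le> norm (z - x) / 1" using t by (intro divide_left_mono) auto
    also have "\<dots> = norm (z - x)" by simp
    also have "\<dots> \<le> norm z + norm x" by (rule norm_triangle_ineq4)
    finally have "norm v0 < R" using xz R by simp
    then have "v0 \<in> (\<lambda>v. (x, v)) -` G \<inter> ball 0 R" using True by (simp add: v0_def)
    moreover have "open ((\<lambda>v. (x, v)) -` G \<inter> ball 0 R)"
      by (intro open_Int open_vimage G continuous_intros open_ball)
    ultimately obtain r where r: "0 < r" "ball v0 r \<subseteq> (\<lambda>v. (x, v)) -` G \<inter> ball 0 R"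
      unfolding open_contains_ball by blast
    have "\<forall>\<^sub>F n in sequentially. e n < r"
      using order_tendstoD(2)[OF e_lim r(1)] .
    then have "\<forall>\<^sub>F n in sequentially. 1 \<le> \<phi> n x z t"
    proof eventually_elim
      case (elim n)
      have "indicator {..<e n / 2} (norm (v0 - v)) \<le> indicator {..<R} (norm v) * indicator G (x, v) *
          (indicator {1..2} t * indicator {..<e n} (norm (z - x - t *\<^sub>R v)) :: ennreal)" for v
      proof (cases "norm (v0 - v) < e n / 2")
        case lt: True
        then have "v \<in> ball v0 r" using elim e[of n] by (simp add: dist_norm)
        then have "(x, v) \<in> G" "norm v < R" using r by auto
        moreover have "norm (z - x - t *\<^sub>R v) < e n"
        proof -
          have "z - x - t *\<^sub>R v = t *\<^sub>R (v0 - v)" using t by (simp add: v0_def algebra_simps)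
          then have "norm (z - x - t *\<^sub>R v) = t * norm (v0 - v)" using t by simp
          also have "\<dots> \<le> 2 * norm (v0 - v)" using t by (intro mult_right_mono) auto
          finally show ?thesis using lt by simp
        qed
        ultimately show ?thesis using t by (auto simp: indicator_def)
      qed (auto simp: indicator_def)
      then have "(\<integral>\<^sup>+v. k n * indicator {..<e n / 2} (norm (v0 - v)) \<partial>lborel) \<le> \<phi> n x z t"
        unfolding \<phi>_def by (intro nn_integral_mono mult_left_mono) auto
      moreover have "(\<integral>\<^sup>+v. k n * indicator {..<e n / 2} (norm (v0 - v)) \<partial>lborel) = k n * ennreal (w * (e n / 2) ^ ?d)"
        using nn_integral_ball_indicator[of "e n / 2" v0] e[of n] by (simp add: nn_integral_cmult w_def)
      moreover have "k n * ennreal (w * (e n / 2) ^ ?d) = 1"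
        using w e[of n] by (simp add: k_def ennreal_mult[symmetric] power_divide ennreal_1[symmetric] del: ennreal_1)
      ultimately show ?case by simp
    qed
    then have "1 \<le> liminf (\<lambda>n. \<phi> n x z t)" by (rule Liminf_bounded)
    then show ?thesis using True by simp
  qed
  have "(\<integral>\<^sup>+x. \<integral>\<^sup>+z. \<integral>\<^sup>+t. indicator {1..2} t * indicator G (x, (1 / t) *\<^sub>R (z - x)) \<partial>lborel \<partial>\<mu> \<partial>\<mu>)
    \<le> (\<integral>\<^sup>+x. \<integral>\<^sup>+z. \<integral>\<^sup>+t. liminf (\<lambda>n. \<phi> n x z t) \<partial>lborel \<partial>\<mu> \<partial>\<mu>)"
  proof (rule nn_integral_mono_AE, rule eventually_mono[OF mu_supp])
    fix x :: 'a assume x: "norm x < R0"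
    show "(\<integral>\<^sup>+z. \<integral>\<^sup>+t. indicator {1..2} t * indicator G (x, (1 / t) *\<^sub>R (z - x)) \<partial>lborel \<partial>\<mu>)
      \<le> (\<integral>\<^sup>+z. \<integral>\<^sup>+t. liminf (\<lambda>n. \<phi> n x z t) \<partial>lborel \<partial>\<mu>)"
      by (rule nn_integral_mono_AE, rule eventually_mono[OF mu_supp]) (intro nn_integral_mono key x)
  qed
  also have "\<dots> \<le> (\<integral>\<^sup>+x. \<integral>\<^sup>+z. liminf (\<lambda>n. \<integral>\<^sup>+t. \<phi> n x z t \<partial>lborel) \<partial>\<mu> \<partial>\<mu>)"
    by (intro nn_integral_mono nn_integral_liminf) measurable
  also have "\<dots> \<le> (\<integral>\<^sup>+x. liminf (\<lambda>n. \<integral>\<^sup>+z. \<integral>\<^sup>+t. \<phi> n x z t \<partial>lborel \<partial>\<mu>) \<partial>\<mu>)"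
    by (intro nn_integral_mono nn_integral_liminf) measurable
  also have "\<dots> \<le> liminf (\<lambda>n. \<integral>\<^sup>+x. \<integral>\<^sup>+z. \<integral>\<^sup>+t. \<phi> n x z t \<partial>lborel \<partial>\<mu> \<partial>\<mu>)"
    by (intro nn_integral_liminf) measurable
  also have "\<dots> \<le> 2 ^ ?d * S"
  proof (intro Liminf_le always_eventually allI)
    fix n
    have "(\<integral>\<^sup>+x. \<integral>\<^sup>+z. \<integral>\<^sup>+t. \<phi> n x z t \<partial>lborel \<partial>\<mu> \<partial>\<mu>)
      = (\<integral>\<^sup>+x. \<integral>\<^sup>+z. \<integral>\<^sup>+v. \<integral>\<^sup>+t. k n * (indicator {..<R} (norm v) * indicator G (x, v) *
       (indicator {1..2} t * indicator {..<e n} (norm (z - x - t *\<^sub>R v)))) \<partial>lborel \<partial>lborel \<partial>\<mu> \<partial>\<mu>)"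
      unfolding \<phi>_def by (intro nn_integral_cong nn_integral_swap sigma_finite_lborel) measurable
    also have "\<dots> = (\<integral>\<^sup>+x. \<integral>\<^sup>+v. \<integral>\<^sup>+z. \<integral>\<^sup>+t. k n * (indicator {..<R} (norm v) * indicator G (x, v) *
       (indicator {1..2} t * indicator {..<e n} (norm (z - x - t *\<^sub>R v)))) \<partial>lborel \<partial>\<mu> \<partial>lborel \<partial>\<mu>)"
      by (intro nn_integral_cong nn_integral_swap sigma_finite_lborel sigma_finite_mu) measurable
    also have "\<dots> = k n * (\<integral>\<^sup>+x. \<integral>\<^sup>+v. \<integral>\<^sup>+z. \<integral>\<^sup>+t. indicator {..<R} (norm v) * indicator G (x, v) *
       (indicator {1..2} t * indicator {..<e n} (norm (z - x - t *\<^sub>R v))) \<partial>lborel \<partial>\<mu> \<partial>lborel \<partial>\<mu>)"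
      by (simp add: nn_integral_cmult)
    also have "\<dots> \<le> k n * (ennreal (w * e n ^ ?d) * S)"
      unfolding S_def w_def by (intro mult_left_mono direction_mass_bound R_pos e cc f) auto
    also have "\<dots> = (k n * ennreal (w * e n ^ ?d)) * S" by (simp add: mult.assoc)
    also have "k n * ennreal (w * e n ^ ?d) = 2 ^ ?d"
      using w e[of n] by (simp add: k_def ennreal_mult[symmetric] ennreal_power[symmetric])
    finally show "(\<integral>\<^sup>+x. \<integral>\<^sup>+z. \<integral>\<^sup>+t. \<phi> n x z t \<partial>lborel \<partial>\<mu> \<partial>\<mu>) \<le> 2 ^ ?d * S" .
  qed simp
  finally show ?thesis unfolding S_def .
qed

text \<open>
  Absolute continuity of the radial projections of \<open>\<mu>\<close> from \<open>\<mu>\<close>-almost every centre, in transfer form.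
\<close>
lemma radial_transfer:
  assumes P [measurable]: "Measurable.pred (borel \<Otimes>\<^sub>M borel) (\<lambda>z. P (fst z) (snd z))"
    and AE: "AE x in \<mu>. AE v in lborel. P x v"
    and inv: "\<And>x v t. P x v \<Longrightarrow> 0 < t \<Longrightarrow> P x (t *\<^sub>R v)"
  shows "AE x in \<mu>. AE z in \<mu>. P x (z - x)"
proof -
  \<comment> \<open>As t >= 1 and both points have norm below R0, the vectors (z - x) / t have norm
    below 2 R0.\<close>
  define R where "R = 2 * R0 + 1"
  have R: "0 < R" "2 * R0 < R" using R0 by (auto simp: R_def)
  obtain f :: "'a \<times> 'a \<Rightarrow> ennreal" where f_meas [measurable]: "f \<in> borel_measurable borel" and I_fin: "(\<integral>\<^sup>+y. (f y)\<^sup>2 \<partial>lborel) < \<top>" and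
      f: "\<And>h. h \<in> borel_measurable borel \<Longrightarrow>
      (\<integral>\<^sup>+v. \<integral>\<^sup>+\<theta>. indicator {..<R} (norm v) * h (v, ray_pt \<theta> v) \<partial>rays \<partial>lborel) = (\<integral>\<^sup>+y. f y * h y \<partial>lborel)"
    by (rule rays_density[OF R(1)]) (rule that)
  define N where "N = {z :: 'a \<times> 'a. \<not> P (fst z) (snd z)}"
  have N [measurable]: "N \<in> sets (borel \<Otimes>\<^sub>M borel)"
  proof -
    have "{z \<in> space (borel \<Otimes>\<^sub>M borel). \<not> P (fst z) (snd z)} \<in> sets (borel \<Otimes>\<^sub>M borel)"
      by measurable
    then show ?thesis by (simp add: N_def space_pair_measure)
  qed
  then have N' [measurable]: "N \<in> sets borel" by (simp only: borel_prod)
  define B where "B = density lborel (\<lambda>v::'a. indicator {..<R} (norm v) :: ennreal)"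
  have setsB [measurable_cong]: "sets B = sets borel" by (simp add: B_def)
  have finB: "finite_measure B"
  proof (rule finite_measureI)
    have "emeasure B (space B) = (\<integral>\<^sup>+v. indicator {..<R} (norm (0 - v)) \<partial>(lborel :: 'a measure))"
      unfolding B_def by (subst emeasure_density) auto
    also have "\<dots> < \<infinity>" using R by (subst nn_integral_ball_indicator) auto
    finally show "emeasure B (space B) \<noteq> \<infinity>" by simp
  qed
  interpret B: finite_measure B by (rule finB)
  interpret MB: pair_sigma_finite \<mu> B ..
  define M where "M = \<mu> \<Otimes>\<^sub>M B"
  have setsM: "sets M = sets borel"
    unfolding M_def borel_prod[symmetric] by (intro sets_pair_measure_cong sets_mu setsB)
  have finM: "finite_measure M"
    unfolding M_def
    by (rule finite_measureI) (simp add: space_pair_measure B.emeasure_pair_measure_Times ennreal_mult_eq_top_iff)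
  have emeasure_M: "emeasure M G = (\<integral>\<^sup>+x. \<integral>\<^sup>+v. indicator {..<R} (norm v) * indicator G (x, v) \<partial>lborel \<partial>\<mu>)"
    if "G \<in> sets borel" for G
  proof -
    have G [measurable]: "G \<in> sets (borel \<Otimes>\<^sub>M borel)" using that by (simp only: borel_prod)
    have G': "G \<in> sets (\<mu> \<Otimes>\<^sub>M B)" using that setsM by (simp add: M_def)
    have "emeasure M G = (\<integral>\<^sup>+x. \<integral>\<^sup>+v. indicator G (x, v) \<partial>B \<partial>\<mu>)"
      unfolding M_def using G' by (rule B.emeasure_pair_measure)
    also have "\<dots> = (\<integral>\<^sup>+x. \<integral>\<^sup>+v. indicator {..<R} (norm v) * indicator G (x, v) \<partial>lborel \<partial>\<mu>)"
      unfolding B_def by (intro nn_integral_cong nn_integral_density) measurable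
    finally show ?thesis .
  qed
  have N0: "emeasure M N = 0"
  proof -
    have "AE x in \<mu>. (\<integral>\<^sup>+v. indicator {..<R} (norm v) * indicator N (x, v) \<partial>lborel) = 0"
      using AE
    proof eventually_elim
      case (elim x)
      then have "AE v in lborel. indicator {..<R} (norm v) * indicator N (x, v) = (0::ennreal)"
        by eventually_elim (simp add: N_def)
      then show ?case by (subst nn_integral_0_iff_AE) auto
    qed
    then show ?thesis
      unfolding emeasure_M[OF N'] by (subst nn_integral_0_iff_AE) auto
  qed
  \<comment> \<open>Dividing by t in [1, 2] spreads each direction over a segment, so that the law
    can be compared with Lebesgue measure in v. Positive homogeneity of P undoes this at the
    end.\<close>
  define Lam where "Lam = (\<lambda>G. \<integral>\<^sup>+x. \<integral>\<^sup>+z. \<integral>\<^sup>+t. indicator {1..2} t * indicator G (x, (1 / t) *\<^sub>R (z - x)) \<partial>lborel \<partial>\<mu> \<partial>\<mu>)"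
  \<comment> \<open>The order of the choices matters: cc is small against the full square integral,
    then K makes the tail small even after division by cc, and last the open set G is taken so thin
    that K times its mass is small.\<close>
  have small: "Lam N \<le> 2 ^ DIM('a) * ennreal (3 * \<eta>)" if \<eta>: "0 < \<eta>" for \<eta> :: real
  proof -
    obtain i where i: "(\<integral>\<^sup>+y. (f y)\<^sup>2 \<partial>lborel) = ennreal i" "0 \<le> i"
      using I_fin by (cases "\<integral>\<^sup>+y. (f y)\<^sup>2 \<partial>lborel") auto
    define cc where "cc = ennreal (\<eta> / (i + 1))"
    have cc: "0 < cc" "cc < \<top>" using \<eta> i by (auto simp: cc_def)
    have cI: "cc * (\<integral>\<^sup>+y. (f y)\<^sup>2 \<partial>lborel) \<le> ennreal \<eta>"
    proof -
      have "\<eta> / (i + 1) * i \<le> \<eta>" using \<eta> i by (simp add: divide_le_eq field_simps)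
      then show ?thesis using \<eta> i by (simp add: cc_def ennreal_mult[symmetric] ennreal_leI)
    qed
    have "0 < cc * ennreal \<eta>" using cc \<eta> by (simp add: ennreal_zero_less_mult_iff)
    from order_tendstoD(2)[OF tail_tendsto_0[OF _ I_fin] this]
    obtain K where K: "(\<integral>\<^sup>+y. (f y)\<^sup>2 * indicator {of_nat K<..} (f y) \<partial>lborel) < cc * ennreal \<eta>"
      using f_meas by (auto simp: eventually_sequentially)
    have HK: "(\<integral>\<^sup>+y. (f y)\<^sup>2 * indicator {of_nat K<..} (f y) \<partial>lborel) / cc \<le> ennreal \<eta>"
    proof -
      have "(\<integral>\<^sup>+y. (f y)\<^sup>2 * indicator {of_nat K<..} (f y) \<partial>lborel) / cc \<le> (ennreal \<eta> * cc) / cc"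
        using K by (intro divide_right_mono_ennreal) (simp add: mult.commute)
      also have "\<dots> = ennreal \<eta>" using cc by (intro ennreal_mult_divide_eq) auto
      finally show ?thesis .
    qed
    obtain G where G: "open G" "N \<subseteq> G" "emeasure M (G - N) < ennreal (\<eta> / real (Suc K))"
      by (rule outer_regular_null[OF finM setsM N', of "ennreal (\<eta> / real (Suc K))"]) (use \<eta> that in auto)
    have "emeasure M G = emeasure M (G - N)"
      using G N0 N' by (intro emeasure_Diff_null_set[symmetric]) (auto simp: setsM intro!: null_setsI)
    with G have MG: "emeasure M G \<le> ennreal (\<eta> / real (Suc K))" by auto
    have KM: "of_nat K * emeasure M G \<le> ennreal \<eta>"
    proof -
      have "of_nat K * emeasure M G \<le> ennreal (real K) * ennreal (\<eta> / real (Suc K))"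
        using MG by (simp add: ennreal_of_nat_eq_real_of_nat mult_left_mono)
      also have "\<dots> = ennreal (real K * (\<eta> / real (Suc K)))" using \<eta> by (intro ennreal_mult[symmetric]) auto
      also have "\<dots> \<le> ennreal \<eta>" using \<eta> by (intro ennreal_leI) (simp add: field_simps)
      finally show ?thesis .
    qed
    have "Lam N \<le> Lam G"
      unfolding Lam_def using G(2) by (intro nn_integral_mono) (auto simp: indicator_def)
    also have "\<dots> \<le> 2 ^ DIM('a) * (of_nat K * (\<integral>\<^sup>+x. \<integral>\<^sup>+v. indicator {..<R} (norm v) * indicator G (x, v) \<partial>lborel \<partial>\<mu>)
        + (cc * (\<integral>\<^sup>+y. (f y)\<^sup>2 \<partial>lborel) + (\<integral>\<^sup>+y. (f y)\<^sup>2 * indicator {of_nat K<..} (f y) \<partial>lborel) / cc))"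
      unfolding Lam_def by (intro direction_measure_open_le R cc f_meas G f)
    also have "\<dots> \<le> 2 ^ DIM('a) * (ennreal \<eta> + (ennreal \<eta> + ennreal \<eta>))"
      using KM G(1) by (intro mult_left_mono add_mono cI HK) (auto simp: emeasure_M)
    also have "ennreal \<eta> + (ennreal \<eta> + ennreal \<eta>) = ennreal (3 * \<eta>)"
      using \<eta> by (simp flip: ennreal_plus)
    finally show ?thesis .
  qed
  have "Lam N \<le> 0 + ennreal \<eta>" if "0 < \<eta>" for \<eta> :: real
  proof -
    have "Lam N \<le> 2 ^ DIM('a) * ennreal (3 * (\<eta> / (3 * 2 ^ DIM('a))))"
      using that by (intro small) auto
    also have "\<dots> = ennreal (2 ^ DIM('a) * (3 * (\<eta> / (3 * 2 ^ DIM('a)))))"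
      using that by (subst ennreal_mult) (auto simp: ennreal_power[symmetric])
    also have "\<dots> = ennreal \<eta>" by simp
    finally show ?thesis by simp
  qed
  then have "Lam N = 0" using ennreal_le_epsilon[of 0 "Lam N"] by auto
  then have "AE x in \<mu>. (\<integral>\<^sup>+z. \<integral>\<^sup>+t. indicator {1..2} t * indicator N (x, (1 / t) *\<^sub>R (z - x)) \<partial>lborel \<partial>\<mu>) = 0"
    unfolding Lam_def by (subst (asm) nn_integral_0_iff_AE) measurable
  then show ?thesis
  proof eventually_elim
    case (elim x)
    then have "AE z in \<mu>. (\<integral>\<^sup>+t. indicator {1..2} t * indicator N (x, (1 / t) *\<^sub>R (z - x)) \<partial>lborel) = 0"
      by (subst (asm) nn_integral_0_iff_AE) measurable
    then show ?case
    proof eventually_elim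
      case (elim z)
      have ae: "AE t in lborel. indicator {1..2} t * indicator N (x, (1 / t) *\<^sub>R (z - x)) = (0::ennreal)"
        using elim by (subst (asm) nn_integral_0_iff_AE) measurable
      show "P x (z - x)"
      proof (rule ccontr)
        assume not: "\<not> P x (z - x)"
        have "AE t in lborel. t \<notin> {1..2::real}"
          using ae
        proof eventually_elim
          case (elim t)
          show ?case
          proof
            assume t: "t \<in> {1..2}"
            with elim have "P x ((1 / t) *\<^sub>R (z - x))" by (auto simp: N_def indicator_def split: if_splits)
            from inv[OF this, of t] t not show False by simp
          qed
        qed
        \<comment> \<open>A single bad pair (x, z) would make every t in [1, 2] bad, but only a null
          set of t is.\<close>
        then have "{1..2::real} \<in> null_sets lborel"
          by (subst AE_iff_null_sets) auto
        then show False by (simp add: null_sets_def)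
      qed
    qed
  qed
qed

end

section \<open>Slabs, hyperplanes and energies\<close>

text \<open>A packing argument that spares a rotation. Put \<delta> = e / |u|. The translates of the
  truncated slab by 2 k \<delta> along u / |u| are disjoint and stay in the ball of radius R + 1
  while 2 k \<delta> <= 1, so about 1 / (2 \<delta>) copies share the volume of this ball.\<close>

lemma slab_volume:
  fixes u :: "'a::euclidean_space"
  assumes "u \<noteq> 0" "0 < R" "0 < e"
  shows "(\<integral>\<^sup>+y. indicator {..<R} (norm y) * indicator {..<e} \<bar>u \<bullet> y - b\<bar> \<partial>lborel)
    \<le> ennreal (4 * (unit_ball_vol DIM('a) * (R + 1) ^ DIM('a)) * e / norm u)"
proof -
  define V where "V = unit_ball_vol (real DIM('a)) * (R + 1) ^ DIM('a)"
  have V: "0 \<le> V" "emeasure lborel (ball (0::'a) (R + 1)) = ennreal V"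
    using assms by (auto simp: V_def emeasure_ball)
  define \<delta> where "\<delta> = e / norm u"
  have \<delta>: "0 < \<delta>" "\<delta> * norm u = e" using assms by (auto simp: \<delta>_def)
  define S where "S = {y. norm y < R \<and> \<bar>u \<bullet> y - b\<bar> < e}"
  have [measurable]: "S \<in> sets borel" unfolding S_def by measurable
  have eq: "(\<integral>\<^sup>+y. indicator {..<R} (norm y) * indicator {..<e} \<bar>u \<bullet> y - b\<bar> \<partial>lborel) = emeasure lborel S"
  proof -
    have "(\<integral>\<^sup>+y. indicator {..<R} (norm y) * indicator {..<e} \<bar>u \<bullet> y - b\<bar> \<partial>lborel) = (\<integral>\<^sup>+y. indicator S y \<partial>lborel)"
      by (intro nn_integral_cong) (auto simp: S_def indicator_def)
    then show ?thesis by simp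
  qed
  have "emeasure lborel S \<le> ennreal (4 * \<delta>) * ennreal V"
  proof (cases "1 \<le> 4 * \<delta>")
    case True
    have "emeasure lborel S \<le> emeasure lborel (ball (0::'a) (R + 1))"
      by (intro emeasure_mono) (auto simp: S_def)
    also have "\<dots> \<le> ennreal (4 * \<delta>) * ennreal V"
      using True V by (simp add: ennreal_mult[symmetric] ennreal_leI mult_le_cancel_right1)
    finally show ?thesis .
  next
    case False
    define n where "n = nat \<lfloor>1 / (2 * \<delta>)\<rfloor>"
    have n: "real n \<le> 1 / (2 * \<delta>)" "1 / (2 * \<delta>) < real n + 1"
      using \<delta> by (auto simp: n_def)
    then have n1: "2 * real n * \<delta> \<le> 1" and n2: "1 < (real n + 1) * (2 * \<delta>)" 
      using \<delta> by (auto simp: field_simps)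
    \<comment> \<open>As 4 \<delta> < 1, rounding down loses at most half of the copies; this is the
      source of the constant 4.\<close>
    have n3: "1 \<le> 4 * \<delta> * real n"
      using n2 False by (simp add: algebra_simps)
    define s where "s = (\<lambda>k::nat. (2 * real k * \<delta> / norm u) *\<^sub>R u)"
    define T where "T = (\<lambda>k. (+) (- s k) -` S)"
    have T_meas [measurable]: "T k \<in> sets borel" for k
      using measurable_sets[of "(+) (- s k)" borel borel S] by (simp add: T_def)
    have T_eq: "emeasure lborel (T k) = emeasure lborel S" for k
    proof -
      have "emeasure lborel S = emeasure (distr lborel borel ((+) (- s k))) S"
        by (simp only: lborel_distr_plus)
      also have "\<dots> = emeasure lborel (T k)"
        by (subst emeasure_distr) (auto simp: T_def)
      finally show ?thesis by simp
    qed
    have us: "u \<bullet> s k = 2 * real k * e" for k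
      using assms by (simp add: s_def \<delta>_def power2_norm_eq_inner[symmetric] power2_eq_square)
    have disj: "disjoint_family_on T {..<n}"
      unfolding disjoint_family_on_def
    proof (intro ballI impI)
      fix i j :: nat assume ij: "i \<noteq> j"
      show "T i \<inter> T j = {}"
      proof (rule ccontr)
        assume "T i \<inter> T j \<noteq> {}"
        then obtain y where "y \<in> T i" "y \<in> T j" by auto
        then have "\<bar>u \<bullet> y - 2 * real i * e - b\<bar> < e" "\<bar>u \<bullet> y - 2 * real j * e - b\<bar> < e"
          by (auto simp: T_def S_def inner_diff_right us)
        then have "\<bar>2 * real i * e - 2 * real j * e\<bar> < 2 * e" by linarith
        also have "2 * real i * e - 2 * real j * e = 2 * e * (real i - real j)"
          by (simp add: algebra_simps)
        finally have "2 * e * \<bar>real i - real j\<bar> < 2 * e * 1" using assms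
          by (simp add: abs_mult)
        then have "\<bar>real i - real j\<bar> < 1" using assms by simp
        then show False using ij by linarith
      qed
    qed
    have sub: "T k \<subseteq> ball 0 (R + 1)" if "k < n" for k
    proof
      fix y assume "y \<in> T k"
      then have "norm (y - s k) < R" by (simp add: T_def S_def)
      moreover have "norm (s k) = 2 * real k * \<delta>" using \<delta> assms by (simp add: s_def)
      moreover have "2 * real k * \<delta> \<le> 2 * real n * \<delta>" using that \<delta> by (intro mult_right_mono) auto
      moreover have "norm y \<le> norm (y - s k) + norm (s k)" by norm
      ultimately show "y \<in> ball 0 (R + 1)" using n1 by simp
    qed
    have "of_nat n * emeasure lborel S = (\<Sum>k<n. emeasure lborel (T k))" by (simp add: T_eq)
    also have "\<dots> = emeasure lborel (\<Union>k<n. T k)"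
      by (intro sum_emeasure disj) auto
    also have "\<dots> \<le> emeasure lborel (ball (0::'a) (R + 1))"
      using sub by (intro emeasure_mono) auto
    finally have nS: "of_nat n * emeasure lborel S \<le> ennreal V" by (simp add: V)
    have "emeasure lborel S = 1 * emeasure lborel S" by simp
    also have "\<dots> \<le> ennreal (4 * \<delta> * real n) * emeasure lborel S"
      using ennreal_leI[OF n3] by (intro mult_right_mono) auto
    also have "\<dots> = ennreal (4 * \<delta>) * (of_nat n * emeasure lborel S)"
      using \<delta> by (simp add: ennreal_mult ennreal_of_nat_eq_real_of_nat mult.assoc)
    also have "\<dots> \<le> ennreal (4 * \<delta>) * ennreal V" by (intro mult_left_mono nS) auto
    finally show ?thesis .
  qed
  also have "\<dots> = ennreal (4 * V * e / norm u)"
    using assms V by (subst ennreal_mult[symmetric]) (auto simp: \<delta>_def mult_ac)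
  finally show ?thesis unfolding eq V_def .
qed

context frostman_measure
begin

text \<open>Dyadic shells: at distance about 2^-k the kernel is at most 2^((k + 1) (d - 1)) and the
  ball has mass at most c 2^(-k \<tau>). The shells sum to a geometric series with ratio q = 2^(d -
  1 - \<tau>) < 1, uniformly in the centre.\<close>

lemma energy_bound:
  obtains C where "C < \<top>" "\<And>w. (\<integral>\<^sup>+z. ennreal (1 / norm (w - z) ^ (DIM('a) - 1)) \<partial>\<mu>) \<le> C"
proof -
  let ?m = "DIM('a) - 1"
  have m: "real ?m = real DIM('a) - 1" by (simp add: of_nat_diff)
  define q where "q = 2 powr (real ?m - \<tau>)"
  have q: "0 < q" "q < 1" using tau m by (auto simp: q_def powr_less_one)
  define a where "a = (\<lambda>k::nat. ennreal ((2 ^ Suc k) ^ ?m))"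
  have pt: "ennreal (1 / norm u ^ ?m) \<le> 1 + (\<Sum>k. a k * indicator (ball 0 ((1/2)^k)) u)" for u :: 'a
  proof (cases "u = 0 \<or> 1 \<le> norm u")
    case True
    \<comment> \<open>At u = 0 the kernel has the value 1 / 0 = 0, or 1 if the exponent is 0, so the
      diagonal is covered by the summand 1.\<close>
    have "1 / norm u ^ ?m \<le> 1"
      using True by (cases "?m = 0") (auto simp: divide_le_eq one_le_power power_0_left)
    then have "ennreal (1 / norm u ^ ?m) \<le> 1" by simp
    then show ?thesis by (rule order_trans) simp
  next
    case False
    then have u: "0 < norm u" "norm u < 1" by auto
    obtain n0 where "(1/2) ^ n0 < norm u" using real_arch_pow_inv[of "norm u" "1/2"] u by auto
    then obtain n where n: "(1/2) ^ n < norm u" "\<And>k. k < n \<Longrightarrow> \<not> (1/2) ^ k < norm u"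
      using exists_least_iff[of "\<lambda>n. (1/2) ^ n < norm u"] by blast
    have "n \<noteq> 0" using n(1) u by (cases n) auto
    then obtain k where k: "n = Suc k" by (cases n) auto
    have "norm u \<le> (1/2) ^ k" using n(2)[of k] k by simp
    show ?thesis
    proof (cases "norm u < (1/2) ^ k")
      case True
      have "1 / norm u ^ ?m = (1 / norm u) ^ ?m" by (simp add: power_one_over)
      also have "\<dots> \<le> (2 ^ Suc k) ^ ?m"
        using n(1) u unfolding k by (intro power_mono) (auto simp: field_simps power_one_over)
      finally have "ennreal (1 / norm u ^ ?m) \<le> a k" unfolding a_def by (rule ennreal_leI)
      also have "a k = (\<Sum>i\<in>{k}. a i * indicator (ball 0 ((1/2)^i)) u)" using True by simp
      also have "\<dots> \<le> (\<Sum>i. a i * indicator (ball 0 ((1/2)^i)) u)"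
        by (intro sum_le_suminf) auto
      finally show ?thesis by (rule order_trans) simp
    next
      case False
      \<comment> \<open>The balls are open, so a point on the sphere of radius 2^-k is accounted for
        by the next larger ball.\<close>
      then have nu: "norm u = (1/2) ^ k" using \<open>norm u \<le> (1/2) ^ k\<close> by simp
      then have "k \<noteq> 0" using u by (cases k) auto
      then obtain j where j: "k = Suc j" by (cases k) auto
      have "norm u * 2 = (1/2) ^ j" using nu j by simp
      then have lt: "norm u < (1/2) ^ j" using u(1) by linarith
      have "1 / norm u ^ ?m = (2 ^ Suc j) ^ ?m" by (simp add: nu j power_one_over)
      then have "ennreal (1 / norm u ^ ?m) = a j" unfolding a_def by simp
      also have "a j = (\<Sum>i\<in>{j}. a i * indicator (ball 0 ((1/2)^i)) u)" using lt by simp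
      also have "\<dots> \<le> (\<Sum>i. a i * indicator (ball 0 ((1/2)^i)) u)"
        by (intro sum_le_suminf) auto
      finally show ?thesis by (rule order_trans) simp
    qed
  qed
  have "(\<integral>\<^sup>+z. ennreal (1 / norm (w - z) ^ ?m) \<partial>\<mu>) \<le> 1 + (\<Sum>k. ennreal (2 ^ ?m * c * q ^ k))" for w
  proof -
    have [measurable]: "ball w r \<in> sets borel" for r by simp
    have "(\<integral>\<^sup>+z. ennreal (1 / norm (w - z) ^ ?m) \<partial>\<mu>) \<le> (\<integral>\<^sup>+z. 1 + (\<Sum>k. a k * indicator (ball w ((1/2)^k)) z) \<partial>\<mu>)"
    proof (intro nn_integral_mono)
      fix z
      have "indicator (ball 0 r) (w - z) = (indicator (ball w r) z :: ennreal)" for r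
        by (simp add: indicator_def dist_norm norm_minus_commute)
      then show "ennreal (1 / norm (w - z) ^ ?m) \<le> 1 + (\<Sum>k. a k * indicator (ball w ((1/2)^k)) z)"
        using pt[of "w - z"] by simp
    qed
    also have "(\<integral>\<^sup>+z. 1 + (\<Sum>k. a k * indicator (ball w ((1/2)^k)) z) \<partial>\<mu>) = (\<integral>\<^sup>+z. 1 \<partial>\<mu>) + (\<integral>\<^sup>+z. (\<Sum>k. a k * indicator (ball w ((1/2)^k)) z) \<partial>\<mu>)"
      by (rule nn_integral_add) measurable
    also have "\<dots> = 1 + (\<Sum>k. a k * emeasure \<mu> (ball w ((1/2)^k)))"
      using emeasure_space_1 by (simp add: nn_integral_suminf nn_integral_cmult_indicator sets_mu)
    also have "\<dots> \<le> 1 + (\<Sum>k. ennreal (2 ^ ?m * c * q ^ k))"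
    proof (intro add_left_mono suminf_le)
      fix k
      have "a k * emeasure \<mu> (ball w ((1/2)^k)) \<le> a k * ennreal (c * ((1/2)^k) powr \<tau>)"
        by (intro mult_left_mono mu_ball) auto
      also have "\<dots> = ennreal ((2 ^ Suc k) ^ ?m * (c * ((1/2)^k) powr \<tau>))"
        using c unfolding a_def by (intro ennreal_mult[symmetric]) auto
      also have "(2 ^ Suc k) ^ ?m * (c * ((1/2)^k) powr \<tau>) = 2 ^ ?m * c * q ^ k"
      proof -
        have "2 powr real ?m = (2 :: real) ^ ?m" by (rule powr_realpow) simp
        then have "(2 ^ Suc k :: real) ^ ?m = 2 ^ ?m * (2 powr real ?m) ^ k"
          by (simp only: power_mult[symmetric] power_add[symmetric] power_Suc[symmetric]) (simp add: mult.commute power_add)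
        moreover have "((1/2 :: real) ^ k) powr \<tau> = (2 powr (- \<tau>)) ^ k"
          by (simp add: powr_minus powr_power powr_powr power_one_over powr_divide inverse_eq_divide mult.commute flip: powr_realpow)
        moreover have "q = 2 powr real ?m * 2 powr (- \<tau>)" unfolding q_def by (simp flip: powr_add)
        ultimately show ?thesis by (simp add: power_mult_distrib)
      qed
      finally show "a k * emeasure \<mu> (ball w ((1/2)^k)) \<le> ennreal (2 ^ ?m * c * q ^ k)" .
    qed auto
    finally show ?thesis .
  qed
  moreover have "1 + (\<Sum>k. ennreal (2 ^ ?m * c * q ^ k)) < \<top>"
  proof -
    have "summable (\<lambda>k. 2 ^ ?m * c * q ^ k)" using q by (intro summable_mult summable_geometric) auto
    then have "(\<Sum>k. ennreal (2 ^ ?m * c * q ^ k)) \<noteq> \<top>"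
      using q c by (intro ennreal_suminf_neq_top) auto
    then show ?thesis by (simp add: less_top)
  qed
  ultimately show ?thesis using that by blast
qed

text \<open>Double counting of the pairs w in H, p in space with |w - p| < e. From w one sees a ball
  of volume of order e^d; the points p fill part of a slab of volume O(e) and each sees mass at most
  c e^\<tau>. Hence \<mu>(H) is O(e^(1 + \<tau> - d)), with a positive exponent. The truncation by
  R0 makes the slab bounded.\<close>

lemma mu_hyperplane:
  assumes u: "u \<noteq> 0"
  shows "AE w in \<mu>. u \<bullet> w \<noteq> b"
proof -
  let ?w = "unit_ball_vol (real DIM('a))"
  define H where "H = {w :: 'a. u \<bullet> w = b \<and> norm w < R0}"
  have [measurable]: "H \<in> sets borel" unfolding H_def by measurable
  define k where "k = 4 * c * (R0 + 1 + 1) ^ DIM('a)"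
  have k: "0 \<le> k" using c R0 by (simp add: k_def)
  have bound: "measure \<mu> H \<le> k * e powr (1 + \<tau> - DIM('a))" if e: "0 < e" "e < 1" for e
  proof -
    have "ennreal (?w * e ^ DIM('a)) * emeasure \<mu> H = (\<integral>\<^sup>+w. indicator H w * (\<integral>\<^sup>+p. indicator {..<e} (norm (w - p)) \<partial>lborel) \<partial>\<mu>)"
      using e by (simp add: nn_integral_ball_indicator nn_integral_multc mult.commute)
    also have "\<dots> = (\<integral>\<^sup>+w. \<integral>\<^sup>+p. indicator H w * indicator {..<e} (norm (w - p)) \<partial>lborel \<partial>\<mu>)"
      by (simp add: nn_integral_cmult)
    also have "\<dots> = (\<integral>\<^sup>+p. \<integral>\<^sup>+w. indicator H w * indicator {..<e} (norm (w - p)) \<partial>\<mu> \<partial>lborel)"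
      by (intro nn_integral_swap sigma_finite_mu sigma_finite_lborel) measurable
    also have "\<dots> \<le> (\<integral>\<^sup>+p. (indicator {..<R0 + 1} (norm p) * indicator {..<norm u * e} \<bar>u \<bullet> p - b\<bar>) * ennreal (c * e powr \<tau>) \<partial>lborel)"
    proof (intro nn_integral_mono)
      fix p
      have "(\<integral>\<^sup>+w. indicator H w * indicator {..<e} (norm (w - p)) \<partial>\<mu>)
         \<le> (\<integral>\<^sup>+w. (indicator {..<R0 + 1} (norm p) * indicator {..<norm u * e} \<bar>u \<bullet> p - b\<bar>) * indicator (ball p e) w \<partial>\<mu>)"
      proof (intro nn_integral_mono)
        fix w
        show "indicator H w * indicator {..<e} (norm (w - p))
          \<le> (indicator {..<R0 + 1} (norm p) * indicator {..<norm u * e} \<bar>u \<bullet> p - b\<bar>) * (indicator (ball p e) w :: ennreal)"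
        proof (cases "w \<in> H \<and> norm (w - p) < e")
          case True
          have "norm p \<le> norm w + norm (w - p)" by norm
          moreover have "\<bar>u \<bullet> p - b\<bar> = \<bar>u \<bullet> (w - p)\<bar>" using True by (auto simp: H_def inner_diff_right)
          moreover have "\<bar>u \<bullet> (w - p)\<bar> \<le> norm u * norm (w - p)" by (rule Cauchy_Schwarz_ineq2)
          moreover have "norm u * norm (w - p) < norm u * e" using True u by simp
          ultimately show ?thesis using True e by (auto simp: H_def indicator_def dist_norm norm_minus_commute)
        qed (auto simp: indicator_def)
      qed
      also have "\<dots> = (indicator {..<R0 + 1} (norm p) * indicator {..<norm u * e} \<bar>u \<bullet> p - b\<bar>) * emeasure \<mu> (ball p e)"
        by (rule nn_integral_cmult_indicator) (simp add: sets_mu)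
      also have "\<dots> \<le> (indicator {..<R0 + 1} (norm p) * indicator {..<norm u * e} \<bar>u \<bullet> p - b\<bar>) * ennreal (c * e powr \<tau>)"
        by (intro mult_left_mono mu_ball e) auto
      finally show "(\<integral>\<^sup>+w. indicator H w * indicator {..<e} (norm (w - p)) \<partial>\<mu>) \<le> \<dots>" .
    qed
    also have "\<dots> = (\<integral>\<^sup>+p. indicator {..<R0 + 1} (norm p) * indicator {..<norm u * e} \<bar>u \<bullet> p - b\<bar> \<partial>lborel) * ennreal (c * e powr \<tau>)"
      by (rule nn_integral_multc) measurable
    also have "\<dots> \<le> ennreal (4 * (?w * (R0 + 1 + 1) ^ DIM('a)) * (norm u * e) / norm u) * ennreal (c * e powr \<tau>)"
      using u e R0 by (intro mult_right_mono slab_volume) auto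
    also have "\<dots> = ennreal (4 * (?w * (R0 + 1 + 1) ^ DIM('a)) * e * (c * e powr \<tau>))"
      using u e R0 c by (subst ennreal_mult[symmetric]) auto
    finally have "ennreal (?w * e ^ DIM('a) * measure \<mu> H) \<le> ennreal (4 * (?w * (R0 + 1 + 1) ^ DIM('a)) * e * (c * e powr \<tau>))"
      using e by (simp add: ennreal_mult emeasure_eq_measure)
    then have "?w * e ^ DIM('a) * measure \<mu> H \<le> 4 * (?w * (R0 + 1 + 1) ^ DIM('a)) * e * (c * e powr \<tau>)"
      using e R0 c by (subst (asm) ennreal_le_iff) auto
    then have "?w * (e ^ DIM('a) * measure \<mu> H) \<le> ?w * (k * (e * e powr \<tau>))"
      by (simp add: k_def mult_ac)
    then have "e ^ DIM('a) * measure \<mu> H \<le> k * (e * e powr \<tau>)"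
      by simp
    moreover have "e * e powr \<tau> = e ^ DIM('a) * e powr (1 + \<tau> - DIM('a))"
      using e by (simp add: powr_diff powr_add powr_realpow)
    ultimately have "e ^ DIM('a) * measure \<mu> H \<le> e ^ DIM('a) * (k * e powr (1 + \<tau> - DIM('a)))"
      by (simp add: mult_ac)
    then show ?thesis using e by simp
  qed
  have "((\<lambda>e. k * e powr (1 + \<tau> - DIM('a))) \<longlongrightarrow> k * 0 powr (1 + \<tau> - DIM('a))) (at_right 0)"
    using tau by (intro tendsto_intros tendsto_powr') (auto simp: eventually_at_right_less eventually_at_filter)
  moreover have "\<forall>\<^sub>F e in at_right 0. measure \<mu> H \<le> k * e powr (1 + \<tau> - DIM('a))"
    using eventually_at_right_real[of 0 1] by (auto elim!: eventually_mono intro: bound)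
  ultimately have "measure \<mu> H \<le> k * 0 powr (1 + \<tau> - DIM('a))"
    by (intro tendsto_lowerbound[where F="at_right (0::real)"]) auto
  then have "emeasure \<mu> H = 0" by (simp add: emeasure_eq_measure measure_le_0_iff)
  then have "AE w in \<mu>. w \<notin> H" by (intro AE_not_in null_setsI) auto
  then show ?thesis using mu_supp by eventually_elim (auto simp: H_def)
qed

lemma AE_neq: "AE w in \<mu>. w \<noteq> z"
proof -
  obtain u :: 'a where "u \<in> Basis" using nonempty_Basis by blast
  then have "u \<noteq> 0" by auto
  from mu_hyperplane[OF this, of "u \<bullet> z"] show ?thesis by eventually_elim auto
qed

end

section \<open>Energies of squared distance maps\<close>

context frostman_measure
begin

definition pair_energy :: "'i set \<Rightarrow> nat \<Rightarrow> ('i \<Rightarrow> 'a) \<Rightarrow> ennreal" where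
  "pair_energy I n y = (\<integral>\<^sup>+w. \<integral>\<^sup>+w'. (\<Prod>a\<in>I. indicator {..<(1/2)^n} \<bar>(dist w (y a))\<^sup>2 - (dist w' (y a))\<^sup>2\<bar>) \<partial>\<mu> \<partial>\<mu>)"

text \<open>Infinitely many scales instead of all, because a lower limit is what Fatou's lemma
  controls. Dyadic scales and an integer constant keep all quantifiers countable and the predicate
  measurable.\<close>

definition finite_energy :: "'i set \<Rightarrow> ('i \<Rightarrow> 'a) \<Rightarrow> bool" where
  "finite_energy I y \<longleftrightarrow> (\<exists>C::nat. \<forall>m. \<exists>n\<ge>m. 2 ^ (n * card I) * pair_energy I n y \<le> of_nat C)"

lemma measurable_pair_energy:
  assumes I: "finite I" and M: "\<And>a. a \<in> I \<Longrightarrow> sets (M a) = sets borel"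
  shows "pair_energy I n \<in> borel_measurable (Pi\<^sub>M I M)"
proof -
  have [measurable]: "(\<lambda>y. y a) \<in> borel_measurable (Pi\<^sub>M I M)" if "a \<in> I" for a
    using measurable_component_singleton[OF that, of M] M[OF that] by (simp cong: measurable_cong_sets)
  show ?thesis unfolding pair_energy_def by measurable
qed

lemma pred_finite_energy:
  assumes I: "finite I" and M: "\<And>a. a \<in> I \<Longrightarrow> sets (M a) = sets borel"
  shows "Measurable.pred (Pi\<^sub>M I M) (finite_energy I)"
proof -
  have [measurable]: "pair_energy I n \<in> borel_measurable (Pi\<^sub>M I M)" for n
    using measurable_pair_energy[OF assms] .
  show ?thesis unfolding finite_energy_def by measurable
qed

text \<open>The quadratic term in y cancels, so the difference is affine in y. Both uses of the
  energy rest on this: it places y in a slab, and it makes the energy compatible with affine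
  combinations of the points.\<close>

lemma dist_square_diff:
  "(dist w y)\<^sup>2 - (dist w' y)\<^sup>2 = (norm w)\<^sup>2 - (norm w')\<^sup>2 - (2 *\<^sub>R (w - w')) \<bullet> (y :: 'a)"
  by (simp add: dist_norm power2_norm_eq_inner inner_diff inner_commute algebra_simps)

lemma pair_energy_mult:
  "pair_energy I n y * (\<Prod>a\<in>I. f a) = (\<integral>\<^sup>+w. \<integral>\<^sup>+w'. (\<Prod>a\<in>I. f a * indicator {..<(1/2)^n} \<bar>(dist w (y a))\<^sup>2 - (dist w' (y a))\<^sup>2\<bar>) \<partial>\<mu> \<partial>\<mu>)"
proof -
  have "(\<integral>\<^sup>+w. \<integral>\<^sup>+w'. (\<Prod>a\<in>I. f a * indicator {..<(1/2)^n} \<bar>(dist w (y a))\<^sup>2 - (dist w' (y a))\<^sup>2\<bar>) \<partial>\<mu> \<partial>\<mu>)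
    = (\<integral>\<^sup>+w. (\<Prod>a\<in>I. f a) * (\<integral>\<^sup>+w'. (\<Prod>a\<in>I. indicator {..<(1/2)^n} \<bar>(dist w (y a))\<^sup>2 - (dist w' (y a))\<^sup>2\<bar>) \<partial>\<mu>) \<partial>\<mu>)"
    unfolding prod.distrib by (intro nn_integral_cong nn_integral_cmult) measurable
  also have "\<dots> = (\<Prod>a\<in>I. f a) * pair_energy I n y"
    unfolding pair_energy_def by (intro nn_integral_cmult) measurable
  finally show ?thesis by (simp add: mult.commute)
qed

text \<open>Integrated over bounded y, the product of slab indicators factorizes into slab volumes
  and is at most (V 2^-n / |w - w'|)^(d - 1). The normalizing factor 2^(n (d - 1)) cancels the
  scale, and the kernel of \<open>energy_bound\<close> remains, since the number of points equals
  its exponent.\<close>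

lemma AE_finite_energy:
  fixes I :: "'i set"
  assumes I: "finite I" "card I = DIM('a) - 1"
  shows "AE y in Pi\<^sub>M I (\<lambda>_. lborel). finite_energy I y"
proof -
  interpret product_sigma_finite "\<lambda>_::'i. lborel :: 'a measure" ..
  have sf: "sigma_finite_measure (Pi\<^sub>M I (\<lambda>_. lborel :: 'a measure))" by (rule sigma_finite[OF I(1)])
  let ?m = "DIM('a) - 1"
  have pe [measurable]: "pair_energy I n \<in> borel_measurable (Pi\<^sub>M I (\<lambda>_. lborel))" for n
    by (rule measurable_pair_energy) (use I in auto)
  have kern: "(\<lambda>z. ennreal (1 / norm (w - z) ^ ?m)) \<in> borel_measurable \<mu>" for w by measurable
  have comp [measurable]: "(\<lambda>y. y a) \<in> borel_measurable (Pi\<^sub>M I (\<lambda>_. lborel :: 'a measure))" if "a \<in> I" for a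
    using measurable_component_singleton[OF that, of "\<lambda>_. lborel :: 'a measure"] by simp
  obtain C where C: "C < \<top>" "\<And>w. (\<integral>\<^sup>+z. ennreal (1 / norm (w - z) ^ ?m) \<partial>\<mu>) \<le> C"
    by (rule energy_bound) (rule that)
  have R: "AE y in Pi\<^sub>M I (\<lambda>_. lborel). (\<forall>a\<in>I. norm (y a) < R) \<longrightarrow> finite_energy I y" if R: "0 < R" for R
  proof -
    \<comment> \<open>The constant 4 of \<open>slab_volume\<close> is halved because the normal
      vector is 2 (w - w').\<close>
    define V where "V = 2 * (unit_ball_vol DIM('a) * (R + 1) ^ DIM('a))"
    have V: "0 \<le> V" using R by (simp add: V_def)
    define F where "F = (\<lambda>n y. 2 ^ (n * ?m) * (pair_energy I n y * (\<Prod>a\<in>I. indicator {..<R} (norm (y a)))))"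
    have [measurable]: "F n \<in> borel_measurable (Pi\<^sub>M I (\<lambda>_. lborel))" for n
      unfolding F_def by measurable
    have F_bound: "(\<integral>\<^sup>+y. F n y \<partial>Pi\<^sub>M I (\<lambda>_. lborel)) \<le> ennreal (V ^ ?m) * C" for n
    proof -
      let ?g = "\<lambda>w w' y. indicator {..<R} (norm y) * indicator {..<(1/2)^n} \<bar>(dist w y)\<^sup>2 - (dist w' (y::'a))\<^sup>2\<bar> :: ennreal"
      have slab: "(\<integral>\<^sup>+y. ?g w w' y \<partial>lborel) \<le> ennreal (V * (1/2)^n / norm (w - w'))" if "w \<noteq> w'" for w w'
      proof -
        have "(\<integral>\<^sup>+y. ?g w w' y \<partial>lborel) = (\<integral>\<^sup>+y. indicator {..<R} (norm y) * indicator {..<(1/2)^n} \<bar>(2 *\<^sub>R (w - w')) \<bullet> y - ((norm w)\<^sup>2 - (norm w')\<^sup>2)\<bar> \<partial>lborel)"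
          unfolding dist_square_diff by (simp add: abs_minus_commute)
        also have "\<dots> \<le> ennreal (4 * (unit_ball_vol DIM('a) * (R + 1) ^ DIM('a)) * (1/2)^n / norm (2 *\<^sub>R (w - w')))"
          using that R by (intro slab_volume) auto
        finally show ?thesis by (simp add: V_def mult_ac)
      qed
      have "(\<integral>\<^sup>+y. F n y \<partial>Pi\<^sub>M I (\<lambda>_. lborel)) = 2 ^ (n * ?m) * (\<integral>\<^sup>+y. pair_energy I n y * (\<Prod>a\<in>I. indicator {..<R} (norm (y a))) \<partial>Pi\<^sub>M I (\<lambda>_. lborel))"
        unfolding F_def by (rule nn_integral_cmult) measurable
      also have "(\<integral>\<^sup>+y. pair_energy I n y * (\<Prod>a\<in>I. indicator {..<R} (norm (y a))) \<partial>Pi\<^sub>M I (\<lambda>_. lborel))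
        = (\<integral>\<^sup>+y. \<integral>\<^sup>+w. \<integral>\<^sup>+w'. (\<Prod>a\<in>I. ?g w w' (y a)) \<partial>\<mu> \<partial>\<mu> \<partial>Pi\<^sub>M I (\<lambda>_. lborel))"
      proof (intro nn_integral_cong)
        fix y :: "'i \<Rightarrow> 'a"
        show "pair_energy I n y * (\<Prod>a\<in>I. indicator {..<R} (norm (y a))) = (\<integral>\<^sup>+w. \<integral>\<^sup>+w'. (\<Prod>a\<in>I. ?g w w' (y a)) \<partial>\<mu> \<partial>\<mu>)"
          by (rule pair_energy_mult)
      qed
      also have "\<dots> = (\<integral>\<^sup>+w. \<integral>\<^sup>+y. \<integral>\<^sup>+w'. (\<Prod>a\<in>I. ?g w w' (y a)) \<partial>\<mu> \<partial>Pi\<^sub>M I (\<lambda>_. lborel) \<partial>\<mu>)"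
        by (intro nn_integral_swap sf sigma_finite_mu) measurable
      also have "\<dots> = (\<integral>\<^sup>+w. \<integral>\<^sup>+w'. \<integral>\<^sup>+y. (\<Prod>a\<in>I. ?g w w' (y a)) \<partial>Pi\<^sub>M I (\<lambda>_. lborel) \<partial>\<mu> \<partial>\<mu>)"
        by (intro nn_integral_cong nn_integral_swap sf sigma_finite_mu) measurable
      also have "\<dots> = (\<integral>\<^sup>+w. \<integral>\<^sup>+w'. (\<integral>\<^sup>+y. ?g w w' y \<partial>lborel) ^ ?m \<partial>\<mu> \<partial>\<mu>)"
        using I by (intro nn_integral_cong) (subst product_nn_integral_prod, auto)
      also have "\<dots> \<le> (\<integral>\<^sup>+w. \<integral>\<^sup>+w'. ennreal ((V * (1/2)^n) ^ ?m) * ennreal (1 / norm (w - w') ^ ?m) \<partial>\<mu> \<partial>\<mu>)"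
      proof (rule nn_integral_mono)
        fix w
        show "(\<integral>\<^sup>+w'. (\<integral>\<^sup>+y. ?g w w' y \<partial>lborel) ^ ?m \<partial>\<mu>) \<le> (\<integral>\<^sup>+w'. ennreal ((V * (1/2)^n) ^ ?m) * ennreal (1 / norm (w - w') ^ ?m) \<partial>\<mu>)"
        \<comment> \<open>For w' = w there is no slab; \<mu> has no atoms, so this case is
          negligible.\<close>
        proof (rule nn_integral_mono_AE, rule eventually_mono[OF AE_neq[of w]])
          fix w' assume "w' \<noteq> w"
          then have "(\<integral>\<^sup>+y. ?g w w' y \<partial>lborel) ^ ?m \<le> ennreal (V * (1/2)^n / norm (w - w')) ^ ?m"
            by (intro power_mono slab) auto
          also have "\<dots> = ennreal ((V * (1/2)^n) ^ ?m * (1 / norm (w - w') ^ ?m))"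
            using V by (simp add: ennreal_power power_divide power_mult_distrib)
          also have "\<dots> = ennreal ((V * (1/2)^n) ^ ?m) * ennreal (1 / norm (w - w') ^ ?m)"
            using V by (intro ennreal_mult) auto
          finally show "(\<integral>\<^sup>+y. ?g w w' y \<partial>lborel) ^ ?m \<le> \<dots>" .
        qed
      qed
      also have "\<dots> = (\<integral>\<^sup>+w. ennreal ((V * (1/2)^n) ^ ?m) * (\<integral>\<^sup>+w'. ennreal (1 / norm (w - w') ^ ?m) \<partial>\<mu>) \<partial>\<mu>)"
        by (intro nn_integral_cong nn_integral_cmult kern)
      also have "\<dots> \<le> (\<integral>\<^sup>+w. ennreal ((V * (1/2)^n) ^ ?m) * C \<partial>\<mu>)"
        by (intro nn_integral_mono mult_left_mono C) auto
      also have "\<dots> = ennreal ((V * (1/2)^n) ^ ?m) * C" using emeasure_space_1 by simp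
      finally have "(\<integral>\<^sup>+y. F n y \<partial>Pi\<^sub>M I (\<lambda>_. lborel)) \<le> 2 ^ (n * ?m) * (ennreal ((V * (1/2)^n) ^ ?m) * C)"
        by (simp add: mult_left_mono)
      also have "\<dots> = (2 ^ (n * ?m) * ennreal ((V * (1/2)^n) ^ ?m)) * C" by (simp add: mult.assoc)
      also have "(2::ennreal) ^ (n * ?m) * ennreal ((V * (1/2)^n) ^ ?m) = ennreal (2 ^ (n * ?m) * (V * (1/2)^n) ^ ?m)"
        using V by (simp add: ennreal_mult ennreal_power[symmetric])
      also have "2 ^ (n * ?m) * (V * (1/2)^n) ^ ?m = V ^ ?m"
        unfolding power_mult power_mult_distrib[symmetric] by (simp add: power_one_over)
      finally show ?thesis .
    qed
    \<comment> \<open>The mean of F n is bounded uniformly in n, so by Fatou's lemma the lower limit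
      is finite for almost every y; that is \<open>finite_energy\<close> once the cut-off at R is
      inactive.\<close>
    have "(\<integral>\<^sup>+y. liminf (\<lambda>n. F n y) \<partial>Pi\<^sub>M I (\<lambda>_. lborel)) \<le> liminf (\<lambda>n. \<integral>\<^sup>+y. F n y \<partial>Pi\<^sub>M I (\<lambda>_. lborel))"
      by (rule nn_integral_liminf) measurable
    also have "\<dots> \<le> ennreal (V ^ ?m) * C" by (intro Liminf_le always_eventually allI F_bound) simp
    also have "\<dots> < \<top>" using C by (simp add: ennreal_mult_less_top)
    finally have "AE y in Pi\<^sub>M I (\<lambda>_. lborel). liminf (\<lambda>n. F n y) \<noteq> \<infinity>"
      by (intro nn_integral_PInf_AE) auto
    then show ?thesis
    proof eventually_elim
      case (elim y)
      show ?case
      proof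
        assume y: "\<forall>a\<in>I. norm (y a) < R"
        then have "(\<Prod>a\<in>I. indicator {..<R} (norm (y a))) = (1 :: ennreal)"
          by (intro prod.neutral) auto
        then have F_eq: "F n y = 2 ^ (n * card I) * pair_energy I n y" for n
          by (simp add: F_def I)
        obtain c where c: "liminf (\<lambda>n. F n y) < of_nat c"
          using elim ennreal_Ex_less_of_nat by (auto simp: less_top)
        have "\<exists>n\<ge>m. F n y \<le> of_nat c" for m
        proof (rule ccontr)
          assume "\<not> ?thesis"
          then have "\<forall>\<^sub>F n in sequentially. of_nat c \<le> F n y"
            unfolding eventually_sequentially by (intro exI[of _ m]) (metis linear)
          then have "of_nat c \<le> liminf (\<lambda>n. F n y)" by (rule Liminf_bounded)
          then show False using c by simp
        qed
        then show "finite_energy I y" unfolding finite_energy_def F_eq by blast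
      qed
    qed
  qed
  have "AE y in Pi\<^sub>M I (\<lambda>_. lborel). \<forall>n. (\<forall>a\<in>I. norm (y a) < real (Suc n)) \<longrightarrow> finite_energy I y"
    unfolding AE_all_countable by (intro allI R) simp
  then show ?thesis
  proof eventually_elim
    case (elim y)
    obtain n where n: "(\<Sum>a\<in>I. norm (y a)) < real n" using reals_Archimedean2 by blast
    have "norm (y a) < real (Suc n)" if "a \<in> I" for a
      using member_le_sum[OF that, of "\<lambda>a. norm (y a)"] I n by simp
    then show ?case using elim by blast
  qed
qed

text \<open>
  The squared distances to \<open>y\<^sub>j + t (y\<^sub>i - y\<^sub>j)\<close> are affine combinations of those to \<open>y\<^sub>i\<close> and \<open>y\<^sub>j\<close>, so
  that \<open>finite_energy\<close> depends on the affine hull of \<open>y\<close> only.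
\<close>
lemma finite_energy_affine:
  assumes I: "finite I" "i \<in> I" "j \<in> I" "i \<noteq> j" and t: "t \<noteq> 0" and y: "finite_energy I y"
  shows "finite_energy I (y(i := y j + t *\<^sub>R (y i - y j)))"
proof -
  let ?y = "y(i := y j + t *\<^sub>R (y i - y j))"
  let ?D = "\<lambda>y w w'. (dist w y)\<^sup>2 - (dist w' (y :: 'a))\<^sup>2"
  have D: "t * ?D (y i) w w' = ?D (?y i) w w' - (1 - t) * ?D (y j) w w'" for w w'
    unfolding dist_square_diff by (simp add: inner_diff inner_add algebra_simps)
  \<comment> \<open>Solving for the old difference at i multiplies the tolerance by (1 + |1 - t|) /
    |t|. Passing to a scale finer by 2^-k absorbs this, and the normalization then changes by the
    fixed factor 2^(k card I).\<close>
  obtain k where k: "(1 + \<bar>1 - t\<bar>) / \<bar>t\<bar> < 2 ^ k" 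
    using real_arch_pow[of 2 "(1 + \<bar>1 - t\<bar>) / \<bar>t\<bar>"] by auto
  have sub: "pair_energy I (n + k) ?y \<le> pair_energy I n y" for n
    unfolding pair_energy_def
  proof (intro nn_integral_mono)
    fix w w'
    show "(\<Prod>a\<in>I. indicator {..<(1/2)^(n + k)} \<bar>?D (?y a) w w'\<bar>) \<le> (\<Prod>a\<in>I. indicator {..<(1/2)^n} \<bar>?D (y a) w w'\<bar> :: ennreal)"
    proof (cases "\<forall>a\<in>I. \<bar>?D (?y a) w w'\<bar> < (1/2)^(n + k)")
      case True
      let ?e = "(1/2::real)^(n + k)"
      have le: "?e \<le> (1/2)^n" by (intro power_decreasing) auto
      have "\<bar>?D (y a) w w'\<bar> < (1/2)^n" if a: "a \<in> I" for a
      proof (cases "a = i")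
        case False
        then show ?thesis using less_le_trans[OF True[rule_format, OF a] le] by simp
      next
        case ai: True
        have 1: "\<bar>?D (?y i) w w'\<bar> < ?e" using True I(2) by blast
        have 2: "\<bar>?D (y j) w w'\<bar> < ?e" using True[rule_format, OF I(3)] I(4) by simp
        have "\<bar>t\<bar> * \<bar>?D (y i) w w'\<bar> = \<bar>?D (?y i) w w' - (1 - t) * ?D (y j) w w'\<bar>"
          unfolding abs_mult[symmetric] D ..
        also have "\<dots> \<le> \<bar>?D (?y i) w w'\<bar> + \<bar>1 - t\<bar> * \<bar>?D (y j) w w'\<bar>"
          unfolding abs_mult[symmetric] by (rule abs_triangle_ineq4)
        also have "\<dots> \<le> ?e + \<bar>1 - t\<bar> * ?e"
          using 1 2 by (intro add_mono mult_left_mono) auto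
        finally have "\<bar>?D (y i) w w'\<bar> \<le> (1 + \<bar>1 - t\<bar>) / \<bar>t\<bar> * ?e"
          using t by (simp add: field_simps)
        also have "\<dots> < 2 ^ k * ?e" using k by (intro mult_strict_right_mono) auto
        also have "\<dots> = (1/2)^n" by (simp add: power_add power_one_over)
        finally show ?thesis using ai by simp
      qed
      then have "(\<Prod>a\<in>I. indicator {..<(1/2)^n} \<bar>?D (y a) w w'\<bar> :: ennreal) = 1"
        by (intro prod.neutral) auto
      moreover have "(\<Prod>a\<in>I. indicator {..<(1/2)^(n + k)} \<bar>?D (?y a) w w'\<bar> :: ennreal) \<le> 1"
        by (intro prod_le_1) (auto simp: indicator_def)
      ultimately show ?thesis by simp
    next
      case False
      then have "(\<Prod>a\<in>I. indicator {..<(1/2)^(n + k)} \<bar>?D (?y a) w w'\<bar> :: ennreal) = 0"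
        using I(1) by (intro prod_zero) (auto simp: indicator_def)
      from eq_refl[OF this] show ?thesis by (rule order_trans) simp
    qed
  qed
  obtain C :: nat where C: "\<And>m. \<exists>n\<ge>m. 2 ^ (n * card I) * pair_energy I n y \<le> of_nat C"
    using y unfolding finite_energy_def by blast
  have "\<exists>n\<ge>m. 2 ^ (n * card I) * pair_energy I n ?y \<le> of_nat (2 ^ (k * card I) * C)" for m
  proof -
    obtain n where n: "n \<ge> m" "2 ^ (n * card I) * pair_energy I n y \<le> of_nat C" using C by blast
    have "2 ^ ((n + k) * card I) * pair_energy I (n + k) ?y \<le> 2 ^ ((n + k) * card I) * pair_energy I n y"
      by (intro mult_left_mono sub) auto
    also have "\<dots> = 2 ^ (k * card I) * (2 ^ (n * card I) * pair_energy I n y)"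
      by (simp add: add_mult_distrib2 power_add mult_ac)
    also have "\<dots> \<le> 2 ^ (k * card I) * of_nat C" by (intro mult_left_mono n) auto
    finally show ?thesis using n(1) by (intro exI[of _ "n + k"]) auto
  qed
  then show ?thesis unfolding finite_energy_def by blast
qed

end

section \<open>Absolute continuity of squared distance maps of finite energy\<close>

lemma open_product_contains_box:
  fixes U :: "('i \<Rightarrow> real) set"
  assumes "open U" "x \<in> U" "finite I"
  obtains \<delta> where "0 < \<delta>" "\<And>p. (\<forall>a\<in>I. \<bar>x a - p a\<bar> < \<delta>) \<Longrightarrow> (\<forall>a. a \<notin> I \<longrightarrow> p a = x a) \<Longrightarrow> p \<in> U"
proof -
  have "openin (product_topology (\<lambda>i. euclidean) UNIV) U"
    using assms(1) by (simp add: open_fun_def)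
  from product_topology_open_contains_basis[OF this assms(2)]
  obtain X where X: "x \<in> Pi\<^sub>E UNIV X" "\<And>i. openin euclidean (X i)" "Pi\<^sub>E UNIV X \<subseteq> U"
    by auto
  have "\<exists>e>0. ball (x a) e \<subseteq> X a" for a
    using X(1,2) open_contains_ball[of "X a"] by (auto simp: PiE_def Pi_def)
  then obtain e where e: "\<And>a. 0 < e a" "\<And>a. ball (x a) (e a) \<subseteq> X a" by metis
  show ?thesis
  proof
    show "0 < Min (insert 1 (e ` I))" using assms(3) e by auto
    fix p assume p: "\<forall>a\<in>I. \<bar>x a - p a\<bar> < Min (insert 1 (e ` I))" "\<forall>a. a \<notin> I \<longrightarrow> p a = x a"
    have "p a \<in> X a" for a
    proof (cases "a \<in> I")
      case True
      then have "\<bar>x a - p a\<bar> < e a" using p(1) assms(3) by auto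
      then show ?thesis using e(2)[of a] by (auto simp: dist_real_def subset_iff)
    next
      case False
      then show ?thesis using p(2) X(1) by (auto simp: PiE_def Pi_def)
    qed
    then show "p \<in> U" using X(3) by auto
  qed
qed

text \<open>\<open>square_bounded_approx\<close> works with Borel measures on a Polish type. The
  product measure on I is moved to the full function space, which is Polish for a countable index
  type; outside I its points are constantly \<open>undefined\<close>.\<close>

lemma measurable_PiM_borel_id:
  fixes I :: "'i::countable set"
  shows "(\<lambda>p. p) \<in> measurable (Pi\<^sub>M I (\<lambda>_. lborel :: real measure)) borel"
proof (rule measurable_coordinatewise_then_product)
  fix i
  show "(\<lambda>p. p i) \<in> borel_measurable (Pi\<^sub>M I (\<lambda>_. lborel :: real measure))"
  proof (cases "i \<in> I")
    case True
    then show ?thesis using measurable_component_singleton[OF True, of "\<lambda>_. lborel :: real measure"] by simp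
  next
    case False
    then have "p i = undefined" if "p \<in> space (Pi\<^sub>M I (\<lambda>_. lborel :: real measure))" for p
      using that by (auto simp: space_PiM PiE_def extensional_def)
    then show ?thesis by (subst measurable_cong[where g="\<lambda>_. undefined"]) auto
  qed
qed

lemma measurable_borel_restrict:
  "(\<lambda>p. restrict p I) \<in> measurable borel (Pi\<^sub>M I (\<lambda>_. lborel :: real measure))"
  by (rule measurable_restrict) (simp add: measurable_product_coordinates)

lemma two_interval_integral:
  "(\<integral>\<^sup>+p. indicator {..<s/2} \<bar>a - p\<bar> * indicator {..<s/2} \<bar>b - p\<bar> \<partial>lborel)
    \<le> ennreal s * indicator {..<s} \<bar>a - b\<bar>" if "0 < s" for a b s :: real
proof (cases "\<bar>a - b\<bar> < s")
  case True
  have iff0: "\<bar>a - p\<bar> < s / 2 \<longleftrightarrow> a - s / 2 < p \<and> p < a + s / 2" for p by linarith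
  have iff: "\<bar>a - p\<bar> * 2 < s \<longleftrightarrow> a - s / 2 < p \<and> p < a + s / 2" for p
    unfolding iff0[symmetric] by (simp add: less_divide_eq)
  have "(\<integral>\<^sup>+p. indicator {..<s/2} \<bar>a - p\<bar> * indicator {..<s/2} \<bar>b - p\<bar> \<partial>lborel)
     \<le> (\<integral>\<^sup>+p. indicator {a - s/2..a + s/2} p \<partial>lborel)"
    by (intro nn_integral_mono) (simp add: indicator_def iff)
  also have "\<dots> = ennreal s" using that by simp
  finally show ?thesis using True by simp
next
  case False
  then have "\<not> (\<bar>a - p\<bar> < s/2 \<and> \<bar>b - p\<bar> < s/2)" for p by linarith
  then have "indicator {..<s/2} \<bar>a - p\<bar> * indicator {..<s/2} \<bar>b - p\<bar> = (0::ennreal)" for p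
    by (simp add: indicator_def)
  then show ?thesis by (simp only: nn_integral_const) simp
qed

lemma interval_integral:
  "(\<integral>\<^sup>+p. indicator {..<s/2} \<bar>a - p\<bar> \<partial>lborel) = ennreal s" if "0 < s" for a s :: real
proof -
  have iff0: "\<bar>a - p\<bar> < s / 2 \<longleftrightarrow> a - s / 2 < p \<and> p < a + s / 2" for p by linarith
  have iff: "\<bar>a - p\<bar> * 2 < s \<longleftrightarrow> a - s / 2 < p \<and> p < a + s / 2" for p
    unfolding iff0[symmetric] by (simp add: less_divide_eq)
  have "(\<integral>\<^sup>+p. indicator {..<s/2} \<bar>a - p\<bar> \<partial>lborel) = (\<integral>\<^sup>+p. indicator {a - s/2<..<a + s/2} p \<partial>lborel)"
    by (intro nn_integral_cong) (simp add: indicator_def iff)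
  also have "\<dots> = ennreal s" using that by simp
  finally show ?thesis .
qed

context frostman_measure
begin

text \<open>Smoothing the law of the squared distances over cubes gives functions g k whose square
  integral is at most the normalized pair energy, because two cubes of side s meet only if the
  squared distances differ by less than s in each coordinate. Along the scales of
  \<open>finite_energy\<close> this is bounded, so the limit law is absolutely continuous.\<close>

lemma AE_sqdists_notin_null:
  fixes I :: "'i::countable set"
  assumes I: "finite I" and y: "finite_energy I y" and N: "N \<in> null_sets (Pi\<^sub>M I (\<lambda>_. lborel))"
  shows "AE w in \<mu>. (\<lambda>a\<in>I. (dist w (y a))\<^sup>2) \<notin> N"
proof -
  interpret Pi: product_sigma_finite "\<lambda>_::'i. lborel :: real measure" ..
  let ?P = "Pi\<^sub>M I (\<lambda>_. lborel :: real measure)"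
  have sf: "sigma_finite_measure ?P" by (rule Pi.sigma_finite[OF I])
  interpret P: sigma_finite_measure ?P by (rule sf)
  define X where "X = (\<lambda>w. \<lambda>a\<in>I. (dist w (y a))\<^sup>2)"
  have X_I: "X w a = (dist w (y a))\<^sup>2" if "a \<in> I" for w a using that by (simp add: X_def)
  have X_comp [measurable]: "(\<lambda>w. X w a) \<in> borel_measurable borel" for a
    by (cases "a \<in> I") (auto simp: X_def)
  have X_meas [measurable]: "X \<in> borel_measurable borel"
    by (rule measurable_coordinatewise_then_product) (rule X_comp)
  have kern [measurable]: "(\<lambda>w. \<Prod>a\<in>I. indicator {..<s} \<bar>X w a - p a\<bar> :: ennreal) \<in> borel_measurable borel" for p s
    by measurable
  have comp: "(\<lambda>p. p a) \<in> borel_measurable ?P" if "a \<in> I" for a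
    using measurable_component_singleton[OF that, of "\<lambda>_. lborel :: real measure"] by simp
  define D where "D = (\<Sum>a\<in>I. (R0 + norm (y a))\<^sup>2)"
  have X_le: "\<bar>X w a\<bar> \<le> D" if "norm w < R0" "a \<in> I" for w a
  proof -
    have "dist w (y a) \<le> R0 + norm (y a)" using that norm_triangle_ineq4[of w "y a"] by (simp add: dist_norm)
    then have "(dist w (y a))\<^sup>2 \<le> (R0 + norm (y a))\<^sup>2" by (intro power_mono) auto
    also have "\<dots> \<le> D" unfolding D_def using I that(2) by (intro member_le_sum) auto
    finally show ?thesis using that by (simp add: X_I)
  qed
  \<comment> \<open>D bounds the squared distances and cubes have half side at most 1/2, so the
    margin 1 contains all smoothing. Cutting to a box makes L finite.\<close>
  define Box where "Box = {p :: 'i \<Rightarrow> real. \<forall>a\<in>I. \<bar>p a\<bar> \<le> D + 1}"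
  have Box_meas: "{p \<in> space borel. p \<in> Box} \<in> sets borel"
    unfolding Box_def using I by measurable
  then have [measurable]: "Box \<in> sets borel" by simp
  note [measurable] = measurable_PiM_borel_id[of I]
  define L0 where "L0 = density ?P (indicator Box)"
  have [measurable_cong]: "sets L0 = sets ?P" by (simp add: L0_def)
  define L where "L = distr L0 borel (\<lambda>p. p)"
  have nn_L: "(\<integral>\<^sup>+p. h p \<partial>L) = (\<integral>\<^sup>+p. indicator Box p * h p \<partial>?P)" if [measurable]: "h \<in> borel_measurable borel" for h
  proof -
    have [measurable]: "h \<in> borel_measurable ?P"
      using measurable_compose[OF measurable_PiM_borel_id that] .
    have [measurable]: "(indicator Box :: _ \<Rightarrow> ennreal) \<in> borel_measurable ?P"
      using measurable_compose[OF measurable_PiM_borel_id[of I] borel_measurable_indicator[of Box borel]] by simp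
    have "(\<integral>\<^sup>+p. h p \<partial>L) = (\<integral>\<^sup>+p. h p \<partial>L0)"
      unfolding L_def by (subst nn_integral_distr) (auto simp: L0_def measurable_PiM_borel_id)
    also have "\<dots> = (\<integral>\<^sup>+p. indicator Box p * h p \<partial>?P)"
      unfolding L0_def by (subst nn_integral_density) auto
    finally show ?thesis .
  qed
  have finL: "finite_measure L"
  proof (rule finite_measureI)
    have "emeasure L (space L) = (\<integral>\<^sup>+p. 1 \<partial>L)" by simp
    also have "\<dots> = (\<integral>\<^sup>+p. indicator Box p * 1 \<partial>?P)" by (rule nn_L) simp
    also have "\<dots> = (\<integral>\<^sup>+p. (\<Prod>a\<in>I. indicator {-(D+1)..D+1} (p a)) \<partial>?P)"
    proof (intro nn_integral_cong)
      fix p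
      show "indicator Box p * 1 = (\<Prod>a\<in>I. indicator {-(D+1)..D+1} (p a) :: ennreal)"
      proof (cases "p \<in> Box")
        case True
        then have "(\<Prod>a\<in>I. indicator {-(D+1)..D+1} (p a) :: ennreal) = 1"
          by (intro prod.neutral) (force simp: Box_def abs_le_iff)
        then show ?thesis using True by simp
      next
        case False
        then have "(\<Prod>a\<in>I. indicator {-(D+1)..D+1} (p a) :: ennreal) = 0"
          using I by (intro prod_zero) (force simp: Box_def abs_le_iff indicator_def)+
        then show ?thesis using False by simp
      qed
    qed
    also have "\<dots> = (\<Prod>a\<in>I. \<integral>\<^sup>+t. indicator {-(D+1)..D+1} t \<partial>lborel)"
      using I by (intro Pi.product_nn_integral_prod) auto
    also have "\<dots> < \<infinity>"
    proof -
      have "0 \<le> D" unfolding D_def by (intro sum_nonneg) auto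
      then have "(\<Prod>a\<in>I. \<integral>\<^sup>+t. indicator {-(D+1)..D+1} t \<partial>lborel) = ennreal (2 * (D + 1)) ^ card I"
        by simp
      then show ?thesis by (simp add: power_less_top_ennreal)
    qed
    finally show "emeasure L (space L) \<noteq> \<infinity>" by simp
  qed
  define \<rho> where "\<rho> = distr \<mu> borel X"
  have finrho: "finite_measure \<rho>" unfolding \<rho>_def by (rule finite_measure_distr) measurable
  obtain C :: nat where C: "\<And>m. \<exists>n\<ge>m. 2 ^ (n * card I) * pair_energy I n y \<le> of_nat C"
    using y unfolding finite_energy_def by blast
  then obtain r where r: "\<And>k. k \<le> r k" "\<And>k. 2 ^ (r k * card I) * pair_energy I (r k) y \<le> of_nat C" by metis
  define s where "s = (\<lambda>k. (1/2::real) ^ r k)"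
  have s: "0 < s k" "s k \<le> 1" for k by (auto simp: s_def power_le_one)
  have s_lim: "s \<longlonglongrightarrow> 0"
  proof (rule tendsto_sandwich[of "\<lambda>_. 0"])
    show "\<forall>\<^sub>F k in sequentially. s k \<le> (1/2) ^ k"
      unfolding s_def using r(1) by (intro always_eventually allI power_decreasing) auto
    show "(\<lambda>k. (1/2::real) ^ k) \<longlonglongrightarrow> 0" by (rule LIMSEQ_power_zero) simp
    show "\<forall>\<^sub>F k in sequentially. 0 \<le> s k"
      using s(1) by (intro always_eventually allI less_imp_le)
  qed simp
  \<comment> \<open>The inverse volume of a cube of side s k in card I coordinates.\<close>
  define K where "K = (\<lambda>k. 2 ^ (r k * card I) :: ennreal)"
  have K: "K k * ennreal (s k) ^ card I = 1" for k
  proof -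
    have "K k * ennreal (s k) ^ card I = ennreal (2 ^ (r k * card I) * ((1/2) ^ r k) ^ card I)"
      by (simp add: K_def s_def ennreal_mult ennreal_power ennreal_power[symmetric, of 2])
    also have "(2::real) ^ (r k * card I) * ((1/2) ^ r k) ^ card I = 1"
      unfolding power_mult power_mult_distrib[symmetric] by (simp add: power_one_over)
    finally show ?thesis by simp
  qed
  define q where "q = (\<lambda>k w p. \<Prod>a\<in>I. indicator {..<s k / 2} \<bar>X w a - p a\<bar> :: ennreal)"
  have q_meas1 [measurable]: "q k w \<in> borel_measurable borel" for k w unfolding q_def by measurable
  have coord [measurable]: "(\<lambda>z. (snd z) a) \<in> borel_measurable (\<mu> \<Otimes>\<^sub>M (borel :: ('i \<Rightarrow> real) measure))" for a
    using measurable_compose[OF measurable_snd measurable_product_coordinates] .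
  have q_meas2: "(\<lambda>z. q k (fst z) (snd z)) \<in> borel_measurable (\<mu> \<Otimes>\<^sub>M borel)" for k unfolding q_def by measurable
  have q_meas3: "(\<lambda>z. q k (fst z) (snd z)) \<in> borel_measurable (\<mu> \<Otimes>\<^sub>M ?P)" for k
    using measurable_compose[OF measurable_Pair[OF measurable_fst measurable_compose[OF measurable_snd measurable_PiM_borel_id]] q_meas2]
    by simp
  have q_meas4: "(\<lambda>w. q k w p) \<in> borel_measurable \<mu>" for k p 
    using measurable_compose[OF measurable_Pair2'[of p borel \<mu>] q_meas2[of k]] by simp
  define g where "g = (\<lambda>k p. K k * (\<integral>\<^sup>+w. q k w p \<partial>\<mu>))"
  have g_meas [measurable]: "g k \<in> borel_measurable borel" for k
  proof -
    have "(\<lambda>p. \<integral>\<^sup>+w. q k w p \<partial>\<mu>) \<in> borel_measurable borel"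
      using measurable_compose[OF measurable_Pair[OF measurable_snd measurable_fst] q_meas2[of k]]
      by (intro borel_measurable_nn_integral) (simp add: split_beta')
    then show ?thesis unfolding g_def by measurable
  qed
  have g_sq: "(\<integral>\<^sup>+p. (g k p)\<^sup>2 \<partial>L) \<le> of_nat C" for k
  proof -
    note comp [measurable]
    have "(\<integral>\<^sup>+p. (g k p)\<^sup>2 \<partial>L) = (\<integral>\<^sup>+p. indicator Box p * (g k p)\<^sup>2 \<partial>?P)" by (rule nn_L) measurable
    also have "\<dots> \<le> (\<integral>\<^sup>+p. (K k)\<^sup>2 * (\<integral>\<^sup>+w. \<integral>\<^sup>+w'. q k w p * q k w' p \<partial>\<mu> \<partial>\<mu>) \<partial>?P)"
    proof (intro nn_integral_mono)
      fix p
      have "(\<integral>\<^sup>+w. q k w p \<partial>\<mu>)\<^sup>2 = (\<integral>\<^sup>+w. \<integral>\<^sup>+w'. q k w p * q k w' p \<partial>\<mu> \<partial>\<mu>)"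
        using q_meas4 by (simp add: power2_eq_square nn_integral_cmult nn_integral_multc)
      then show "indicator Box p * (g k p)\<^sup>2 \<le> (K k)\<^sup>2 * (\<integral>\<^sup>+w. \<integral>\<^sup>+w'. q k w p * q k w' p \<partial>\<mu> \<partial>\<mu>)"
        by (simp add: g_def power_mult_distrib indicator_def)
    qed
    also have "\<dots> = (K k)\<^sup>2 * (\<integral>\<^sup>+p. \<integral>\<^sup>+w. \<integral>\<^sup>+w'. q k w p * q k w' p \<partial>\<mu> \<partial>\<mu> \<partial>?P)"
      unfolding q_def by (rule nn_integral_cmult) measurable
    also have "(\<integral>\<^sup>+p. \<integral>\<^sup>+w. \<integral>\<^sup>+w'. q k w p * q k w' p \<partial>\<mu> \<partial>\<mu> \<partial>?P) = (\<integral>\<^sup>+w. \<integral>\<^sup>+p. \<integral>\<^sup>+w'. q k w p * q k w' p \<partial>\<mu> \<partial>?P \<partial>\<mu>)"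
      unfolding q_def by (intro nn_integral_swap sf sigma_finite_mu) measurable
    also have "\<dots> = (\<integral>\<^sup>+w. \<integral>\<^sup>+w'. \<integral>\<^sup>+p. q k w p * q k w' p \<partial>?P \<partial>\<mu> \<partial>\<mu>)"
      unfolding q_def by (intro nn_integral_cong nn_integral_swap sf sigma_finite_mu) measurable
    also have "\<dots> \<le> (\<integral>\<^sup>+w. \<integral>\<^sup>+w'. ennreal (s k) ^ card I * (\<Prod>a\<in>I. indicator {..<(1/2) ^ r k} \<bar>(dist w (y a))\<^sup>2 - (dist w' (y a))\<^sup>2\<bar>) \<partial>\<mu> \<partial>\<mu>)"
    proof (intro nn_integral_mono)
      fix w w'
      have "(\<integral>\<^sup>+p. q k w p * q k w' p \<partial>?P) = (\<integral>\<^sup>+p. (\<Prod>a\<in>I. indicator {..<s k / 2} \<bar>X w a - p a\<bar> * indicator {..<s k / 2} \<bar>X w' a - p a\<bar>) \<partial>?P)"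
        by (simp add: q_def prod.distrib)
      also have "\<dots> = (\<Prod>a\<in>I. \<integral>\<^sup>+t. indicator {..<s k / 2} \<bar>X w a - t\<bar> * indicator {..<s k / 2} \<bar>X w' a - t\<bar> \<partial>lborel)"
        using I by (intro Pi.product_nn_integral_prod) auto
      also have "\<dots> \<le> (\<Prod>a\<in>I. ennreal (s k) * indicator {..<(1/2) ^ r k} \<bar>(dist w (y a))\<^sup>2 - (dist w' (y a))\<^sup>2\<bar>)"
      proof (rule prod_mono_ennreal)
        fix a assume "a \<in> I"
        then show "(\<integral>\<^sup>+t. indicator {..<s k / 2} \<bar>X w a - t\<bar> * indicator {..<s k / 2} \<bar>X w' a - t\<bar> \<partial>lborel)
          \<le> ennreal (s k) * indicator {..<(1/2) ^ r k} \<bar>(dist w (y a))\<^sup>2 - (dist w' (y a))\<^sup>2\<bar>"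
          using two_interval_integral[OF s(1)[of k], of "X w a" "X w' a"] by (simp add: X_I s_def)
      qed
      also have "\<dots> = ennreal (s k) ^ card I * (\<Prod>a\<in>I. indicator {..<(1/2) ^ r k} \<bar>(dist w (y a))\<^sup>2 - (dist w' (y a))\<^sup>2\<bar>)"
        by (simp add: prod.distrib)
      finally show "(\<integral>\<^sup>+p. q k w p * q k w' p \<partial>?P) \<le> ennreal (s k) ^ card I * (\<Prod>a\<in>I. indicator {..<(1/2) ^ r k} \<bar>(dist w (y a))\<^sup>2 - (dist w' (y a))\<^sup>2\<bar>)" .
    qed
    also have "\<dots> = pair_energy I (r k) y * (\<Prod>a\<in>I. ennreal (s k))"
      unfolding pair_energy_mult by (simp add: prod.distrib)
    finally have "(\<integral>\<^sup>+p. (g k p)\<^sup>2 \<partial>L) \<le> (K k)\<^sup>2 * (pair_energy I (r k) y * ennreal (s k) ^ card I)"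
      by (simp add: mult_left_mono)
    also have "\<dots> = (K k * ennreal (s k) ^ card I) * (K k * pair_energy I (r k) y)"
      by (simp add: power2_eq_square mult_ac)
    also have "\<dots> \<le> of_nat C" using r(2)[of k] by (simp add: K) (simp add: K_def)
    finally show ?thesis .
  qed
  have lim: "emeasure \<rho> U \<le> liminf (\<lambda>k. \<integral>\<^sup>+p. g k p * indicator U p \<partial>L)" if U: "open U" for U
  proof -
    have U_meas [measurable]: "U \<in> sets borel" using U by simp
    have BU: "(\<lambda>p. indicator (Box \<inter> U) p :: ennreal) \<in> borel_measurable ?P"
      using measurable_compose[OF measurable_PiM_borel_id[of I] borel_measurable_indicator[of "Box \<inter> U" borel]] by simp
    define \<phi> where "\<phi> = (\<lambda>k w. \<integral>\<^sup>+p. K k * (indicator (Box \<inter> U) p * q k w p) \<partial>?P)"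
    have integrand: "(\<lambda>z. K k * (indicator (Box \<inter> U) (snd z) * q k (fst z) (snd z))) \<in> borel_measurable (\<mu> \<Otimes>\<^sub>M ?P)" for k
      using q_meas3[of k] measurable_compose[OF measurable_snd BU, of \<mu>] by measurable
    have phi_meas: "\<phi> k \<in> borel_measurable \<mu>" for k
      unfolding \<phi>_def using integrand[of k] by (intro P.borel_measurable_nn_integral) (simp add: split_beta')
    have key: "indicator U (X w) \<le> liminf (\<lambda>k. \<phi> k w)" if w: "norm w < R0" for w
    proof (cases "X w \<in> U")
      case True
      obtain \<delta> where \<delta>: "0 < \<delta>" "\<And>p. (\<forall>a\<in>I. \<bar>X w a - p a\<bar> < \<delta>) \<Longrightarrow> (\<forall>a. a \<notin> I \<longrightarrow> p a = X w a) \<Longrightarrow> p \<in> U"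
        by (rule open_product_contains_box[OF U True I]) (rule that)
      have "\<forall>\<^sub>F k in sequentially. s k < \<delta>" using order_tendstoD(2)[OF s_lim \<delta>(1)] .
      then have "\<forall>\<^sub>F k in sequentially. 1 \<le> \<phi> k w"
      proof eventually_elim
        case (elim k)
        have "\<phi> k w = (\<integral>\<^sup>+p. K k * q k w p \<partial>?P)"
          unfolding \<phi>_def
        proof (intro nn_integral_cong)
          fix p assume p: "p \<in> space ?P"
          show "K k * (indicator (Box \<inter> U) p * q k w p) = K k * q k w p"
          proof (cases "\<forall>a\<in>I. \<bar>X w a - p a\<bar> < s k / 2")
            case True
            have "p \<in> U"
            proof (rule \<delta>(2))
              have "s k / 2 < \<delta>" using elim s[of k] by simp
              then show "\<forall>a\<in>I. \<bar>X w a - p a\<bar> < \<delta>" using True by force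
              show "\<forall>a. a \<notin> I \<longrightarrow> p a = X w a"
                using p by (auto simp: X_def space_PiM PiE_def extensional_def)
            qed
            moreover have "p \<in> Box"
              unfolding Box_def
            proof (intro CollectI ballI)
              fix a assume a: "a \<in> I"
              then have "\<bar>X w a - p a\<bar> < s k / 2" using True by blast
              then show "\<bar>p a\<bar> \<le> D + 1" using X_le[OF w a] s(2)[of k] by linarith
            qed
            ultimately show ?thesis by simp
          next
            case False
            then have "q k w p = 0" unfolding q_def using I by (intro prod_zero) (auto simp: indicator_def)
            then show ?thesis by simp
          qed
        qed
        also have "\<dots> = K k * (\<integral>\<^sup>+p. q k w p \<partial>?P)"
          by (rule nn_integral_cmult) (use measurable_compose[OF measurable_PiM_borel_id[of I] q_meas1] in simp)
        also have "(\<integral>\<^sup>+p. q k w p \<partial>?P) = (\<Prod>a\<in>I. \<integral>\<^sup>+t. indicator {..<s k / 2} \<bar>X w a - t\<bar> \<partial>lborel)"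
          unfolding q_def using I by (intro Pi.product_nn_integral_prod) auto
        also have "\<dots> = ennreal (s k) ^ card I" using interval_integral[OF s(1)[of k]] by simp
        finally show ?case by (simp add: K)
      qed
      then have "1 \<le> liminf (\<lambda>k. \<phi> k w)" by (rule Liminf_bounded)
      then show ?thesis using True by simp
    qed simp
    have "emeasure \<rho> U = (\<integral>\<^sup>+w. indicator U (X w) \<partial>\<mu>)"
    proof -
      have "emeasure \<rho> U = (\<integral>\<^sup>+p. indicator U p \<partial>\<rho>)" by (simp add: \<rho>_def)
      also have "\<dots> = (\<integral>\<^sup>+w. indicator U (X w) \<partial>\<mu>)"
        unfolding \<rho>_def by (rule nn_integral_distr) auto
      finally show ?thesis .
    qed
    also have "\<dots> \<le> (\<integral>\<^sup>+w. liminf (\<lambda>k. \<phi> k w) \<partial>\<mu>)"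
      by (rule nn_integral_mono_AE, rule eventually_mono[OF mu_supp]) (rule key)
    also have "\<dots> \<le> liminf (\<lambda>k. \<integral>\<^sup>+w. \<phi> k w \<partial>\<mu>)"
      by (rule nn_integral_liminf) (rule phi_meas)
    also have "(\<lambda>k. \<integral>\<^sup>+w. \<phi> k w \<partial>\<mu>) = (\<lambda>k. \<integral>\<^sup>+p. g k p * indicator U p \<partial>L)"
    proof
      fix k
      have "(\<integral>\<^sup>+w. \<phi> k w \<partial>\<mu>) = (\<integral>\<^sup>+p. \<integral>\<^sup>+w. K k * (indicator (Box \<inter> U) p * q k w p) \<partial>\<mu> \<partial>?P)"
        unfolding \<phi>_def by (intro nn_integral_swap sf sigma_finite_mu integrand)
      also have "\<dots> = (\<integral>\<^sup>+p. indicator Box p * (g k p * indicator U p) \<partial>?P)"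
      proof (intro nn_integral_cong)
        fix p
        have "(\<integral>\<^sup>+w. K k * (indicator (Box \<inter> U) p * q k w p) \<partial>\<mu>) = K k * (indicator (Box \<inter> U) p * (\<integral>\<^sup>+w. q k w p \<partial>\<mu>))"
          using q_meas4 by (simp add: nn_integral_cmult)
        then show "(\<integral>\<^sup>+w. K k * (indicator (Box \<inter> U) p * q k w p) \<partial>\<mu>) = indicator Box p * (g k p * indicator U p)"
          by (simp add: g_def indicator_inter_arith mult_ac)
      qed
      also have "\<dots> = (\<integral>\<^sup>+p. g k p * indicator U p \<partial>L)"
        by (rule nn_L[symmetric]) measurable
      finally show "(\<integral>\<^sup>+w. \<phi> k w \<partial>\<mu>) = (\<integral>\<^sup>+p. g k p * indicator U p \<partial>L)" .
    qed
    finally show ?thesis .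
  qed
  interpret square_bounded_approx \<rho> L g "of_nat C"
  proof (rule square_bounded_approx.intro)
    show "finite_measure \<rho>" "finite_measure L" by fact+
    show "sets \<rho> = sets borel" "sets L = sets borel" by (simp_all add: \<rho>_def L_def)
    show "g n \<in> borel_measurable borel" for n by (rule g_meas)
    show "(\<integral>\<^sup>+p. (g n p)\<^sup>2 \<partial>L) \<le> of_nat C" for n by (rule g_sq)
    show "(of_nat C :: ennreal) < \<top>" by (simp add: of_nat_less_top)
    show "emeasure \<rho> U \<le> liminf (\<lambda>n. \<integral>\<^sup>+p. g n p * indicator U p \<partial>L)" if "open U" for U
      using that by (rule lim)
  qed
  \<comment> \<open>The null set is pulled back to the full function space; on extensional functions
    restriction is the identity, so L and \<rho> see the same set.\<close>
  define N' where "N' = (\<lambda>p. restrict p I) -` N"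
  have N'_meas [measurable]: "N' \<in> sets borel"
    using measurable_sets[OF measurable_borel_restrict[of I], of N] N by (simp add: N'_def null_sets_def)
  have "emeasure L N' = (\<integral>\<^sup>+p. indicator N' p \<partial>L)" using N'_meas by (simp add: L_def)
  also have "\<dots> = (\<integral>\<^sup>+p. indicator Box p * indicator N' p \<partial>?P)" by (rule nn_L) measurable
  also have "\<dots> = 0"
  proof -
    have "AE p in ?P. indicator Box p * indicator N' p = (0::ennreal)"
      using AE_not_in[OF N] AE_space
    proof eventually_elim
      case (elim p)
      then have "restrict p I = p" by (auto simp: space_PiM PiE_restrict)
      then show ?case using elim by (simp add: N'_def)
    qed
    then have "(\<integral>\<^sup>+p. indicator Box p * indicator N' p \<partial>?P) = (\<integral>\<^sup>+p. 0 \<partial>?P)"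
      by (intro nn_integral_cong_AE) simp
    then show ?thesis by simp
  qed
  finally have "N' \<in> null_sets L" by (auto intro!: null_setsI simp: L_def)
  then have "N' \<in> null_sets \<rho>" using absolutely_continuous_limit by (auto simp: absolutely_continuous_def)
  then have "AE p in \<rho>. p \<notin> N'" by (rule AE_not_in)
  then have "AE w in \<mu>. X w \<notin> N'" unfolding \<rho>_def by (subst (asm) AE_distr_iff) auto
  then show ?thesis by eventually_elim (simp add: N'_def X_def)
qed

end

section \<open>Transfer from Lebesgue measure to the Frostman measure\<close>

text \<open>Isolates the two coordinates involved in one transfer step: p is the base point, q
  supplies the direction, and x collects the spectators.\<close>

definition insert_pair :: "'i set \<Rightarrow> 'i \<Rightarrow> 'i \<Rightarrow> ('i \<Rightarrow> 'b) \<Rightarrow> 'b \<Rightarrow> 'b \<Rightarrow> 'i \<Rightarrow> 'b" where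
  "insert_pair J p q x a b = merge J {p, q} (x, \<lambda>k\<in>{p, q}. if k = p then a else b)"

lemma insert_pair_simps:
  assumes "p \<notin> J" "q \<notin> J" "p \<noteq> q"
  shows "insert_pair J p q x a b p = a" "insert_pair J p q x a b q = b"
    "(insert_pair J p q x a b)(p := c) = insert_pair J p q x c b"
    "(insert_pair J p q x a b)(q := c) = insert_pair J p q x a c"
  using assms by (auto simp: insert_pair_def merge_def fun_eq_iff)

lemma (in product_sigma_finite) AE_PiM_pair:
  assumes pq: "p \<noteq> q" and P: "Measurable.pred (Pi\<^sub>M {p, q} M) P"
  shows "(AE y in Pi\<^sub>M {p, q} M. P y) \<longleftrightarrow> (AE a in M p. AE b in M q. P (\<lambda>k\<in>{p, q}. if k = p then a else b))"
proof -
  interpret pq: pair_sigma_finite "M p" "M q" ..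
  define mk where "mk = (\<lambda>(a::'a) (b::'a). \<lambda>k\<in>{p, q}. if k = p then a else b)"
  have mk: "(\<lambda>z. mk (fst z) (snd z)) \<in> measurable (M p \<Otimes>\<^sub>M M q) (Pi\<^sub>M {p, q} M)"
    using pq unfolding mk_def by (intro measurable_restrict) auto
  have P': "Measurable.pred (M p \<Otimes>\<^sub>M M q) (\<lambda>z. P (mk (fst z) (snd z)))"
    by (rule measurable_compose[OF mk P])
  define f where "f = (\<lambda>a b. indicator {z. \<not> P (mk (fst z) (snd z))} (a, b) :: ennreal)"
  have [measurable]: "(\<lambda>z. indicator {z. \<not> P (mk (fst z) (snd z))} z :: ennreal) \<in> borel_measurable (M p \<Otimes>\<^sub>M M q)"
    using P' by (intro borel_measurable_indicator') simp
  have f_meas: "case_prod f \<in> borel_measurable (M p \<Otimes>\<^sub>M M q)"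
    by (simp add: f_def split_beta')
  have eq: "mk (\<sigma> p) (\<sigma> q) = \<sigma>" if "\<sigma> \<in> space (Pi\<^sub>M {p, q} M)" for \<sigma>
    using that pq by (auto simp: mk_def space_PiM PiE_def extensional_def fun_eq_iff)
  have [measurable]: "(\<lambda>\<sigma>. f (\<sigma> p) (\<sigma> q)) \<in> borel_measurable (Pi\<^sub>M {p, q} M)"
  proof -
    have "(\<lambda>\<sigma>. (\<sigma> p, \<sigma> q)) \<in> measurable (Pi\<^sub>M {p, q} M) (M p \<Otimes>\<^sub>M M q)" by measurable
    from measurable_compose[OF this f_meas] show ?thesis by simp
  qed
  have "(AE y in Pi\<^sub>M {p, q} M. P y) \<longleftrightarrow> (AE \<sigma> in Pi\<^sub>M {p, q} M. f (\<sigma> p) (\<sigma> q) = 0)"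
  proof (rule AE_cong)
    fix \<sigma> assume "\<sigma> \<in> space (Pi\<^sub>M {p, q} M)"
    from eq[OF this] show "P \<sigma> \<longleftrightarrow> f (\<sigma> p) (\<sigma> q) = 0" by (simp add: f_def indicator_def)
  qed
  also have "\<dots> \<longleftrightarrow> (\<integral>\<^sup>+\<sigma>. f (\<sigma> p) (\<sigma> q) \<partial>Pi\<^sub>M {p, q} M) = 0"
    by (subst nn_integral_0_iff_AE) auto
  also have "(\<integral>\<^sup>+\<sigma>. f (\<sigma> p) (\<sigma> q) \<partial>Pi\<^sub>M {p, q} M) = (\<integral>\<^sup>+z. f (fst z) (snd z) \<partial>(M p \<Otimes>\<^sub>M M q))"
    by (rule product_nn_integral_pair[OF f_meas pq])
  also have "\<dots> = 0 \<longleftrightarrow> (AE z in M p \<Otimes>\<^sub>M M q. P (mk (fst z) (snd z)))"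
  proof -
    have "(\<lambda>z. f (fst z) (snd z)) \<in> borel_measurable (M p \<Otimes>\<^sub>M M q)"
      using f_meas by (simp add: split_beta')
    then show ?thesis
      by (subst nn_integral_0_iff_AE) (simp_all add: f_def indicator_def)
  qed
  also have "\<dots> \<longleftrightarrow> (AE a in M p. AE b in M q. P (mk a b))"
    using P' by (subst pq.AE_pair_iff[where P="\<lambda>a b. P (mk a b)"]) (auto simp: pred_def)
  finally show ?thesis by (simp only: mk_def)
qed

lemma measurable_insert_pair:
  assumes x: "x \<in> space (Pi\<^sub>M J (\<lambda>_. borel :: 'b::topological_space measure))"
  shows "(\<lambda>z. insert_pair J p q x (fst z) (snd z)) \<in> measurable (borel \<Otimes>\<^sub>M borel) (Pi\<^sub>M (J \<union> {p, q}) (\<lambda>_. borel))"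
proof -
  have mk: "(\<lambda>z :: 'b \<times> 'b. \<lambda>k\<in>{p, q}. if k = p then fst z else snd z) \<in> measurable (borel \<Otimes>\<^sub>M borel) (Pi\<^sub>M {p, q} (\<lambda>_. borel))"
    by (intro measurable_restrict) auto
  show ?thesis
    unfolding insert_pair_def
    by (rule measurable_compose[OF measurable_Pair[OF measurable_const[OF x] mk] measurable_merge])
qed

lemma AE_PiM_insert_pair:
  fixes M :: "'i \<Rightarrow> 'b::topological_space measure"
  assumes "\<And>i. sigma_finite_measure (M i)" "\<And>i. sets (M i) = sets borel"
    and J: "finite J" "p \<notin> J" "q \<notin> J" "p \<noteq> q"
    and D: "Measurable.pred (Pi\<^sub>M (J \<union> {p, q}) (\<lambda>_. borel)) D"
  shows "(AE y in Pi\<^sub>M (J \<union> {p, q}) M. D y) \<longleftrightarrow>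
    (AE x in Pi\<^sub>M J M. AE a in M p. AE b in M q. D (insert_pair J p q x a b))"
proof -
  interpret product_sigma_finite M using assms(1) by (simp add: product_sigma_finite_def)
  have setsM: "sets (Pi\<^sub>M I M) = sets (Pi\<^sub>M I (\<lambda>_. borel))" for I
    using assms(2) by (intro sets_PiM_cong) auto
  have D': "Measurable.pred (Pi\<^sub>M (J \<union> {p, q}) M) D"
    by (subst measurable_cong_sets[OF setsM refl]) (rule D)
  show ?thesis
  proof (subst AE_PiM_Un[OF _ _ _ D'])
    show "J \<inter> {p, q} = {}" "finite J" "finite {p, q}" using J by auto
    show "(AE x in Pi\<^sub>M J M. AE y in Pi\<^sub>M {p, q} M. D (merge J {p, q} (x, y))) \<longleftrightarrow>
      (AE x in Pi\<^sub>M J M. AE a in M p. AE b in M q. D (insert_pair J p q x a b))"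
    proof (rule AE_cong)
      fix x assume x: "x \<in> space (Pi\<^sub>M J M)"
      have "Measurable.pred (Pi\<^sub>M {p, q} M) (\<lambda>y. D (merge J {p, q} (x, y)))"
        by (rule measurable_compose[OF measurable_compose[OF measurable_Pair1'[OF x] measurable_merge] D'])
      from AE_PiM_pair[OF J(4) this]
      show "(AE y in Pi\<^sub>M {p, q} M. D (merge J {p, q} (x, y))) \<longleftrightarrow> (AE a in M p. AE b in M q. D (insert_pair J p q x a b))"
        by (simp add: insert_pair_def)
    qed
  qed
qed

lemma AE_lborel_translate:
  fixes a :: "'b::euclidean_space"
  assumes "Measurable.pred borel P"
  shows "(AE v in lborel. P (a + v)) \<longleftrightarrow> (AE b in lborel. P b)"
proof -
  have "(AE b in lborel. P b) \<longleftrightarrow> (AE b in distr lborel borel ((+) a). P b)"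
    by (simp only: lborel_distr_plus)
  also have "\<dots> \<longleftrightarrow> (AE v in lborel. P (a + v))"
    using assms by (intro AE_distr_iff) (auto simp: pred_def)
  finally show ?thesis by simp
qed

context frostman_measure
begin

text \<open>Coordinates are exchanged one at a time by freezing the others. Coordinate 0 comes
  first, moving along the line towards coordinate 1, which is still Lebesgue-random. Every later
  coordinate moves along the ray from coordinate 0, which is \<mu>-random by then, as radial
  projections require.\<close>

lemma tuple_transfer:
  fixes D :: "(nat \<Rightarrow> 'a) \<Rightarrow> bool"
  assumes m: "1 \<le> m" and D: "Measurable.pred (Pi\<^sub>M {..m} (\<lambda>_. borel)) D"
    and AE: "AE y in Pi\<^sub>M {..m} (\<lambda>_. lborel). D y"
    and inv: "\<And>y i j t. i \<le> m \<Longrightarrow> j \<le> m \<Longrightarrow> i \<noteq> j \<Longrightarrow> t \<noteq> 0 \<Longrightarrow> D y \<Longrightarrow> D (y(i := y j + t *\<^sub>R (y i - y j)))"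
  shows "AE y in Pi\<^sub>M {..m} (\<lambda>_. \<mu>). D y"
proof -
  \<comment> \<open>The hybrid measure after i exchanges: the coordinates below i are \<mu>-random,
    the others Lebesgue-random.\<close>
  define M where "M = (\<lambda>(i::nat) (a::nat). if a < i then \<mu> else (lborel :: 'a measure))"
  have M: "sigma_finite_measure (M i a)" "sets (M i a) = sets borel" for i a
    by (auto simp: M_def sigma_finite_mu sigma_finite_lborel sets_mu)
  have spaceJ: "space (Pi\<^sub>M J (M i)) = space (Pi\<^sub>M J (\<lambda>_. borel))" for J i
    using M by (intro sets_eq_imp_space_eq sets_PiM_cong) auto
  have step: "AE y in Pi\<^sub>M {..m} (M (Suc i)). D y" if i: "i \<le> m" and H: "AE y in Pi\<^sub>M {..m} (M i). D y" for i
  proof -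
    define p where "p = (0::nat)"
    \<comment> \<open>Step i exchanges coordinate i. For i = 0 this is p itself and 1 merely
      supplies the direction; otherwise it is q.\<close>
    define q where "q = (if i = 0 then 1 else i)"
    define J where "J = {..m} - {p, q}"
    have q: "q \<le> m" "p \<noteq> q" using m i by (auto simp: p_def q_def)
    have Jm: "J \<union> {p, q} = {..m}" using q by (auto simp: J_def p_def)
    have J: "finite J" "p \<notin> J" "q \<notin> J" by (auto simp: J_def)
    note Y = insert_pair_simps[OF J(2,3) q(2)]
    have D': "Measurable.pred (Pi\<^sub>M (J \<union> {p, q}) (\<lambda>_. borel)) D" using D by (simp only: Jm)
    have PiJ: "Pi\<^sub>M J (M (Suc i)) = Pi\<^sub>M J (M i)"
      by (intro PiM_cong) (auto simp: J_def M_def p_def q_def split: if_splits)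
    have "AE x in Pi\<^sub>M J (M i). AE a in M i p. AE b in M i q. D (insert_pair J p q x a b)"
      using H AE_PiM_insert_pair[OF M(1)[of i] M(2)[of i] J q(2) D'] by (simp only: Jm)
    then have "AE x in Pi\<^sub>M J (M i). AE a in M (Suc i) p. AE b in M (Suc i) q. D (insert_pair J p q x a b)"
      using AE_space
    proof eventually_elim
      case (elim x)
      have x: "x \<in> space (Pi\<^sub>M J (\<lambda>_. borel :: 'a measure))" using elim(2) by (simp only: spaceJ)
      let ?P = "\<lambda>a v. D (insert_pair J p q x a (a + v))"
      have Dx: "Measurable.pred (borel \<Otimes>\<^sub>M borel) (\<lambda>z. D (insert_pair J p q x (fst z) (snd z)))"
        by (rule measurable_compose[OF measurable_insert_pair[OF x] D'])
      have "(\<lambda>z::'a \<times> 'a. (fst z, fst z + snd z)) \<in> measurable (borel \<Otimes>\<^sub>M borel) (borel \<Otimes>\<^sub>M borel)"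
        by measurable
      from measurable_compose[OF this Dx] have P: "Measurable.pred (borel \<Otimes>\<^sub>M borel) (\<lambda>z. ?P (fst z) (snd z))"
        by simp
      have slice: "Measurable.pred borel (\<lambda>b. D (insert_pair J p q x a b))" for a
        using measurable_compose[OF measurable_Pair1'[of a borel borel] Dx] by simp
      have inv_q: "D (insert_pair J p q x a (a + t *\<^sub>R v))" if "t \<noteq> 0" "?P a v" for a v t
        using inv[OF q(1) _ q(2)[symmetric] that, unfolded Y] by (simp add: p_def)
      have inv_p: "D (insert_pair J p q x (a + v + t *\<^sub>R (- v)) (a + v))" if "t \<noteq> 0" "?P a v" for a v t
        using inv[OF _ q(1) q(2) that, unfolded Y] by (simp add: p_def)
      show ?case
      proof (cases "i = 0")
        case True
        have p0: "M i p = lborel" "M i q = lborel" "M (Suc i) p = \<mu>" "M (Suc i) q = lborel"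
          using True by (auto simp: M_def p_def q_def)
        have "AE a in lborel. AE b in lborel. D (insert_pair J p q x a b)" using elim(1) by (simp only: p0)
        then have "AE a in lborel. AE v in lborel. ?P a v"
          using AE_lborel_translate[OF slice] by simp
        \<comment> \<open>Translating both points by t v is composed of two admissible moves: p
          slides towards q by the ratio 1 - t, then q slides away from the new p by the ratio 1 / (1
          - t).\<close>
        moreover have half: "?P (a + t *\<^sub>R v) v" if t: "t \<noteq> 1" and P: "?P a v" for a v t
        proof -
          have eq: "a + v + (1 - t) *\<^sub>R (- v) = a + t *\<^sub>R v" by (simp add: algebra_simps)
          have "D (insert_pair J p q x (a + t *\<^sub>R v) (a + v))"
            using inv_p[of "1 - t" a v] t P unfolding eq by simp
          also have "a + v = (a + t *\<^sub>R v) + (1 - t) *\<^sub>R v" by (simp add: algebra_simps)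
          finally have "D (insert_pair J p q x (a + t *\<^sub>R v) ((a + t *\<^sub>R v) + (1 / (1 - t)) *\<^sub>R (1 - t) *\<^sub>R v))"
            by (rule inv_q[rotated]) (use t in auto)
          then show ?thesis using t by simp
        qed
        have "?P (a + t *\<^sub>R v) v" if P: "?P a v" for a v t
        proof (cases "t = 1")
          \<comment> \<open>For t = 1 the first move would put p onto q and lose the direction, so
            two half translations are used.\<close>
          case True
          have "?P (a + (1/2) *\<^sub>R v + (1/2) *\<^sub>R v) v" by (intro half P) auto
          moreover have "a + (1/2) *\<^sub>R v + (1/2) *\<^sub>R v = a + v"
            by (simp add: add.assoc flip: scaleR_add_left)
          ultimately show ?thesis using True by simp
        qed (rule half[OF _ P])
        ultimately have "AE a in \<mu>. AE v in lborel. ?P a v"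
          by (intro line_transfer[OF P])
        then have "AE a in \<mu>. AE b in lborel. D (insert_pair J p q x a b)"
          using AE_lborel_translate[OF slice] by simp
        then show ?thesis by (simp only: p0)
      next
        case False
        then have p0: "M i p = \<mu>" "M i q = lborel" "M (Suc i) p = \<mu>" "M (Suc i) q = \<mu>"
          by (auto simp: M_def p_def q_def)
        have "AE a in \<mu>. AE b in lborel. D (insert_pair J p q x a b)" using elim(1) by (simp only: p0)
        then have "AE a in \<mu>. AE v in lborel. ?P a v"
          using AE_lborel_translate[OF slice] by simp
        then have "AE a in \<mu>. AE z in \<mu>. ?P a (z - a)"
          by (intro radial_transfer[OF P]) (use inv_q in auto)
        then have "AE a in \<mu>. AE z in \<mu>. D (insert_pair J p q x a z)" by simp
        then show ?thesis by (simp only: p0)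
      qed
    qed
    then show ?thesis
      using AE_PiM_insert_pair[OF M(1)[of "Suc i"] M(2)[of "Suc i"] J q(2) D'] by (simp only: Jm PiJ)
  qed
  have "AE y in Pi\<^sub>M {..m} (M i). D y" if "i \<le> Suc m" for i
    using that
  proof (induction i)
    case 0
    have "M 0 = (\<lambda>_. lborel)" by (auto simp: M_def)
    show ?case unfolding \<open>M 0 = _\<close> by (rule AE)
  next
    case (Suc i)
    then show ?case by (intro step) auto
  qed
  from this[of "Suc m"] have "AE y in Pi\<^sub>M {..m} (M (Suc m)). D y" by simp
  also have "Pi\<^sub>M {..m} (M (Suc m)) = Pi\<^sub>M {..m} (\<lambda>_. \<mu>)"
    by (intro PiM_cong) (auto simp: M_def)
  finally show ?thesis .
qed

lemma AE_finite_energy_mu: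
  assumes d: "DIM('a) \<ge> 3"
  shows "AE y in Pi\<^sub>M {..DIM('a) - 2} (\<lambda>_. \<mu>). finite_energy {..DIM('a) - 2} y"
proof (rule tuple_transfer)
  show "1 \<le> DIM('a) - 2" using d by simp
  show "Measurable.pred (Pi\<^sub>M {..DIM('a) - 2} (\<lambda>_. borel)) (finite_energy {..DIM('a) - 2})"
    by (rule pred_finite_energy) auto
  show "AE y in Pi\<^sub>M {..DIM('a) - 2} (\<lambda>_. lborel). finite_energy {..DIM('a) - 2} y"
    using d by (intro AE_finite_energy) auto
qed (auto intro!: finite_energy_affine)

end

section \<open>Frostman's lemma\<close>

text \<open>Nodes of the binary tree are lists with the latest branch in front, so
  \<open>False # q\<close> and \<open>True # q\<close> are the children of q. Subadditivity is all
  that is retained of Hausdorff content.\<close>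

locale tree_capacity =
  fixes h :: "bool list \<Rightarrow> real"
  assumes h_nonneg: "0 \<le> h q" and h_sub: "h q \<le> h (False # q) + h (True # q)" and h_root: "0 < h []"
begin

text \<open>A unit mass at the root is passed down in proportion to the capacities of the
  children.\<close>

primrec mass :: "bool list \<Rightarrow> real" where
  "mass [] = 1"
| "mass (b # q) = mass q * h (b # q) / (h (False # q) + h (True # q))"

primrec left :: "bool list \<Rightarrow> real" where
  "left [] = 0"
| "left (b # q) = (if b then left q + mass (False # q) else left q)"

text \<open>The unit interval is cut into consecutive intervals of length \<open>mass q\<close>, the
  child False to the left. A uniform u thus selects a random branch with the prescribed masses, and
  the limit measure arises as a pushforward without an extension theorem.\<close>

primrec path :: "nat \<Rightarrow> real \<Rightarrow> bool list" where
  "path 0 u = []"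
| "path (Suc n) u = (left (path n u) + mass (False # path n u) \<le> u) # path n u"

lemma length_path [simp]: "length (path n u) = n"
  by (induction n) auto

lemma mass_nonneg: "0 \<le> mass q"
  by (induction q) (auto intro!: divide_nonneg_nonneg mult_nonneg_nonneg add_nonneg_nonneg h_nonneg)

text \<open>The quotient of mass and capacity cannot grow along a branch, since by subadditivity the
  capacity of a node is at most the sum over its children. At the root it is 1 /
  \<open>h []\<close>.\<close>

lemma mass_le: "mass q \<le> h q / h []"
proof (induction q)
  case Nil
  then show ?case using h_root by simp
next
  case (Cons b q)
  let ?s = "h (False # q) + h (True # q)"
  have s: "0 \<le> ?s" "h q \<le> ?s" using h_sub[of q] h_nonneg by (auto intro: add_nonneg_nonneg)
  show ?case
  proof (cases "?s = 0")
    case True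
    then show ?thesis using h_nonneg h_root by (simp del: add_nonneg_eq_0_iff)
  next
    case False
    have "mass q * h (b # q) / ?s \<le> (h q / h []) * h (b # q) / ?s"
      using Cons s h_nonneg by (intro divide_right_mono mult_right_mono) auto
    also have "\<dots> = (h q / ?s) * (h (b # q) / h [])" by simp
    also have "\<dots> \<le> 1 * (h (b # q) / h [])"
    proof -
      have "0 < ?s" using s(1) False by simp
      then have "h q / ?s \<le> 1" using s(2) by simp
      then show ?thesis using h_nonneg h_root by (intro mult_right_mono) auto
    qed
    finally show ?thesis by simp
  qed
qed

lemma mass_split: "mass (False # q) + mass (True # q) = mass q"
proof (cases "h (False # q) + h (True # q) = 0")
  case True
  then have "h q \<le> 0" using h_sub[of q] by simp
  \<comment> \<open>If both children have capacity 0, the division by zero gives them mass 0.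
    Nothing is lost, as then q has no capacity and by \<open>mass_le\<close> no mass.\<close>
  then have "mass q \<le> 0" using mass_le[of q] h_root by (meson divide_nonpos_pos order_trans)
  then have "mass q = 0" using mass_nonneg[of q] by simp
  then show ?thesis by simp
next
  case False
  then show ?thesis by (simp add: add_divide_distrib[symmetric] distrib_left[symmetric])
qed

lemma path_interval:
  assumes "0 \<le> u" "u < 1"
  shows "left (path n u) \<le> u \<and> u < left (path n u) + mass (path n u)"
proof (induction n)
  case 0
  then show ?case using assms by simp
next
  case (Suc n)
  then show ?case using mass_split[of "path n u"] by (auto simp del: mass.simps)
qed

lemma path_measurable: "{u. path n u = q} \<in> sets borel"
proof (induction n arbitrary: q)
  case 0
  have "{u. path 0 u = q} = (if q = [] then UNIV else {})" by auto
  then show ?case by simp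
next
  case (Suc n)
  show ?case
  proof (cases q)
    case Nil
    then show ?thesis by simp
  next
    case (Cons b p)
    have "{u. path (Suc n) u = q} = {u. path n u = p} \<inter> {u. (left p + mass (False # p) \<le> u) = b}"
      using Cons by auto
    moreover have "{u. (left p + mass (False # p) \<le> u) = b} \<in> sets borel"
      by (cases b) auto
    ultimately show ?thesis using Suc[of p] by auto
  qed
qed

definition unif :: "real measure" where
  "unif = density lborel (indicator {0..<1})"

lemma sets_unif [measurable_cong]: "sets unif = sets borel"
  by (simp add: unif_def)

lemma prob_space_unif: "prob_space unif"
  by (rule prob_spaceI) (simp add: unif_def emeasure_density)

lemma emeasure_path_le: "emeasure unif {u. path n u = q} \<le> ennreal (mass q)"
proof -
  have [measurable]: "{u. path n u = q} \<in> sets borel" by (rule path_measurable)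
  have "emeasure unif {u. path n u = q} = (\<integral>\<^sup>+u. indicator {0..<1} u * indicator {u. path n u = q} u \<partial>lborel)"
    unfolding unif_def by (subst emeasure_density) auto
  also have "\<dots> \<le> (\<integral>\<^sup>+u. indicator {left q..<left q + mass q} u \<partial>lborel)"
    using path_interval[of _ n] by (intro nn_integral_mono) (auto simp: indicator_def)
  also have "\<dots> = ennreal (mass q)" using mass_nonneg[of q] by simp
  finally show ?thesis .
qed

text \<open>Later this forces limit points into E. Each level has finitely many nodes, so almost
  every branch avoids those of mass 0, and positive mass implies positive capacity.\<close>

lemma AE_path_pos: "AE u in unif. \<forall>n. 0 < h (path n u)"
  unfolding AE_all_countable
proof
  fix n
  let ?Z = "{q. length q = n \<and> mass q = 0}"
  have finZ: "finite ?Z" by (rule finite_subset[OF _ finite_lists_length_eq[of "UNIV :: bool set" n]]) auto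
  have "AE u in unif. \<forall>q\<in>?Z. path n u \<noteq> q"
  proof (rule AE_finite_allI[OF finZ])
    fix q assume "q \<in> ?Z"
    then have "emeasure unif {u. path n u = q} = 0" using emeasure_path_le[of n q] by simp
    then have "{u. path n u = q} \<in> null_sets unif" using path_measurable by (auto intro!: null_setsI simp: sets_unif)
    from AE_not_in[OF this] show "AE u in unif. path n u \<noteq> q" by eventually_elim auto
  qed
  then show "AE u in unif. 0 < h (path n u)"
  proof eventually_elim
    case (elim u)
    then have "path n u \<notin> ?Z" by blast
    then have "mass (path n u) \<noteq> 0" by simp
    then have "0 < mass (path n u)" using mass_nonneg[of "path n u"] by simp
    also have "\<dots> \<le> h (path n u) / h []" by (rule mass_le)
    finally show ?case using h_root by (simp add: zero_less_divide_iff)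
  qed
qed

end

section \<open>Hausdorff content\<close>

lemma hausdorff_content_le_cover:
  assumes "A \<subseteq> (\<Union>i. U i)" "\<And>i. bounded (U i)" "\<And>i. diameter (U i) \<le> \<delta>"
  shows "hausdorff_content s \<delta> A \<le> (\<Sum>i::nat. diam_powr s (U i))"
  unfolding hausdorff_content_def using assms by (intro Inf_lower) blast

lemma hausdorff_content_le_diam:
  assumes "0 \<le> \<delta>" "bounded B" "diameter B \<le> \<delta>" "A \<subseteq> B"
  shows "hausdorff_content s \<delta> A \<le> diam_powr s B"
proof -
  let ?U = "\<lambda>i::nat. if i = 0 then B else {}"
  have "hausdorff_content s \<delta> A \<le> (\<Sum>i. diam_powr s (?U i))"
    using assms by (intro hausdorff_content_le_cover) (auto split: if_splits)
  also have "\<dots> = diam_powr s B"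
    by (subst suminf_finite[of "{0}"]) (auto simp: diam_powr_def)
  finally show ?thesis .
qed

lemma hausdorff_content_Un:
  "hausdorff_content s \<delta> (A \<union> B) \<le> hausdorff_content s \<delta> A + hausdorff_content s \<delta> B"
proof -
  have main: "hausdorff_content s \<delta> (A \<union> B) \<le> (\<Sum>i. diam_powr s (U i)) + (\<Sum>i. diam_powr s (V i))"
    if U: "A \<subseteq> (\<Union>i. U i)" "\<forall>i. bounded (U i) \<and> diameter (U i) \<le> \<delta>"
      and V: "B \<subseteq> (\<Union>i. V i)" "\<forall>i. bounded (V i) \<and> diameter (V i) \<le> \<delta>" for U V :: "nat \<Rightarrow> 'a set"
  proof -
    \<comment> \<open>Two countable covers are interleaved, one on the even and one on the odd
      indices.\<close>
    let ?W = "\<lambda>i. if even i then U (i div 2) else V (i div 2)"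
    have "A \<union> B \<subseteq> (\<Union>i. ?W i)"
    proof
      fix x assume "x \<in> A \<union> B"
      then consider i where "x \<in> U i" | i where "x \<in> V i" using U V by auto
      then show "x \<in> (\<Union>i. ?W i)"
      proof cases
        case (1 i)
        then have "x \<in> ?W (2 * i)" by simp
        then show ?thesis by (intro UN_I[of "2 * i"]) auto
      next
        case (2 i)
        then have "x \<in> ?W (2 * i + 1)" by simp
        then show ?thesis by (intro UN_I[of "2 * i + 1"]) auto
      qed
    qed
    then have "hausdorff_content s \<delta> (A \<union> B) \<le> (\<Sum>i. diam_powr s (?W i))"
      using U V by (intro hausdorff_content_le_cover) auto
    also have "\<dots> \<le> (\<Sum>i. diam_powr s (U i)) + (\<Sum>i. diam_powr s (V i))"
    proof (rule suminf_le_const)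
      fix n
      have eq: "(\<Sum>i<2*n. diam_powr s (?W i)) = (\<Sum>i<n. diam_powr s (U i)) + (\<Sum>i<n. diam_powr s (V i))"
        by (induction n) (auto simp: ac_simps)
      have "(\<Sum>i<n. diam_powr s (?W i)) \<le> (\<Sum>i<2*n. diam_powr s (?W i))"
        by (intro sum_mono2) auto
      also have "\<dots> \<le> (\<Sum>i. diam_powr s (U i)) + (\<Sum>i. diam_powr s (V i))"
        unfolding eq by (intro add_mono sum_le_suminf) auto
      finally show "(\<Sum>i<n. diam_powr s (?W i)) \<le> (\<Sum>i. diam_powr s (U i)) + (\<Sum>i. diam_powr s (V i))" .
    qed simp
    finally show ?thesis .
  qed
  have "hausdorff_content s \<delta> (A \<union> B) \<le> x + y"
    if "x \<in> {(\<Sum>i. diam_powr s (U i)) | U. A \<subseteq> (\<Union>i::nat. U i) \<and> (\<forall>i. bounded (U i) \<and> diameter (U i) \<le> \<delta>)}"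
      "y \<in> {(\<Sum>i. diam_powr s (U i)) | U. B \<subseteq> (\<Union>i::nat. U i) \<and> (\<forall>i. bounded (U i) \<and> diameter (U i) \<le> \<delta>)}" for x y
    using that main by auto
  note xy = this
  show ?thesis
  proof (rule ennreal_le_epsilon)
    fix e :: real assume fin: "hausdorff_content s \<delta> A + hausdorff_content s \<delta> B < \<top>" and e: "0 < e"
    have A: "hausdorff_content s \<delta> A < hausdorff_content s \<delta> A + ennreal (e/2)"
     and B: "hausdorff_content s \<delta> B < hausdorff_content s \<delta> B + ennreal (e/2)"
      using fin e by (cases "hausdorff_content s \<delta> A"; cases "hausdorff_content s \<delta> B"; auto simp: ennreal_plus[symmetric] simp del: ennreal_plus intro!: ennreal_lessI)+
    obtain x where x: "x \<in> {(\<Sum>i. diam_powr s (U i)) | U. A \<subseteq> (\<Union>i::nat. U i) \<and> (\<forall>i. bounded (U i) \<and> diameter (U i) \<le> \<delta>)}"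
      "x < hausdorff_content s \<delta> A + ennreal (e/2)"
      using A by (subst (asm) (1) hausdorff_content_def) (auto simp: Inf_less_iff)
    obtain y where y: "y \<in> {(\<Sum>i. diam_powr s (U i)) | U. B \<subseteq> (\<Union>i::nat. U i) \<and> (\<forall>i. bounded (U i) \<and> diameter (U i) \<le> \<delta>)}"
      "y < hausdorff_content s \<delta> B + ennreal (e/2)"
      using B by (subst (asm) (1) hausdorff_content_def) (auto simp: Inf_less_iff)
    have "hausdorff_content s \<delta> (A \<union> B) \<le> x + y" by (rule xy[OF x(1) y(1)])
    also have "\<dots> \<le> (hausdorff_content s \<delta> A + ennreal (e/2)) + (hausdorff_content s \<delta> B + ennreal (e/2))"
      by (intro add_mono less_imp_le x y)
    also have "\<dots> = hausdorff_content s \<delta> A + hausdorff_content s \<delta> B + (ennreal (e/2) + ennreal (e/2))"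
      by (simp only: ac_simps)
    also have "ennreal (e/2) + ennreal (e/2) = ennreal e" using e by (simp flip: ennreal_plus)
    finally show "hausdorff_content s \<delta> (A \<union> B) \<le> hausdorff_content s \<delta> A + hausdorff_content s \<delta> B + ennreal e" .
  qed
qed

section \<open>Dyadic boxes and the construction of a Frostman measure\<close>

locale dyadic_boxes =
  fixes ax :: "nat \<Rightarrow> 'a::euclidean_space" and R :: real
  assumes ax: "bij_betw ax {..<DIM('a)} Basis" and R: "0 < R"
begin

definition idx :: "'a \<Rightarrow> nat" where
  "idx = the_inv_into {..<DIM('a)} ax"

definition dir :: "nat \<Rightarrow> 'a" where
  "dir n = ax (n mod DIM('a))"

text \<open>The width in direction \<open>b\<close> after \<open>n\<close> bisections, the \<open>n\<close>-th being perpendicular to \<open>dir n\<close>.\<close>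
definition width :: "nat \<Rightarrow> 'a \<Rightarrow> real" where
  "width n b = 2 * R * (1/2) ^ ((n + DIM('a) - 1 - idx b) div DIM('a))"

text \<open>Cutting one direction at a time, cyclically, makes the subdivision binary as
  \<open>tree_capacity\<close> demands. In the step \<open>length q\<close> is the number of the
  current bisection, and the bit True selects the upper half.\<close>

primrec lo :: "bool list \<Rightarrow> 'a" where
  "lo [] = (\<Sum>b\<in>Basis. (- R) *\<^sub>R b)"
| "lo (b # q) = lo q + (if b then (width (length q) (dir (length q)) / 2) *\<^sub>R dir (length q) else 0)"

definition hi :: "bool list \<Rightarrow> 'a" where
  "hi q = lo q + (\<Sum>b\<in>Basis. width (length q) b *\<^sub>R b)"

lemma dir_Basis [simp]: "dir n \<in> Basis"
  using ax by (auto simp: dir_def bij_betw_def)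

lemma idx_less: "b \<in> Basis \<Longrightarrow> idx b < DIM('a)"
  using the_inv_into_into[of ax "{..<DIM('a)}" b "{..<DIM('a)}"] ax by (auto simp: idx_def bij_betw_def)

lemma idx_eq_iff: "b \<in> Basis \<Longrightarrow> idx b = n mod DIM('a) \<longleftrightarrow> b = dir n"
  using ax f_the_inv_into_f[of ax "{..<DIM('a)}" b] the_inv_into_f_f[of ax "{..<DIM('a)}" "n mod DIM('a)"]
  by (auto simp: idx_def dir_def bij_betw_def)

lemma width_pos: "0 < width n b"
  using R by (simp add: width_def)

lemma width_0: "b \<in> Basis \<Longrightarrow> width 0 b = 2 * R"
  by (simp add: width_def)

text \<open>The quotient in \<open>width\<close> counts the bisections k < n with
  \<open>dir k\<close> = b. It increases by one precisely when n is congruent to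
  \<open>idx b\<close> modulo d.\<close>

lemma width_Suc:
  assumes b: "b \<in> Basis"
  shows "width (Suc n) b = (if b = dir n then width n b / 2 else width n b)"
proof -
  let ?d = "DIM('a)"
  have i: "idx b < ?d" by (rule idx_less[OF b])
  have s: "Suc n + ?d - 1 - idx b = Suc (n + ?d - 1 - idx b)" using i by simp
  have "Suc (n + ?d - 1 - idx b) mod ?d = 0 \<longleftrightarrow> idx b = n mod ?d"
  proof -
    have "Suc (n + ?d - 1 - idx b) = n + (?d - idx b)" using i by simp
    moreover have "(n + (?d - idx b)) mod ?d = (n mod ?d + (?d - idx b)) mod ?d" by (simp add: mod_add_left_eq)
    moreover have "(n mod ?d + (?d - idx b)) mod ?d = 0 \<longleftrightarrow> idx b = n mod ?d"
    proof -
      have lt: "n mod ?d < ?d" by simp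
      consider "n mod ?d < idx b" | "n mod ?d = idx b" | "idx b < n mod ?d" by linarith
      then show ?thesis
      proof cases
        case 1
        then have "n mod ?d + (?d - idx b) < ?d" "0 < n mod ?d + (?d - idx b)" using i by auto
        then show ?thesis using 1 i by simp
      next
        case 2
        then show ?thesis using i by simp
      next
        case 3
        have "m + (d - j) = d + (m - j) \<and> 0 < m - j \<and> m - j < d" if "j < d" "m < d" "j < m" for m j d :: nat
          using that by auto
        from this[OF i lt 3] have "n mod ?d + (?d - idx b) = ?d + (n mod ?d - idx b)" "0 < n mod ?d - idx b" "n mod ?d - idx b < ?d"
          by blast+
        then have "(n mod ?d + (?d - idx b)) mod ?d = n mod ?d - idx b" by (simp only: mod_add_self1 mod_less)
        then show ?thesis using 3 by simp
      qed
    qed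
    ultimately show ?thesis by simp
  qed
  then show ?thesis
    unfolding width_def s div_Suc using idx_eq_iff[OF b, of n] by simp
qed

lemma width_mult: "b \<in> Basis \<Longrightarrow> width (DIM('a) * k) b = 2 * R * (1/2) ^ k"
proof -
  assume b: "b \<in> Basis"
  have "DIM('a) * k + DIM('a) - 1 - idx b = DIM('a) * k + (DIM('a) - 1 - idx b)" 
    using idx_less[OF b] by simp
  then have "(DIM('a) * k + DIM('a) - 1 - idx b) div DIM('a) = k"
    by simp
  then show ?thesis by (simp add: width_def)
qed

lemma lo_inner:
  assumes "c \<in> Basis"
  shows "lo (b # q) \<bullet> c = lo q \<bullet> c + (if b \<and> c = dir (length q) then width (length q) c / 2 else 0)"
  using assms inner_Basis[OF dir_Basis[of "length q"] assms] by (auto simp: inner_add_left)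

lemma hi_inner: "c \<in> Basis \<Longrightarrow> hi q \<bullet> c = lo q \<bullet> c + width (length q) c"
  by (simp add: hi_def inner_add_left inner_sum_left inner_Basis if_distrib cong: if_cong)

lemma mem_cbox: "x \<in> cbox (lo q) (hi q) \<longleftrightarrow>
    (\<forall>c\<in>Basis. lo q \<bullet> c \<le> x \<bullet> c \<and> x \<bullet> c \<le> lo q \<bullet> c + width (length q) c)"
  by (auto simp: mem_box hi_inner)

lemma mem_obox: "x \<in> box (lo q) (hi q) \<longleftrightarrow>
    (\<forall>c\<in>Basis. lo q \<bullet> c < x \<bullet> c \<and> x \<bullet> c < lo q \<bullet> c + width (length q) c)"
  by (auto simp: mem_box hi_inner)

lemma cbox_Cons_subset: "cbox (lo (b # q)) (hi (b # q)) \<subseteq> cbox (lo q) (hi q)"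
proof
  fix x assume x: "x \<in> cbox (lo (b # q)) (hi (b # q))"
  show "x \<in> cbox (lo q) (hi q)"
    unfolding mem_cbox
  proof
    fix c :: 'a assume c: "c \<in> Basis"
    show "lo q \<bullet> c \<le> x \<bullet> c \<and> x \<bullet> c \<le> lo q \<bullet> c + width (length q) c"
      using x[unfolded mem_cbox, rule_format, OF c] width_pos[of "length q" c]
      by (auto simp: lo_inner[OF c] width_Suc[OF c] split: if_splits simp del: lo.simps)
  qed
qed

lemma obox_Cons_subset: "box (lo (b # q)) (hi (b # q)) \<subseteq> box (lo q) (hi q)"
proof
  fix x assume x: "x \<in> box (lo (b # q)) (hi (b # q))"
  show "x \<in> box (lo q) (hi q)"
    unfolding mem_obox
  proof
    fix c :: 'a assume c: "c \<in> Basis"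
    show "lo q \<bullet> c < x \<bullet> c \<and> x \<bullet> c < lo q \<bullet> c + width (length q) c"
      using x[unfolded mem_obox, rule_format, OF c] width_pos[of "length q" c]
      by (auto simp: lo_inner[OF c] width_Suc[OF c] split: if_splits simp del: lo.simps)
  qed
qed

lemma cbox_split: "cbox (lo q) (hi q) \<subseteq> cbox (lo (False # q)) (hi (False # q)) \<union> cbox (lo (True # q)) (hi (True # q))"
proof
  fix x assume x: "x \<in> cbox (lo q) (hi q)"
  let ?k = "dir (length q)"
  have "x \<in> cbox (lo (b # q)) (hi (b # q))" if b: "b \<longleftrightarrow> lo q \<bullet> ?k + width (length q) ?k / 2 < x \<bullet> ?k" for b
    unfolding mem_cbox
  proof
    fix c :: 'a assume c: "c \<in> Basis"
    show "lo (b # q) \<bullet> c \<le> x \<bullet> c \<and> x \<bullet> c \<le> lo (b # q) \<bullet> c + width (length (b # q)) c"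
      using x[unfolded mem_cbox, rule_format, OF c] b
      by (auto simp: lo_inner[OF c] width_Suc[OF c] split: if_splits simp del: lo.simps)
  qed
  then show "x \<in> cbox (lo (False # q)) (hi (False # q)) \<union> cbox (lo (True # q)) (hi (True # q))"
    by (cases "lo q \<bullet> ?k + width (length q) ?k / 2 < x \<bullet> ?k") auto
qed

lemma obox_disjoint: "length q = length q' \<Longrightarrow> q \<noteq> q' \<Longrightarrow> box (lo q) (hi q) \<inter> box (lo q') (hi q') = {}"
proof (induction q arbitrary: q')
  case Nil
  then show ?case by simp
next
  case (Cons b p)
  then obtain b' p' where q': "q' = b' # p'" by (cases q') auto
  show ?case
  proof (cases "p = p'")
    case False
    then have "box (lo p) (hi p) \<inter> box (lo p') (hi p') = {}" using Cons q' by auto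
    then show ?thesis using obox_Cons_subset[of b p] obox_Cons_subset[of b' p'] q' by blast
  next
    case True
    then have bb: "b \<noteq> b'" using Cons q' by simp
    show ?thesis
    proof (rule ccontr)
      assume "\<not> ?thesis"
      then obtain x where x: "x \<in> box (lo (b # p)) (hi (b # p))" "x \<in> box (lo (b' # p)) (hi (b' # p))"
        using q' True by auto
      show False
        using bb x(1)[unfolded mem_obox, rule_format, OF dir_Basis[of "length p"]]
          x(2)[unfolded mem_obox, rule_format, OF dir_Basis[of "length p"]]
        by (cases b; cases b') (auto simp: lo_inner[OF dir_Basis] width_Suc[OF dir_Basis] simp del: lo.simps)
    qed
  qed
qed

lemma dist_cbox_le:
  assumes "x \<in> cbox (lo q) (hi q)" "y \<in> cbox (lo q) (hi q)"
  shows "dist x y \<le> (\<Sum>c\<in>Basis. width (length q) c)"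
proof -
  have "dist x y \<le> (\<Sum>c\<in>Basis. \<bar>(x - y) \<bullet> c\<bar>)" unfolding dist_norm by (rule norm_le_l1)
  also have "\<dots> \<le> (\<Sum>c\<in>Basis. width (length q) c)"
    using assms by (intro sum_mono) (force simp: mem_cbox inner_diff_left abs_le_iff)
  finally show ?thesis .
qed

lemma diameter_cbox_le: "diameter (cbox (lo q) (hi q)) \<le> (\<Sum>c\<in>Basis. width (length q) c)"
  by (intro diameter_le) (auto intro: dist_cbox_le[unfolded dist_norm] sum_nonneg less_imp_le[OF width_pos])

lemma lo_in_cbox: "lo q \<in> cbox (lo q) (hi q)"
  by (auto simp: mem_cbox less_imp_le[OF width_pos])

lemma sum_width_mult: "(\<Sum>c\<in>Basis. width (DIM('a) * k) c) = DIM('a) * (2 * R * (1/2) ^ k)"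
  by (simp add: width_mult)

lemma width_antimono:
  assumes "m \<le> n" "c \<in> Basis"
  shows "width n c \<le> width m c"
  using assms(1)
proof (induction rule: dec_induct)
  case (step n)
  then show ?case using width_Suc[OF assms(2), of n] width_pos[of n c] by (auto split: if_splits)
qed simp

lemma sum_width_tendsto: "(\<lambda>n. \<Sum>c\<in>Basis. width n c) \<longlonglongrightarrow> 0"
proof (rule LIMSEQ_I)
  fix r :: real assume r: "0 < r"
  have "(\<lambda>k. real DIM('a) * (2 * R * (1/2) ^ k)) \<longlonglongrightarrow> real DIM('a) * (2 * R * 0)"
    by (intro tendsto_intros LIMSEQ_power_zero) simp
  then have "\<forall>\<^sub>F k in sequentially. real DIM('a) * (2 * R * (1/2) ^ k) < r"
    using r by (intro order_tendstoD(2)) auto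
  then obtain k where k: "real DIM('a) * (2 * R * (1/2) ^ k) < r" by (auto simp: eventually_sequentially)
  have "norm ((\<Sum>c\<in>Basis. width n c) - 0) < r" if "DIM('a) * k \<le> n" for n
  proof -
    have "(\<Sum>c\<in>(Basis::'a set). width n c) \<le> (\<Sum>c\<in>Basis. width (DIM('a) * k) c)"
      using that by (intro sum_mono width_antimono)
    also have "\<dots> < r" using k by (simp add: sum_width_mult)
    finally show ?thesis using sum_nonneg[of Basis "width n"] width_pos[of n] by (simp add: less_imp_le)
  qed
  then show "\<exists>N. \<forall>n\<ge>N. norm ((\<Sum>c\<in>Basis. width n c) - 0) < r" by blast
qed

text \<open>At level d k the boxes are cubes of side l k with disjoint interiors. Those that meet
  the ball lie in a concentric ball of radius (1 + d) l k, so comparing volumes bounds their number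
  independently of k and r.\<close>

lemma card_boxes_meeting:
  fixes x :: 'a
  defines "l k \<equiv> 2 * R * (1/2) ^ k"
  assumes r: "0 < r" "r \<le> l k"
  defines "S \<equiv> {q. length q = DIM('a) * k \<and> cbox (lo q) (hi q) \<inter> ball x r \<noteq> {}}"
  shows "finite S" "real (card S) \<le> unit_ball_vol DIM('a) * (1 + real DIM('a)) ^ DIM('a)"
proof -
  let ?d = "DIM('a)"
  have l: "0 < l k" using R by (simp add: l_def)
  show fin: "finite S"
    unfolding S_def by (rule finite_subset[OF _ finite_lists_length_eq[of "UNIV :: bool set" "?d * k"]]) auto
  have vol: "emeasure lborel (box (lo q) (hi q)) = ennreal (l k ^ ?d)" if "q \<in> S" for q
  proof -
    have "length q = ?d * k" using that by (simp add: S_def)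
    then have w: "width (length q) c = l k" if "c \<in> Basis" for c using width_mult[OF that, of k] by (simp add: l_def)
    have "emeasure lborel (box (lo q) (hi q)) = ennreal (\<Prod>c\<in>Basis. (hi q - lo q) \<bullet> c)"
      using width_pos by (intro emeasure_lborel_box) (simp add: hi_inner less_imp_le)
    also have "(\<Prod>c\<in>Basis. (hi q - lo q) \<bullet> c) = (\<Prod>c\<in>(Basis :: 'a set). l k)"
      using w by (intro prod.cong) (auto simp: inner_diff_left hi_inner)
    finally show ?thesis by simp
  qed
  have sub: "box (lo q) (hi q) \<subseteq> ball x ((1 + real ?d) * l k)" if q: "q \<in> S" for q
  proof
    fix y assume "y \<in> box (lo q) (hi q)"
    then have y: "y \<in> cbox (lo q) (hi q)" using box_subset_cbox by blast
    obtain z where z: "z \<in> cbox (lo q) (hi q)" "dist x z < r" using q by (auto simp: S_def)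
    have "dist x y \<le> dist x z + dist z y" by (rule dist_triangle)
    also have "dist z y \<le> (\<Sum>c\<in>Basis. width (length q) c)" by (rule dist_cbox_le[OF z(1) y])
    also have "\<dots> = real ?d * l k" using q sum_width_mult[of k] by (simp add: S_def l_def)
    finally show "y \<in> ball x ((1 + real ?d) * l k)" using z(2) r by (simp add: algebra_simps)
  qed
  have "ennreal (real (card S) * l k ^ ?d) = (\<Sum>q\<in>S. emeasure lborel (box (lo q) (hi q)))"
    using l by (simp add: vol ennreal_mult ennreal_of_nat_eq_real_of_nat)
  also have "\<dots> = emeasure lborel (\<Union>q\<in>S. box (lo q) (hi q))"
  proof (rule sum_emeasure[OF _ _ fin])
    show "disjoint_family_on (\<lambda>q. box (lo q) (hi q)) S"
      unfolding disjoint_family_on_def by (intro ballI impI obox_disjoint) (auto simp: S_def)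
  qed auto
  also have "\<dots> \<le> emeasure lborel (ball x ((1 + real ?d) * l k))"
    using sub by (intro emeasure_mono) auto
  also have "\<dots> = ennreal (unit_ball_vol ?d * ((1 + real ?d) * l k) ^ ?d)"
    using l by (intro emeasure_ball) auto
  finally have "real (card S) * l k ^ ?d \<le> unit_ball_vol ?d * ((1 + real ?d) * l k) ^ ?d"
    using l by (subst (asm) ennreal_le_iff) auto
  then have "real (card S) * l k ^ ?d \<le> (unit_ball_vol ?d * (1 + real ?d) ^ ?d) * l k ^ ?d"
    by (simp add: power_mult_distrib mult_ac)
  then show "real (card S) \<le> unit_ball_vol ?d * (1 + real ?d) ^ ?d" using l by simp
qed

end

text \<open>The capacity of a box is the Hausdorff content of its part of E. Then
  \<open>mass_le\<close> bounds the mass of a cube of side l by a multiple of l^s, and a ball of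
  comparable radius meets boundedly many such cubes.\<close>

lemma frostman_exists:
  fixes E :: "'a::euclidean_space set"
  assumes E: "compact E" and s: "0 < s" and H: "hausdorff_measure s E \<noteq> 0"
  obtains \<mu> :: "'a measure" and c where "sets \<mu> = sets borel" "prob_space \<mu>" "0 < c"
    "\<And>x r. 0 < r \<Longrightarrow> emeasure \<mu> (ball x r) \<le> ennreal (c * r powr s)" "AE x in \<mu>. x \<in> E"
proof -
  let ?d = "DIM('a)"
  obtain \<delta> where \<delta>: "0 < \<delta>" "0 < hausdorff_content s \<delta> E"
    using H by (auto simp: hausdorff_measure_def SUP_eq_iff zero_less_iff_neq_zero)
  obtain R where Rb: "0 < R" "E \<subseteq> cball 0 R"
    using compact_imp_bounded[OF E] by (metis bounded_pos mem_cball_0 subsetI)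
  obtain ax :: "nat \<Rightarrow> 'a" where ax: "bij_betw ax {..<?d} Basis"
    using ex_bij_betw_nat_finite[of "Basis :: 'a set"] by (auto simp: atLeast0LessThan)
  interpret dyadic_boxes ax R by standard (use ax Rb in auto)
  define B where "B = (\<lambda>q. cbox (lo q) (hi q))"
  \<comment> \<open>Content at a fixed scale \<delta> is finite, positive on E, and at most the s-th
    power of the diameter on small boxes. The Hausdorff measure itself may be infinite.\<close>
  define g where "g = (\<lambda>q. hausdorff_content s \<delta> (E \<inter> B q))"
  define h where "h = (\<lambda>q. enn2real (g q))"
  have E_root: "E \<inter> B [] = E"
  proof -
    have "x \<in> B []" if "x \<in> E" for x
      unfolding B_def mem_cbox
    proof
      fix c :: 'a assume c: "c \<in> Basis"
      have "\<bar>x \<bullet> c\<bar> \<le> R" using Basis_le_norm[OF c, of x] Rb(2) that by auto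
      moreover have "lo [] \<bullet> c = - R" using c by (simp add: inner_sum_left inner_Basis if_distrib sum_negf cong: if_cong)
      ultimately show "lo [] \<bullet> c \<le> x \<bullet> c \<and> x \<bullet> c \<le> lo [] \<bullet> c + width (length []) c"
        using width_0[OF c] by (simp add: abs_le_iff del: lo.simps)
    qed
    then show ?thesis by auto
  qed
  have g_sub: "g q \<le> g (False # q) + g (True # q)" for q
  proof -
    have "E \<inter> B q = (E \<inter> B (False # q)) \<union> (E \<inter> B (True # q))"
      using cbox_split[of q] cbox_Cons_subset[of _ q] unfolding B_def by blast
    then show ?thesis unfolding g_def by (metis hausdorff_content_Un)
  qed
  have g_small: "g q \<le> ennreal ((\<Sum>c\<in>Basis. width (length q) c) powr s)" if "(\<Sum>c\<in>Basis. width (length q) c) \<le> \<delta>" for q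
  proof -
    have "g q \<le> diam_powr s (B q)"
      unfolding g_def B_def using \<delta> that diameter_cbox_le[of q]
      by (intro hausdorff_content_le_diam) auto
    also have "\<dots> \<le> ennreal ((\<Sum>c\<in>Basis. width (length q) c) powr s)"
      using s diameter_cbox_le[of q] 
      by (auto simp: diam_powr_def B_def intro!: ennreal_leI powr_mono2 diameter_ge_0)
    finally show ?thesis .
  qed
  have "\<forall>\<^sub>F n in sequentially. (\<Sum>c\<in>(Basis::'a set). width n c) < \<delta>"
    using \<delta> sum_width_tendsto by (intro order_tendstoD(2)) auto
  then obtain N where N: "\<And>n. N \<le> n \<Longrightarrow> (\<Sum>c\<in>(Basis::'a set). width n c) < \<delta>" by (auto simp: eventually_sequentially)
  \<comment> \<open>From level N on a box is small enough to cover its part of E alone; coarser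
    boxes inherit finiteness from their children.\<close>
  have g_fin: "g q < \<top>" for q
  proof (induction "N - length q" arbitrary: q)
    case 0
    then have "g q \<le> ennreal ((\<Sum>c\<in>Basis. width (length q) c) powr s)" using N by (intro g_small less_imp_le) simp
    then show ?case by (rule le_less_trans) simp
  next
    case (Suc k)
    then have "g (False # q) < \<top>" "g (True # q) < \<top>" by auto
    then show ?case by (intro le_less_trans[OF g_sub]) (simp add: less_top[symmetric])
  qed
  have g_h: "g q = ennreal (h q)" for q using g_fin[of q] by (simp add: h_def)
  have h_nn: "0 \<le> h q" for q by (simp add: h_def)
  interpret tree_capacity h
  proof
    show "0 \<le> h q" for q by (rule h_nn)
    show "h q \<le> h (False # q) + h (True # q)" for q
    proof -
      have "ennreal (h q) \<le> ennreal (h (False # q) + h (True # q))"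
        using g_sub[of q] h_nn by (simp add: g_h)
      then show ?thesis using h_nn by (subst (asm) ennreal_le_iff) auto
    qed
    have "0 < g []" using \<delta>(2) unfolding g_def E_root .
    then show "0 < h []" by (simp add: g_h)
  qed
  define X where "X = (\<lambda>u. lim (\<lambda>n. lo (path n u)))"
  have nested: "B (path n u) \<subseteq> B (path m u)" if "m \<le> n" for m n u
    using that
  proof (induction rule: dec_induct)
    case (step n)
    then show ?case using cbox_Cons_subset[of _ "path n u"] unfolding B_def path.simps by blast
  qed simp
  have lo_B: "lo (path n u) \<in> B (path m u)" if "m \<le> n" for m n u
    using nested[OF that] lo_in_cbox[of "path n u"] by (auto simp: B_def)
  have conv: "(\<lambda>n. lo (path n u)) \<longlonglongrightarrow> X u" for u
  proof -
    have "Cauchy (\<lambda>n. lo (path n u))"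
    proof (rule metric_CauchyI)
      fix e :: real assume "0 < e"
      then have "\<forall>\<^sub>F n in sequentially. (\<Sum>c\<in>(Basis::'a set). width n c) < e"
        using sum_width_tendsto by (intro order_tendstoD(2)) auto
      then obtain M where M: "(\<Sum>c\<in>(Basis::'a set). width M c) < e" by (auto simp: eventually_sequentially)
      have "dist (lo (path m u)) (lo (path n u)) < e" if "M \<le> m" "M \<le> n" for m n
        using dist_cbox_le[of "lo (path m u)" "path M u" "lo (path n u)"] lo_B that M by (auto simp: B_def)
      then show "\<exists>M. \<forall>m\<ge>M. \<forall>n\<ge>M. dist (lo (path m u)) (lo (path n u)) < e" by blast
    qed
    then have "convergent (\<lambda>n. lo (path n u))" by (rule Cauchy_convergent)
    then show ?thesis unfolding X_def by (rule convergent_LIMSEQ_iff[THEN iffD1])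
  qed
  have X_B: "X u \<in> B (path m u)" for m u
  proof (rule Lim_in_closed_set[OF _ _ _ conv])
    show "closed (B (path m u))" unfolding B_def by (rule closed_cbox)
    show "\<forall>\<^sub>F n in sequentially. lo (path n u) \<in> B (path m u)"
      using lo_B by (auto simp: eventually_sequentially)
  qed simp
  have X_meas [measurable]: "X \<in> borel_measurable unif"
  proof (rule borel_measurable_LIMSEQ_metric[OF _ conv])
    fix n
    have "(\<lambda>u. path n u) \<in> measurable borel (count_space UNIV)"
      by (rule measurable_count_space_eq2_countable[THEN iffD2])
        (use path_measurable[of n] in \<open>auto simp: vimage_def\<close>)
    then have "(\<lambda>u. lo (path n u)) \<in> borel_measurable borel"
      by (rule measurable_compose) simp
    then show "(\<lambda>u. lo (path n u)) \<in> borel_measurable unif" by simp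
  qed
  \<comment> \<open>Boxes along almost every branch have positive content and hence contain points
    of E. These converge to X u, and E is closed.\<close>
  have X_E: "AE u in unif. X u \<in> E"
    using AE_path_pos
  proof eventually_elim
    case (elim u)
    have "E \<inter> B (path n u) \<noteq> {}" for n
    proof
      assume emp: "E \<inter> B (path n u) = {}"
      have "g (path n u) \<le> diam_powr s ({} :: 'a set)"
        unfolding g_def emp using \<delta> by (intro hausdorff_content_le_diam) auto
      then have "g (path n u) = 0" by (simp add: diam_powr_def)
      then have "h (path n u) = 0" by (simp add: h_def)
      then show False using elim by (metis less_irrefl)
    qed
    then have "\<forall>n. \<exists>y. y \<in> E \<and> y \<in> B (path n u)" by blast
    from choice[OF this] obtain y where y: "\<And>n. y n \<in> E" "\<And>n. y n \<in> B (path n u)" by blast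
    have "y \<longlonglongrightarrow> X u"
    proof (rule metric_LIMSEQ_I)
      fix e :: real assume "0 < e"
      then have "\<forall>\<^sub>F n in sequentially. (\<Sum>c\<in>(Basis::'a set). width n c) < e"
        using sum_width_tendsto by (intro order_tendstoD(2)) auto
      then obtain M where M: "\<And>n. M \<le> n \<Longrightarrow> (\<Sum>c\<in>(Basis::'a set). width n c) < e" by (auto simp: eventually_sequentially)
      have "dist (y n) (X u) < e" if "M \<le> n" for n
        using dist_cbox_le[of "y n" "path n u" "X u"] y(2)[of n] X_B[of u n] M[OF that] by (auto simp: B_def)
      then show "\<exists>M. \<forall>n\<ge>M. dist (y n) (X u) < e" by blast
    qed
    then show ?case using y(1) compact_imp_closed[OF E] closed_sequentially by blast
  qed
  interpret U: prob_space unif by (rule prob_space_unif)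
  define \<mu> where "\<mu> = distr unif borel X"
  have prob: "prob_space \<mu>" unfolding \<mu>_def by (rule U.prob_space_distr) measurable
  interpret M: prob_space \<mu> by (rule prob)
  \<comment> \<open>The bound 2 R lets some cube side l k satisfy r <= l k < 2 r; the other bound
    keeps the diameters of these cubes at most \<delta>, so that \<open>g_small\<close>
    applies.\<close>
  define r0 where "r0 = min (2 * R) (\<delta> / (2 * real ?d))"
  have r0: "0 < r0" "r0 \<le> 2 * R" "2 * real ?d * r0 \<le> \<delta>"
    using R \<delta> by (auto simp: r0_def min_def field_simps)
  define K where "K = unit_ball_vol ?d * (1 + real ?d) ^ ?d * (2 * real ?d) powr s / h []"
  have K: "0 \<le> K" using h_root by (auto simp: K_def intro!: divide_nonneg_nonneg mult_nonneg_nonneg)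
  have small: "emeasure \<mu> (ball x r) \<le> ennreal (K * r powr s)" if r: "0 < r" "r \<le> r0" for x r
  proof -
    define l where "l = (\<lambda>k. 2 * R * (1/2) ^ k)"
    obtain k where k: "r \<le> l k" "l k < 2 * r"
    proof -
      have "l \<longlonglongrightarrow> 2 * R * 0" unfolding l_def by (intro tendsto_intros LIMSEQ_power_zero) simp
      then have "\<forall>\<^sub>F k in sequentially. l k < 2 * r" using r by (intro order_tendstoD(2)) auto
      then obtain k0 where "l k0 < 2 * r" by (auto simp: eventually_sequentially)
      then obtain k where k: "l k < 2 * r" "\<And>j. j < k \<Longrightarrow> \<not> l j < 2 * r"
        using exists_least_iff[of "\<lambda>k. l k < 2 * r"] by blast
      have "r \<le> l k"
      proof (cases k)
        case 0
        then show ?thesis using r r0 by (simp add: l_def)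
      next
        case (Suc j)
        then have "2 * r \<le> l j" using k(2)[of j] by simp
        then show ?thesis using Suc by (simp add: l_def)
      qed
      then show ?thesis using that k by blast
    qed
    define n where "n = ?d * k"
    define S where "S = {q. length q = n \<and> cbox (lo q) (hi q) \<inter> ball x r \<noteq> {}}"
    have S: "finite S" "real (card S) \<le> unit_ball_vol ?d * (1 + real ?d) ^ ?d"
      using card_boxes_meeting[of r k x] r k by (auto simp: S_def n_def l_def)
    have W: "(\<Sum>c\<in>(Basis :: 'a set). width n c) = real ?d * l k"
      unfolding n_def sum_width_mult by (simp add: l_def)
    have "real ?d * l k \<le> 2 * real ?d * r0" using k r by (simp add: mult_left_mono)
    then have W_le: "real ?d * l k \<le> \<delta>" using r0(3) by linarith
    have mass_S: "mass q \<le> (2 * real ?d * r) powr s / h []" if "q \<in> S" for q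
    proof -
      have len: "length q = n" using that by (simp add: S_def)
      have "ennreal (h q) \<le> ennreal ((real ?d * l k) powr s)"
        using g_small[of q] W_le by (simp add: len W g_h)
      then have "h q \<le> (real ?d * l k) powr s" by (subst (asm) ennreal_le_iff) auto
      also have "\<dots> \<le> (2 * real ?d * r) powr s"
        using k r s by (intro powr_mono2) (auto simp: mult_left_mono)
      finally show ?thesis using mass_le[of q] h_root by (meson divide_right_mono less_imp_le order_trans)
    qed
    have "emeasure \<mu> (ball x r) = emeasure unif (X -` ball x r \<inter> space unif)"
      unfolding \<mu>_def by (rule emeasure_distr) auto
    \<comment> \<open>Mass is counted by branches rather than by boxes, so common faces of closed
      boxes do no harm.\<close>
    also have "\<dots> \<le> emeasure unif (\<Union>q\<in>S. {u. path n u = q})"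
    proof (rule emeasure_mono)
      show "X -` ball x r \<inter> space unif \<subseteq> (\<Union>q\<in>S. {u. path n u = q})"
        using X_B[of _ n] by (force simp: S_def B_def)
      show "(\<Union>q\<in>S. {u. path n u = q}) \<in> sets unif"
        using S(1) path_measurable by (auto simp: sets_unif)
    qed
    also have "\<dots> \<le> (\<Sum>q\<in>S. emeasure unif {u. path n u = q})"
      using S(1) path_measurable by (intro emeasure_subadditive_finite) (auto simp: sets_unif)
    also have "\<dots> \<le> (\<Sum>q\<in>S. ennreal ((2 * real ?d * r) powr s / h []))"
      by (intro sum_mono order_trans[OF emeasure_path_le] ennreal_leI mass_S)
    also have "\<dots> = ennreal (real (card S) * ((2 * real ?d * r) powr s / h []))"
      using h_root by (simp add: ennreal_mult[symmetric] ennreal_of_nat_eq_real_of_nat)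
    also have "\<dots> \<le> ennreal ((unit_ball_vol ?d * (1 + real ?d) ^ ?d) * ((2 * real ?d * r) powr s / h []))"
      using h_root by (intro ennreal_leI mult_right_mono S) auto
    also have "(unit_ball_vol ?d * (1 + real ?d) ^ ?d) * ((2 * real ?d * r) powr s / h []) = K * r powr s"
      using r by (simp add: K_def powr_mult)
    finally show ?thesis .
  qed
  \<comment> \<open>The second summand makes the bound at least 1 for r >= r0, where total mass 1
    suffices.\<close>
  define c where "c = K + r0 powr (- s)"
  have c: "0 < c" using K r0 by (simp add: c_def add_nonneg_pos)
  have ball_le: "emeasure \<mu> (ball x r) \<le> ennreal (c * r powr s)" if r: "0 < r" for x r
  proof (cases "r \<le> r0")
    case True
    have "K * r powr s \<le> c * r powr s" by (intro mult_right_mono) (auto simp: c_def)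
    then show ?thesis using small[OF r True, of x] by (meson ennreal_leI order_trans)
  next
    case False
    have "1 = r0 powr (- s) * r0 powr s" using r0 by (simp add: powr_minus)
    also have "\<dots> \<le> r0 powr (- s) * r powr s" using False r0 s by (intro mult_left_mono powr_mono2) auto
    also have "\<dots> \<le> c * r powr s" using K by (intro mult_right_mono) (auto simp: c_def)
    finally have "ennreal 1 \<le> ennreal (c * r powr s)" by (rule ennreal_leI)
    then show ?thesis using M.measure_le_1[of "ball x r"] by (simp add: M.emeasure_eq_measure) (metis ennreal_1 ennreal_leI M.prob_le_1 order_trans)
  qed
  have "AE x in \<mu>. x \<in> E"
    unfolding \<mu>_def using X_E E by (subst AE_distr_iff) (auto simp: borel_compact)
  then show ?thesis
    using that[of \<mu> c] prob c ball_le by (simp add: \<mu>_def)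
qed

section \<open>Nondegenerate tuples\<close>

definition nondegenerate :: "nat \<Rightarrow> (nat \<Rightarrow> 'a::euclidean_space) \<Rightarrow> bool" where
  "nondegenerate j z \<longleftrightarrow> inj_on z {0..j} \<and> \<not> affine_dependent (z ` {0..j})"

text \<open>The b i form a dual system to the edges z k - z 0 up to an error. The tolerance leaves
  the matrix of inner products diagonally dominant, and the condition is closed in z for fixed
  b.\<close>

definition approx_dual :: "nat \<Rightarrow> (nat \<Rightarrow> 'a::euclidean_space) \<Rightarrow> (nat \<Rightarrow> 'a) \<Rightarrow> bool" where
  "approx_dual j b z \<longleftrightarrow> (\<forall>i\<in>{1..j}. \<forall>k\<in>{1..j}. \<bar>b i \<bullet> (z k - z 0) - of_bool (i = k)\<bar> \<le> 1 / (2 * (real j + 1)))"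

lemma approx_dual_imp_nondegenerate:
  assumes b: "approx_dual j b z"
  shows "nondegenerate j z"
proof -
  define e where "e = 1 / (2 * (real j + 1))"
  have e: "0 < e" "real j * e < 1 / 2" "e \<le> 1/2" by (auto simp: e_def field_simps)
  have B: "\<bar>b i \<bullet> (z k - z 0) - of_bool (i = k)\<bar> \<le> e" if "i \<in> {1..j}" "k \<in> {1..j}" for i k
    using b that by (simp add: approx_dual_def e_def)
  have je: "e < 1/2" if "j \<noteq> 0"
  proof -
    have "1 * e \<le> real j * e" using that e(1) by (intro mult_right_mono) auto
    then show ?thesis using e(2) by linarith
  qed
  have inj: "inj_on z {0..j}"
  proof (rule inj_onI, rule ccontr)
    have less: False if "k < l" "l \<le> j" "z k = z l" for k l
    proof -
      have l: "l \<in> {1..j}" using that by auto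
      have "1 - e \<le> b l \<bullet> (z l - z 0)" using B[OF l l] by (simp add: abs_le_iff)
      moreover have "b l \<bullet> (z l - z 0) \<le> e"
      proof (cases "k = 0")
        case True
        then show ?thesis using that e by simp
      next
        case False
        then have "k \<in> {1..j}" using that by auto
        from B[OF l this] show ?thesis using that by (simp add: abs_le_iff)
      qed
      ultimately show False using je l by auto
    qed
    fix k l assume "k \<in> {0..j}" "l \<in> {0..j}" "z k = z l" "k \<noteq> l"
    then show False using less[of k l] less[of l k] by (cases "k < l") auto
  qed
  have "\<not> affine_dependent (z ` {0..j})"
  proof
    assume "affine_dependent (z ` {0..j})"
    then obtain U where U: "sum U (z ` {0..j}) = 0" "\<exists>v\<in>z ` {0..j}. U v \<noteq> 0" "(\<Sum>v\<in>z ` {0..j}. U v *\<^sub>R v) = 0"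
      by (subst (asm) affine_dependent_explicit_finite) auto
    define cf where "cf = (\<lambda>k. U (z k))"
    have s1: "(\<Sum>k\<in>{0..j}. cf k) = 0" and s2: "(\<Sum>k\<in>{0..j}. cf k *\<^sub>R z k) = 0"
      using U inj by (auto simp: sum.reindex cf_def)
    have split: "{0..j} = insert 0 {1..j}" by auto
    have "(\<Sum>k\<in>{0..j}. cf k *\<^sub>R (z k - z 0)) = 0"
      using s1 s2 by (simp add: scaleR_diff_right sum_subtractf flip: scaleR_left.sum)
    then have s3: "(\<Sum>k\<in>{1..j}. cf k *\<^sub>R (z k - z 0)) = 0" unfolding split by simp
    have "\<exists>k\<in>{1..j}. cf k \<noteq> 0"
    proof (rule ccontr)
      assume "\<not> ?thesis"
      then have z: "cf k = 0" if "k \<in> {1..j}" for k using that by blast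
      then have "cf 0 = 0" using s1 unfolding split by simp
      with z have "cf k = 0" if "k \<in> {0..j}" for k using that by (cases "k = 0") auto
      then show False using U(2) by (auto simp: cf_def)
    qed
    then obtain k0 where k0: "k0 \<in> {1..j}" "cf k0 \<noteq> 0" by blast
    \<comment> \<open>Diagonal dominance: at an index where a linear relation has its largest
      coefficient m, the relation paired with b i gives m <= m j e < m / 2.\<close>
    define m where "m = Max ((\<lambda>k. \<bar>cf k\<bar>) ` {1..j})"
    have "m \<in> (\<lambda>k. \<bar>cf k\<bar>) ` {1..j}" unfolding m_def using k0 by (intro Max_in) auto
    then obtain i where i: "i \<in> {1..j}" "\<bar>cf i\<bar> = m" by auto
    have le_m: "\<bar>cf k\<bar> \<le> m" if "k \<in> {1..j}" for k unfolding m_def using that by (intro Max_ge) auto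
    have m: "0 < m" using le_m[OF k0(1)] k0(2) by linarith
    have "(\<Sum>k\<in>{1..j}. cf k * (b i \<bullet> (z k - z 0))) = b i \<bullet> (\<Sum>k\<in>{1..j}. cf k *\<^sub>R (z k - z 0))"
      by (simp add: inner_sum_right)
    then have "(\<Sum>k\<in>{1..j}. cf k * (b i \<bullet> (z k - z 0))) = 0" by (simp only: s3 inner_zero_right)
    moreover have "(\<Sum>k\<in>{1..j}. cf k * of_bool (i = k)) = cf i"
      using i(1) by (simp add: of_bool_def if_distrib cong: if_cong)
    ultimately have "cf i = - (\<Sum>k\<in>{1..j}. cf k * (b i \<bullet> (z k - z 0) - of_bool (i = k)))"
      by (simp add: right_diff_distrib sum_subtractf)
    then have "m = \<bar>\<Sum>k\<in>{1..j}. cf k * (b i \<bullet> (z k - z 0) - of_bool (i = k))\<bar>" using i(2) by simp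
    also have "\<dots> \<le> (\<Sum>k\<in>{1..j}. \<bar>cf k * (b i \<bullet> (z k - z 0) - of_bool (i = k))\<bar>)" by (rule sum_abs)
    also have "\<dots> \<le> (\<Sum>k\<in>{1..j}. m * e)"
      unfolding abs_mult using B[OF i(1)] le_m m by (intro sum_mono mult_mono) auto
    also have "\<dots> = m * (real j * e)" by simp
    also have "\<dots> < m * 1" using e m by (intro mult_strict_left_mono) auto
    finally show False by simp
  qed
  with inj show ?thesis by (simp add: nondegenerate_def)
qed

lemma nondegenerate_imp_approx_dual:
  fixes z :: "nat \<Rightarrow> 'a::euclidean_space"
  assumes z: "nondegenerate j z" and Q: "\<And>X :: 'a set. open X \<Longrightarrow> X \<noteq> {} \<Longrightarrow> \<exists>q\<in>Q. q \<in> X"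
  shows "\<exists>b\<in>Pi\<^sub>E {1..j} (\<lambda>_. Q). approx_dual j b z"
proof -
  define e where "e = 1 / (2 * (real j + 1))"
  have e: "0 < e" by (simp add: e_def)
  have inj: "inj_on z {0..j}" and aff: "\<not> affine_dependent (z ` {0..j})" using z by (auto simp: nondegenerate_def)
  define w where "w = (\<lambda>k. - z 0 + z k)"
  have "{0..j} = insert 0 {1..j}" by auto
  then have "z ` {0..j} = insert (z 0) (z ` {1..j})" by simp
  moreover have "z 0 \<notin> z ` {1..j}"
  proof
    assume "z 0 \<in> z ` {1..j}"
    then obtain k where k: "k \<in> {1..j}" "z 0 = z k" by blast
    then have "0 = k" by (intro inj_onD[OF inj k(2)]) auto
    then show False using k(1) by simp
  qed
  ultimately have "\<not> dependent ((\<lambda>x. - z 0 + x) ` z ` {1..j})"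
    using aff affine_dependent_iff_dependent[of "z 0" "z ` {1..j}"] by simp
  then have indep: "independent (w ` {1..j})" by (simp add: image_image w_def)
  have w_inj: "w k = w l \<longleftrightarrow> k = l" if "k \<in> {1..j}" "l \<in> {1..j}" for k l
    using inj that by (auto simp: w_def inj_on_def)
  have "\<exists>q\<in>Q. \<forall>k\<in>{1..j}. \<bar>q \<bullet> (z k - z 0) - of_bool (i = k)\<bar> \<le> e" if i: "i \<in> {1..j}" for i
  proof -
    obtain g :: "'a \<Rightarrow> real" where g: "linear g" "\<forall>x\<in>w ` {1..j}. g x = of_bool (x = w i)"
      using linear_independent_extend[OF indep, of "\<lambda>x. of_bool (x = w i)"] by auto
    \<comment> \<open>An exact dual vector, representing the functional that is 1 on the i-th edge
      and 0 on the others. It is then moved to a nearby point of the dense set Q.\<close>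
    define b0 where "b0 = adjoint g 1"
    have b0: "b0 \<bullet> x = g x" for x
      using adjoint_works[OF g(1), of x 1] by (simp add: b0_def inner_commute)
    define r where "r = e / (1 + (\<Sum>k\<in>{1..j}. norm (w k)))"
    have r: "0 < r" using e by (auto simp: r_def intro!: divide_pos_pos add_pos_nonneg sum_nonneg)
    obtain q where q: "q \<in> Q" "q \<in> ball b0 r" using Q[of "ball b0 r"] r by auto
    have "\<bar>q \<bullet> (z k - z 0) - of_bool (i = k)\<bar> \<le> e" if k: "k \<in> {1..j}" for k
    proof -
      have "b0 \<bullet> w k = of_bool (i = k)" using g(2) k w_inj[OF k i] by (auto simp: b0)
      then have "\<bar>q \<bullet> (z k - z 0) - of_bool (i = k)\<bar> = \<bar>(q - b0) \<bullet> w k\<bar>"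
        by (simp add: w_def inner_diff_left inner_diff_right inner_add_right)
      also have "\<dots> \<le> norm (q - b0) * norm (w k)" by (rule Cauchy_Schwarz_ineq2)
      also have "\<dots> \<le> r * (1 + (\<Sum>k\<in>{1..j}. norm (w k)))"
      proof (intro mult_mono)
        show "norm (q - b0) \<le> r" using q(2) by (simp add: dist_norm norm_minus_commute)
        have "norm (w k) \<le> (\<Sum>k\<in>{1..j}. norm (w k))" using k by (intro member_le_sum) auto
        then show "norm (w k) \<le> 1 + (\<Sum>k\<in>{1..j}. norm (w k))" by simp
      qed (use r in auto)
      also have "\<dots> = e"
      proof -
        have "1 + (\<Sum>k\<in>{1..j}. norm (w k)) \<noteq> 0" using sum_nonneg[of "{1..j}" "\<lambda>k. norm (w k)"] by auto
        then show ?thesis by (simp add: r_def)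
      qed
      finally show ?thesis .
    qed
    then show ?thesis using q(1) by blast
  qed
  then obtain b where b: "\<And>i. i \<in> {1..j} \<Longrightarrow> b i \<in> Q \<and> (\<forall>k\<in>{1..j}. \<bar>b i \<bullet> (z k - z 0) - of_bool (i = k)\<bar> \<le> e)"
    by metis
  show ?thesis
  proof
    show "restrict b {1..j} \<in> Pi\<^sub>E {1..j} (\<lambda>_. Q)" using b by auto
    show "approx_dual j (restrict b {1..j}) z" using b by (auto simp: approx_dual_def e_def)
  qed
qed

lemma nondegenerate_iff_approx_dual:
  obtains B :: "(nat \<Rightarrow> 'a::euclidean_space) set" where "countable B"
    "\<And>z. nondegenerate j z \<longleftrightarrow> (\<exists>b\<in>B. approx_dual j b z)"
proof -
  obtain Q :: "'a set" where Q: "countable Q" "\<And>X :: 'a set. open X \<Longrightarrow> X \<noteq> {} \<Longrightarrow> \<exists>q\<in>Q. q \<in> X"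
    using countable_dense_exists[where 'a='a] by blast
  show ?thesis
  proof (rule that)
    show "countable (Pi\<^sub>E {1..j} (\<lambda>_. Q))" using Q(1) by (intro countable_PiE) auto
    show "nondegenerate j z \<longleftrightarrow> (\<exists>b\<in>Pi\<^sub>E {1..j} (\<lambda>_. Q). approx_dual j b z)" for z :: "nat \<Rightarrow> 'a"
      using approx_dual_imp_nondegenerate nondegenerate_imp_approx_dual[OF _ Q(2)] by blast
  qed
qed

lemma pred_nondegenerate:
  fixes f :: "'w \<Rightarrow> nat \<Rightarrow> 'a::euclidean_space"
  assumes f: "\<And>i. i \<le> j \<Longrightarrow> (\<lambda>w. f w i) \<in> borel_measurable M"
  shows "Measurable.pred M (\<lambda>w. nondegenerate j (f w))"
proof -
  obtain B :: "(nat \<Rightarrow> 'a) set" where B: "countable B" "\<And>z. nondegenerate j z \<longleftrightarrow> (\<exists>b\<in>B. approx_dual j b z)"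
    by (rule nondegenerate_iff_approx_dual) (rule that)
  have "Measurable.pred M (\<lambda>w. approx_dual j b (f w))" for b
  proof -
    have [measurable]: "Measurable.pred M (\<lambda>w. \<bar>b i \<bullet> (f w k - f w 0) - of_bool (i = k)\<bar> \<le> 1 / (2 * (real j + 1)))"
      if "k \<in> {1..j}" for i k
    proof -
      have [measurable]: "(\<lambda>w. f w k) \<in> borel_measurable M" "(\<lambda>w. f w 0) \<in> borel_measurable M"
        using f that by auto
      show ?thesis by measurable
    qed
    then show ?thesis unfolding approx_dual_def by measurable
  qed
  then have "{w \<in> space M. \<exists>b\<in>B. approx_dual j b (f w)} \<in> sets M"
    using B(1) by (intro sets.sets_Collect_countable_Ex') (auto simp: pred_def)
  then show ?thesis by (simp add: pred_def B(2))
qed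

text \<open>Positivity of \<open>emeasure\<close> includes measurability, as non-measurable sets get
  the value 0. With countably many approximate dual systems the set becomes a countable union of
  continuous images of compact sets.\<close>

lemma nondeg_pinned_dists_measurable:
  fixes E :: "'a::euclidean_space set"
  assumes E: "compact E"
  shows "nondeg_pinned_dists j x E \<in> sets (lborel_pairs j)"
proof -
  obtain B :: "(nat \<Rightarrow> 'a) set" where B: "countable B" "\<And>z. nondegenerate j z \<longleftrightarrow> (\<exists>b\<in>B. approx_dual j b z)"
    by (rule nondegenerate_iff_approx_dual) (rule that)
  define F where "F = (\<lambda>z :: nat \<Rightarrow> 'a. \<lambda>(a, b)\<in>pairs j. dist (z a) (z b))"
  \<comment> \<open>Coordinates outside {1..j} are pinned to x, including those beyond j, so that Z
    is compact in the full function space.\<close>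
  define Z where "Z = Pi\<^sub>E UNIV (\<lambda>i. if i \<in> {1..j} then E else {x})"
  have Z: "compact Z"
  proof -
    have "compactin (product_topology (\<lambda>i::nat. euclidean :: 'a topology) UNIV) Z"
      unfolding Z_def compactin_PiE using E by auto
    then show ?thesis by (simp add: euclidean_product_topology)
  qed
  have closed: "closed {z. approx_dual j b z}" for b :: "nat \<Rightarrow> 'a"
  proof -
    have "{z. approx_dual j b z} = (\<Inter>i\<in>{1..j}. \<Inter>k\<in>{1..j}. {z. \<bar>b i \<bullet> (z k - z 0) - of_bool (i = k)\<bar> \<le> 1 / (2 * (real j + 1))})"
      unfolding approx_dual_def by blast
    then show ?thesis
      by (simp only:) (intro closed_INT ballI closed_Collect_le continuous_intros continuous_on_product_coordinates)
  qed
  have cont: "continuous_on S F" for S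
  proof (rule continuous_on_coordinatewise_then_product)
    fix p :: "nat \<times> nat"
    show "continuous_on S (\<lambda>z. F z p)"
    proof (cases "p \<in> pairs j")
      case True
      then have "F z p = dist (z (fst p)) (z (snd p))" for z by (simp add: F_def split_beta')
      then show ?thesis by (simp add: continuous_on_dist continuous_on_product_coordinates continuous_on_subset[OF continuous_on_product_coordinates])
    next
      case False
      then have "F z p = undefined" for z by (simp add: F_def)
      then show ?thesis by simp
    qed
  qed
  have eq: "nondeg_pinned_dists j x E = (\<Union>b\<in>B. F ` (Z \<inter> {z. approx_dual j b z}))"
  proof (intro subset_antisym subsetI)
    fix y assume "y \<in> nondeg_pinned_dists j x E"
    then obtain z where z: "y = F z" "z 0 = x" "\<forall>i\<in>{1..j}. z i \<in> E" "nondegenerate j z"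
      by (auto simp: nondeg_pinned_dists_def F_def nondegenerate_def)
    define z' where "z' = (\<lambda>i. if i \<le> j then z i else x)"
    have z'_eq: "z' i = z i" if "i \<le> j" for i using that by (simp add: z'_def)
    have "F z' = F z" by (auto simp: F_def pairs_def fun_eq_iff z'_eq)
    moreover have "nondegenerate j z'"
    proof -
      have "z' ` {0..j} = z ` {0..j}" by (intro image_cong) (auto simp: z'_eq)
      moreover have "inj_on z' {0..j} \<longleftrightarrow> inj_on z {0..j}" by (intro inj_on_cong) (auto simp: z'_eq)
      ultimately show ?thesis using z(4) by (simp add: nondegenerate_def)
    qed
    moreover have "z' \<in> Z" using z by (auto simp: Z_def z'_def Suc_le_eq)
    ultimately have "z' \<in> Z" "y = F z'" "nondegenerate j z'" using z(1) by simp_all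
    moreover obtain b where "b \<in> B" "approx_dual j b z'" using \<open>nondegenerate j z'\<close> B(2) by blast
    ultimately show "y \<in> (\<Union>b\<in>B. F ` (Z \<inter> {z. approx_dual j b z}))" by blast
  next
    fix y assume "y \<in> (\<Union>b\<in>B. F ` (Z \<inter> {z. approx_dual j b z}))"
    then obtain z b where z: "y = F z" "z \<in> Z" "b \<in> B" "approx_dual j b z" by auto
    then have n: "nondegenerate j z" using B(2) by blast
    have zi: "z i \<in> (if i \<in> {1..j} then E else {x})" for i using z(2) by (auto simp: Z_def PiE_def Pi_def)
    have "z 0 = x" using zi[of 0] by simp
    moreover have "\<forall>i\<in>{1..j}. z i \<in> E" using zi by (metis (full_types))
    ultimately show "y \<in> nondeg_pinned_dists j x E"
      using n z(1) by (auto simp: nondeg_pinned_dists_def F_def nondegenerate_def)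
  qed
  have borel: "nondeg_pinned_dists j x E \<in> sets borel"
    unfolding eq
  proof (rule sets.countable_UN''[OF B(1)])
    show "F ` (Z \<inter> {z. approx_dual j b z}) \<in> sets borel" for b
      by (intro borel_compact compact_continuous_image cont compact_Int_closed Z closed)
  qed
  have sub: "nondeg_pinned_dists j x E \<subseteq> space (lborel_pairs j)"
    by (auto simp: nondeg_pinned_dists_def lborel_pairs_def space_PiM)
  have "(\<lambda>p. p) -` nondeg_pinned_dists j x E \<inter> space (lborel_pairs j) \<in> sets (lborel_pairs j)"
    using measurable_sets[OF measurable_PiM_borel_id[of "pairs j"] borel] by (simp add: lborel_pairs_def)
  then show ?thesis using sub by (simp add: Int_absorb2)
qed

section \<open>From squared distances to distances\<close>

lemma null_sets_sqrt_vimage: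
  assumes A: "A \<in> null_sets lborel"
  shows "sqrt -` A \<in> null_sets lborel"
proof -
  have "A \<in> sets borel" using A by auto
  then have m: "sqrt -` A \<in> sets borel"
    using measurable_sets[OF borel_measurable_sqrt, of A] by simp
  have "negligible A" using A by (simp add: negligible_iff_null_sets null_sets_completionI)
  then have n: "negligible (A \<inter> {0..})" "negligible (A \<inter> {..0})" by (auto intro: negligible_Int)
  have "negligible ((\<lambda>t. t\<^sup>2) ` (A \<inter> {0..}))"
    by (rule negligible_differentiable_image_negligible[OF _ n(1)])
      (auto simp: differentiable_on_def intro!: derivative_intros)
  moreover have "negligible ((\<lambda>t. - t\<^sup>2) ` (A \<inter> {..0}))"
    by (rule negligible_differentiable_image_negligible[OF _ n(2)])
      (auto simp: differentiable_on_def intro!: derivative_intros)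
  \<comment> \<open>On negative arguments \<open>sqrt\<close> is continued as an odd function, so
    the preimage of the negative part of A is its image under -t^2.\<close>
  moreover have "sqrt -` A \<subseteq> (\<lambda>t. t\<^sup>2) ` (A \<inter> {0..}) \<union> (\<lambda>t. - t\<^sup>2) ` (A \<inter> {..0})"
  proof
    fix t assume t: "t \<in> sqrt -` A"
    show "t \<in> (\<lambda>t. t\<^sup>2) ` (A \<inter> {0..}) \<union> (\<lambda>t. - t\<^sup>2) ` (A \<inter> {..0})"
    proof (cases "0 \<le> t")
      case True
      then show ?thesis using t by (intro UnI1 image_eqI[of _ _ "sqrt t"]) auto
    next
      case False
      then have "t = - (sqrt t)\<^sup>2" using real_sqrt_pow2[of "- t"] by (simp add: real_sqrt_minus)
      then show ?thesis using t False by (intro UnI2 image_eqI[of _ _ "sqrt t"]) auto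
    qed
  qed
  ultimately have "negligible (sqrt -` A)" by (meson negligible_Un negligible_subset)
  then show ?thesis using m by (simp add: negligible_iff_null_sets null_sets_completion_iff)
qed

lemma AE_lborel_sqrt: "(AE t in lborel. P t) \<Longrightarrow> (AE t in lborel. P (sqrt t))"
proof -
  assume "AE t in lborel. P t"
  then obtain N where N: "N \<in> null_sets lborel" "{t. \<not> P t} \<subseteq> N" by (auto simp: eventually_ae_filter)
  have "AE t in lborel. t \<notin> sqrt -` N" by (intro AE_not_in null_sets_sqrt_vimage N)
  then show ?thesis by eventually_elim (use N in auto)
qed

text \<open>Fubini reduces the coordinatewise root to one variable at a time: almost every section
  of N is null, and the one-dimensional root preserves this.\<close>

lemma AE_PiM_sqrt:
  fixes N :: "('i \<Rightarrow> real) set"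
  assumes "finite I" "N \<in> null_sets (Pi\<^sub>M I (\<lambda>_. lborel))"
  shows "AE c in Pi\<^sub>M I (\<lambda>_. lborel). (\<lambda>k\<in>I. sqrt (c k)) \<notin> N"
  using assms
proof (induction I arbitrary: N rule: finite_induct)
  case empty
  have "AE c in Pi\<^sub>M {} (\<lambda>_::'i. lborel :: real measure). c \<notin> N" by (rule AE_not_in[OF empty])
  then show ?case using AE_space
  proof eventually_elim
    case (elim c)
    then have "restrict (\<lambda>k. sqrt (c k)) {} = c" by (auto simp: space_PiM)
    then show ?case using elim by simp
  qed
next
  case (insert i I)
  interpret product_sigma_finite "\<lambda>_::'i. lborel :: real measure" ..
  have N [measurable]: "N \<in> sets (Pi\<^sub>M (insert i I) (\<lambda>_. lborel))" using insert.prems by auto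
  have pN: "Measurable.pred (Pi\<^sub>M (insert i I) (\<lambda>_. lborel)) (\<lambda>y. y \<notin> N)" by measurable
  have map_meas: "(\<lambda>y. \<lambda>k\<in>insert i I. sqrt (y k)) \<in> measurable (Pi\<^sub>M (insert i I) (\<lambda>_. lborel)) (Pi\<^sub>M (insert i I) (\<lambda>_. lborel))"
  proof (rule measurable_restrict)
    fix k assume "k \<in> insert i I"
    then have "(\<lambda>y. y k) \<in> borel_measurable (Pi\<^sub>M (insert i I) (\<lambda>_. lborel :: real measure))"
      using measurable_component_singleton[of k "insert i I" "\<lambda>_. lborel :: real measure"] by simp
    then show "(\<lambda>y. sqrt (y k)) \<in> measurable (Pi\<^sub>M (insert i I) (\<lambda>_. lborel)) lborel" by simp
  qed
  have "AE y in Pi\<^sub>M (insert i I) (\<lambda>_. lborel). y \<notin> N" by (rule AE_not_in[OF insert.prems])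
  then have "AE x in Pi\<^sub>M I (\<lambda>_. lborel). AE t in lborel. x(i := t) \<notin> N"
    by (subst (asm) AE_PiM_insert[OF insert.hyps pN])
  then obtain N0 where N0: "N0 \<in> null_sets (Pi\<^sub>M I (\<lambda>_. lborel))"
    "{x \<in> space (Pi\<^sub>M I (\<lambda>_. lborel)). \<not> (AE t in lborel. x(i := t) \<notin> N)} \<subseteq> N0"
    by (auto simp: eventually_ae_filter)
  have "AE c in Pi\<^sub>M I (\<lambda>_. lborel). AE t in lborel. (\<lambda>k\<in>insert i I. sqrt ((c(i := t)) k)) \<notin> N"
    using insert.IH[OF N0(1)]
  proof eventually_elim
    case (elim c)
    have "(\<lambda>k\<in>I. sqrt (c k)) \<in> space (Pi\<^sub>M I (\<lambda>_. lborel))" by (simp add: space_PiM)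
    then have "AE t in lborel. (\<lambda>k\<in>I. sqrt (c k))(i := t) \<notin> N" using N0(2) elim by blast
    then have "AE t in lborel. (\<lambda>k\<in>I. sqrt (c k))(i := sqrt t) \<notin> N" by (rule AE_lborel_sqrt)
    moreover have "(\<lambda>k\<in>I. sqrt (c k))(i := sqrt t) = (\<lambda>k\<in>insert i I. sqrt ((c(i := t)) k))" for t
      using insert.hyps by (auto simp: fun_eq_iff)
    ultimately show ?case by simp
  qed
  then show ?case
    by (subst AE_PiM_insert[OF insert.hyps measurable_compose[OF map_meas pN]])
qed

section \<open>Pinned squared distances\<close>

context frostman_measure
begin

lemma finite_energy_image:
  assumes "inj_on f I"
  shows "finite_energy (f ` I) y = finite_energy I (y \<circ> f)"
  using assms by (simp add: finite_energy_def pair_energy_def prod.reindex card_image)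

lemma AE_PiM_mu_insert:
  fixes P :: "('i \<Rightarrow> 'a) \<Rightarrow> bool"
  assumes "finite I" "i \<notin> I" "Measurable.pred (Pi\<^sub>M (insert i I) (\<lambda>_. \<mu>)) P"
  shows "(AE y in Pi\<^sub>M (insert i I) (\<lambda>_. \<mu>). P y) \<longleftrightarrow> (AE z in Pi\<^sub>M I (\<lambda>_. \<mu>). AE w in \<mu>. P (z(i := w)))"
proof -
  interpret product_sigma_finite "\<lambda>_::'i. \<mu>" by (simp add: product_sigma_finite_def sigma_finite_mu)
  show ?thesis by (rule AE_PiM_insert[OF assms])
qed

definition good_pin :: "'a \<Rightarrow> bool" where
  "good_pin x \<longleftrightarrow> (AE z in Pi\<^sub>M {1..DIM('a) - 2} (\<lambda>_. \<mu>). finite_energy {..DIM('a) - 2} (z(0 := x)))"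

lemma AE_good_pin:
  assumes d: "DIM('a) \<ge> 3"
  shows "AE x in \<mu>. good_pin x"
proof -
  let ?n = "DIM('a) - 2" and ?I = "{1..DIM('a) - 2}"
  interpret product_sigma_finite "\<lambda>_::nat. \<mu>" by (simp add: product_sigma_finite_def sigma_finite_mu)
  have "sigma_finite_measure (Pi\<^sub>M ?I (\<lambda>_. \<mu>))" by (rule sigma_finite) simp
  then interpret P: pair_sigma_finite "Pi\<^sub>M ?I (\<lambda>_. \<mu>)" \<mu> by (simp add: pair_sigma_finite_def sigma_finite_mu)
  have ins: "{..?n} = insert 0 ?I" by auto
  have m: "Measurable.pred (Pi\<^sub>M (insert 0 ?I) (\<lambda>_. \<mu>)) (finite_energy {..?n})"
    unfolding ins[symmetric] by (rule pred_finite_energy) (auto simp: sets_mu)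
  have "AE y in Pi\<^sub>M (insert 0 ?I) (\<lambda>_. \<mu>). finite_energy {..?n} y"
    unfolding ins[symmetric] by (rule AE_finite_energy_mu[OF d])
  then have "AE z in Pi\<^sub>M ?I (\<lambda>_. \<mu>). AE x in \<mu>. finite_energy {..?n} (z(0 := x))"
    by (subst (asm) AE_PiM_mu_insert[OF _ _ m]) auto
  moreover have "{q \<in> space (Pi\<^sub>M ?I (\<lambda>_. \<mu>) \<Otimes>\<^sub>M \<mu>). finite_energy {..?n} ((fst q)(0 := snd q))} \<in> sets (Pi\<^sub>M ?I (\<lambda>_. \<mu>) \<Otimes>\<^sub>M \<mu>)"
  proof -
    have "Measurable.pred (Pi\<^sub>M ?I (\<lambda>_. \<mu>) \<Otimes>\<^sub>M \<mu>) (\<lambda>q. finite_energy {..?n} ((fst q)(0 := snd q)))"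
      using measurable_compose[OF measurable_add_dim[of 0 ?I "\<lambda>_. \<mu>"] m] by (simp add: split_beta')
    then show ?thesis by (simp add: pred_def)
  qed
  ultimately show ?thesis
    unfolding good_pin_def using P.AE_commute by simp
qed

text \<open>The energy bound concerns n + 1 reference points, while a new vertex may be joined to
  only j + 1 of them. Null sets in the smaller set of distances are pulled back to all of
  them.\<close>

lemma AE_new_sqdists_notin_null:
  fixes y :: "nat \<Rightarrow> 'a"
  assumes y: "finite_energy {..n} y" and k: "j \<le> n"
    and N: "N \<in> null_sets (Pi\<^sub>M ((\<lambda>a. (a, k)) ` {..j}) (\<lambda>_. lborel))"
  shows "AE w in \<mu>. (\<lambda>(a, _)\<in>(\<lambda>a. (a, k :: nat)) ` {..j}. (dist w (y a))\<^sup>2) \<notin> N"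
proof -
  let ?P = "(\<lambda>a. (a, k)) ` {..j}" and ?J = "(\<lambda>a. (a, k)) ` {..n}"
  interpret product_sigma_finite "\<lambda>_::nat \<times> nat. lborel :: real measure" ..
  have sub: "?P \<subseteq> ?J" using k by (intro image_mono) auto
  have [measurable]: "N \<in> sets (Pi\<^sub>M ?P (\<lambda>_. lborel))" using N by auto
  have "AE c in Pi\<^sub>M ?J (\<lambda>_. lborel). restrict c ?P \<notin> N"
    by (rule AE_PiM_restrict[OF sub _ _ AE_not_in[OF N]]) (simp, measurable)
  then obtain N' where N': "N' \<in> null_sets (Pi\<^sub>M ?J (\<lambda>_. lborel))"
    "{c \<in> space (Pi\<^sub>M ?J (\<lambda>_. lborel)). \<not> restrict c ?P \<notin> N} \<subseteq> N'"
    by (auto simp: eventually_ae_filter)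
  have "finite_energy ?J (\<lambda>p. y (fst p))"
    using y by (subst finite_energy_image) (auto simp: inj_on_def comp_def)
  from AE_sqdists_notin_null[OF _ this N'(1)]
  have "AE w in \<mu>. (\<lambda>p\<in>?J. (dist w (y (fst p)))\<^sup>2) \<notin> N'" by simp
  then show ?thesis
  proof eventually_elim
    case (elim w)
    have "(\<lambda>p\<in>?J. (dist w (y (fst p)))\<^sup>2) \<in> space (Pi\<^sub>M ?J (\<lambda>_. lborel))" by (simp add: space_PiM)
    then have "restrict (\<lambda>p\<in>?J. (dist w (y (fst p)))\<^sup>2) ?P \<notin> N" using N'(2) elim by blast
    moreover have "restrict (\<lambda>p\<in>?J. (dist w (y (fst p)))\<^sup>2) ?P = (\<lambda>(a, _)\<in>?P. (dist w (y a))\<^sup>2)"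
      using sub by (auto simp: fun_eq_iff restrict_def split: prod.splits)
    ultimately show ?case by simp
  qed
qed

text \<open>Induction on the number of vertices by Fubini in the target: for almost all values of
  the old distances the section of N in the new ones is null. The induction hypothesis keeps the old
  tuple away from the exceptional values, and a \<mu>-random new vertex avoids the section.\<close>

lemma AE_pinned_sqdist_notin_null:
  assumes x: "good_pin x" and d: "DIM('a) \<ge> 3"
    and "j \<le> DIM('a) - 1" "N \<in> null_sets (lborel_pairs j)"
  shows "AE z in Pi\<^sub>M {1..j} (\<lambda>_. \<mu>). pinned_sqdist j x z \<notin> N"
  using assms(3,4)
proof (induction j arbitrary: N)
  case 0
  have p0: "pairs 0 = {}" by (auto simp: pairs_def)
  \<comment> \<open>Without pairs the product measure is the unit mass at one point, whose only null
    set is empty.\<close>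
  have "N = {}"
  proof (rule ccontr)
    assume "N \<noteq> {}"
    have "N \<subseteq> {\<lambda>_. undefined}"
      using sets.sets_into_space[of N "lborel_pairs 0"] 0 by (auto simp: lborel_pairs_def p0 space_PiM)
    with \<open>N \<noteq> {}\<close> have "N = {\<lambda>_. undefined}" by blast
    then show False using 0 by (auto simp: lborel_pairs_def p0 PiM_empty null_sets_def)
  qed
  then show ?case by simp
next
  case (Suc j)
  let ?n = "DIM('a) - 2"
  let ?P = "(\<lambda>a. (a, Suc j)) ` {..j}"
  have jn: "j \<le> ?n" using Suc.prems(1) d by linarith
  interpret L: product_sigma_finite "\<lambda>_::nat \<times> nat. lborel :: real measure" ..
  interpret M: product_sigma_finite "\<lambda>_::nat. \<mu>" by (simp add: product_sigma_finite_def sigma_finite_mu)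
  have pairs: "pairs (Suc j) = pairs j \<union> ?P" by (auto simp: pairs_def)
  have disj: "pairs j \<inter> ?P = {}" by (auto simp: pairs_def)
  have N: "N \<in> null_sets (Pi\<^sub>M (pairs j \<union> ?P) (\<lambda>_. lborel))" using Suc.prems(2) by (simp add: lborel_pairs_def pairs)
  then have N_meas: "N \<in> sets (Pi\<^sub>M (pairs j \<union> ?P) (\<lambda>_. lborel))" by auto
  have pN: "Measurable.pred (Pi\<^sub>M (pairs j \<union> ?P) (\<lambda>_. lborel)) (\<lambda>c. c \<notin> N)"
  proof -
    note N_meas [measurable]
    show ?thesis by measurable
  qed
  have "AE c in Pi\<^sub>M (pairs j \<union> ?P) (\<lambda>_. lborel). c \<notin> N" by (rule AE_not_in[OF N])
  then have "AE c in Pi\<^sub>M (pairs j) (\<lambda>_. lborel). AE c' in Pi\<^sub>M ?P (\<lambda>_. lborel). merge (pairs j) ?P (c, c') \<notin> N"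
    by (subst (asm) L.AE_PiM_Un[OF disj _ _ pN]) (auto simp: finite_pairs)
  then obtain N0 where N0: "N0 \<in> null_sets (Pi\<^sub>M (pairs j) (\<lambda>_. lborel))"
    "{c \<in> space (Pi\<^sub>M (pairs j) (\<lambda>_. lborel)). \<not> (AE c' in Pi\<^sub>M ?P (\<lambda>_. lborel). merge (pairs j) ?P (c, c') \<notin> N)} \<subseteq> N0"
    by (auto simp: eventually_ae_filter)
  have IH: "AE z in Pi\<^sub>M {1..j} (\<lambda>_. \<mu>). pinned_sqdist j x z \<notin> N0"
    using Suc.IH[of N0] Suc.prems(1) N0(1) by (simp add: lborel_pairs_def)
  \<comment> \<open>At stage j fewer than d - 1 reference points may be present. As almost every
    completion has finite energy, some completion exists, and any one will do.\<close>
  have ext: "AE z in Pi\<^sub>M {1..j} (\<lambda>_. \<mu>). \<exists>y. finite_energy {..?n} y \<and> (\<forall>a\<le>j. y a = (z(0 := x)) a)"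
  proof -
    let ?J = "{Suc j..?n}"
    have un: "{1..?n} = {1..j} \<union> ?J" using jn by auto
    have m: "Measurable.pred (Pi\<^sub>M ({1..j} \<union> ?J) (\<lambda>_. \<mu>)) (\<lambda>z. finite_energy {..?n} (z(0 := x)))"
    proof -
      have ins: "{..?n} = insert 0 ({1..j} \<union> ?J)" using jn by auto
      have "(\<lambda>z. z(0 := x)) \<in> measurable (Pi\<^sub>M ({1..j} \<union> ?J) (\<lambda>_. \<mu>)) (Pi\<^sub>M {..?n} (\<lambda>_. \<mu>))"
        unfolding ins by (intro measurable_fun_upd[where J="{1..j} \<union> ?J"]) auto
      moreover have "Measurable.pred (Pi\<^sub>M {..?n} (\<lambda>_. \<mu>)) (finite_energy {..?n})"
        by (rule pred_finite_energy) (auto simp: sets_mu)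
      ultimately show ?thesis by (rule measurable_compose)
    qed
    have "AE z in Pi\<^sub>M ({1..j} \<union> ?J) (\<lambda>_. \<mu>). finite_energy {..?n} (z(0 := x))"
      using x unfolding good_pin_def un .
    then have "AE z in Pi\<^sub>M {1..j} (\<lambda>_. \<mu>). AE z' in Pi\<^sub>M ?J (\<lambda>_. \<mu>). finite_energy {..?n} ((merge {1..j} ?J (z, z'))(0 := x))"
      by (subst (asm) M.AE_PiM_Un[OF _ _ _ m]) auto
    then show ?thesis
    proof eventually_elim
      case (elim z)
      interpret J: prob_space "Pi\<^sub>M ?J (\<lambda>_. \<mu>)" by (rule prob_space_PiM) (rule prob_space_axioms)
      have "\<exists>z'. finite_energy {..?n} ((merge {1..j} ?J (z, z'))(0 := x))"
      proof (rule ccontr)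
        assume "\<not> ?thesis"
        then have "AE z' in Pi\<^sub>M ?J (\<lambda>_. \<mu>). False" using elim by simp
        then show False by (simp add: J.AE_False)
      qed
      then obtain z' where "finite_energy {..?n} ((merge {1..j} ?J (z, z'))(0 := x))" by blast
      then show ?case by (intro exI conjI) (auto simp: merge_def)
    qed
  qed
  have "AE z in Pi\<^sub>M {1..j} (\<lambda>_. \<mu>). AE w in \<mu>. pinned_sqdist (Suc j) x (z(Suc j := w)) \<notin> N"
    using IH ext
  proof eventually_elim
    case (elim z)
    then obtain y where y: "finite_energy {..?n} y" "\<And>a. a \<le> j \<Longrightarrow> y a = (z(0 := x)) a" by blast
    have sp: "pinned_sqdist j x z \<in> space (Pi\<^sub>M (pairs j) (\<lambda>_. lborel))"
      by (simp add: pinned_sqdist_def space_PiM)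
    have "AE c' in Pi\<^sub>M ?P (\<lambda>_. lborel). merge (pairs j) ?P (pinned_sqdist j x z, c') \<notin> N"
      using N0(2) sp elim(1) by blast
    then obtain N2 where N2: "N2 \<in> null_sets (Pi\<^sub>M ?P (\<lambda>_. lborel))"
      "{c' \<in> space (Pi\<^sub>M ?P (\<lambda>_. lborel)). \<not> merge (pairs j) ?P (pinned_sqdist j x z, c') \<notin> N} \<subseteq> N2"
      by (auto simp: eventually_ae_filter)
    have "AE w in \<mu>. (\<lambda>(a, _)\<in>?P. (dist w (y a))\<^sup>2) \<notin> N2"
      by (rule AE_new_sqdists_notin_null[OF y(1) jn N2(1)])
    then show ?case
    proof eventually_elim
      case (elim w)
      let ?c = "(\<lambda>(a, _)\<in>?P. (dist w (y a))\<^sup>2)"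
      have "?c \<in> space (Pi\<^sub>M ?P (\<lambda>_. lborel))" by (simp add: space_PiM)
      then have "merge (pairs j) ?P (pinned_sqdist j x z, ?c) \<notin> N" using N2(2) elim by blast
      moreover have "merge (pairs j) ?P (pinned_sqdist j x z, ?c) = pinned_sqdist (Suc j) x (z(Suc j := w))"
      proof
        fix p :: "nat \<times> nat"
        obtain a b where p: "p = (a, b)" by (cases p)
        consider "p \<in> pairs j" | "p \<in> ?P" | "p \<notin> pairs (Suc j)" using pairs by blast
        then show "merge (pairs j) ?P (pinned_sqdist j x z, ?c) p = pinned_sqdist (Suc j) x (z(Suc j := w)) p"
        proof cases
          case 1
          then have "p \<in> pairs (Suc j)" "a \<noteq> Suc j" "b \<noteq> Suc j" using pairs p by (auto simp: pairs_def)
          with 1 show ?thesis unfolding p by (simp add: merge_def pinned_sqdist_def)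
        next
          case 2
          then have ab: "p \<in> pairs (Suc j)" "p \<notin> pairs j" "b = Suc j" "a \<le> j" using pairs disj p by auto
          with 2 show ?thesis unfolding p
            by (simp add: merge_def pinned_sqdist_def y(2) dist_commute)
        next
          case 3
          then show ?thesis using pairs by (simp add: merge_def pinned_sqdist_def)
        qed
      qed
      ultimately show ?case by simp
    qed
  qed
  moreover have ins: "{1..Suc j} = insert (Suc j) {1..j}" by auto
  moreover have "Measurable.pred (Pi\<^sub>M (insert (Suc j) {1..j}) (\<lambda>_. \<mu>)) (\<lambda>z. pinned_sqdist (Suc j) x z \<notin> N)"
  proof -
    have "Measurable.pred (lborel_pairs (Suc j)) (\<lambda>c. c \<notin> N)" unfolding lborel_pairs_def pairs by (rule pN)
    from measurable_compose[OF measurable_pinned_sqdist[OF sets_mu] this] show ?thesis by (simp only: ins)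
  qed
  ultimately show ?case by (simp only: ins) (subst AE_PiM_mu_insert, auto)
qed

text \<open>The vertices chosen so far span an affine subspace of dimension less than d, contained
  in a hyperplane, and \<mu> does not charge hyperplanes.\<close>

lemma AE_nondegenerate:
  assumes "j \<le> DIM('a) - 1"
  shows "AE z in Pi\<^sub>M {1..j} (\<lambda>_. \<mu>). nondegenerate j (z(0 := x))"
  using assms
proof (induction j)
  case 0
  have "nondegenerate 0 (z(0 := x))" for z :: "nat \<Rightarrow> 'a"
    by (simp add: nondegenerate_def affine_independent_1)
  then show ?case by (intro AE_I2)
next
  case (Suc j)
  have ins: "{1..Suc j} = insert (Suc j) {1..j}" by auto
  have m: "Measurable.pred (Pi\<^sub>M (insert (Suc j) {1..j}) (\<lambda>_. \<mu>)) (\<lambda>z. nondegenerate (Suc j) (z(0 := x)))"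
  proof (rule pred_nondegenerate)
    fix i assume i: "i \<le> Suc j"
    show "(\<lambda>z. (z(0 := x)) i) \<in> borel_measurable (Pi\<^sub>M (insert (Suc j) {1..j}) (\<lambda>_. \<mu>))"
    proof (cases "i = 0")
      case False
      then have "i \<in> insert (Suc j) {1..j}" using i by auto
      from measurable_component_singleton[OF this, of "\<lambda>_. \<mu>"] False show ?thesis
        by (simp add: sets_mu cong: measurable_cong_sets)
    qed simp
  qed
  have "AE z in Pi\<^sub>M {1..j} (\<lambda>_. \<mu>). AE w in \<mu>. nondegenerate (Suc j) ((z(Suc j := w))(0 := x))"
    using Suc.IH[OF Suc_leD[OF Suc.prems]]
  proof eventually_elim
    case (elim z)
    let ?z = "z(0 := x)" and ?H = "affine hull ((z(0 := x)) ` {0..j})"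
    have inj: "inj_on ?z {0..j}" and aff: "\<not> affine_dependent (?z ` {0..j})"
      using elim unfolding nondegenerate_def by blast+
    have card: "card (?z ` {0..j}) = Suc j" unfolding card_image[OF inj] by simp
    have "aff_dim (?z ` {0..j}) \<le> int (card (?z ` {0..j})) - 1" by (rule aff_dim_le_card) simp
    also have "\<dots> < int DIM('a)" using Suc.prems card by auto
    finally obtain u c where u: "u \<noteq> 0" "?z ` {0..j} \<subseteq> {w. u \<bullet> w = c}"
      by (rule aff_lowdim_subset_hyperplane) 
    then have "?H \<subseteq> {w. u \<bullet> w = c}" by (intro hull_minimal affine_hyperplane)
    moreover have "AE w in \<mu>. u \<bullet> w \<noteq> c" by (rule mu_hyperplane[OF u(1)])
    ultimately have "AE w in \<mu>. w \<notin> ?H" by (auto elim!: eventually_mono)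
    then show ?case
    proof eventually_elim
      case (elim w)
      let ?y = "(z(Suc j := w))(0 := x)"
      have y: "?y k = ?z k" if "k \<in> {0..j}" for k using that by auto
      have im: "?y ` {0..j} = ?z ` {0..j}" by (intro image_cong y refl)
      have w: "w \<notin> ?z ` {0..j}" using elim hull_subset[of "?z ` {0..j}" affine] by blast
      have split: "{0..Suc j} = insert (Suc j) {0..j}" by auto
      have "inj_on ?y {0..j} = inj_on ?z {0..j}" by (intro inj_on_cong y)
      then have "inj_on ?y {0..Suc j}"
        unfolding split inj_on_insert using inj w im by auto
      moreover have "\<not> affine_dependent (insert w (?z ` {0..j}))"
        by (rule affine_independent_insert[OF aff elim])
      moreover have "?y ` {0..Suc j} = insert w (?z ` {0..j})" unfolding split image_insert im by simp
      ultimately show ?case by (simp add: nondegenerate_def)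
    qed
  qed
  then show ?case unfolding ins by (subst AE_PiM_mu_insert[OF _ _ m]) auto
qed

end

section \<open>Topological support and assembly of the theorem\<close>

lemma closed_msupport: "closed (msupport M)"
proof -
  have "- msupport M = \<Union>{U. open U \<and> emeasure M U = 0}"
    by (auto simp: msupport_def zero_less_iff_neq_zero)
  moreover have "open (\<Union>{U. open U \<and> emeasure M U = 0})" by auto
  ultimately show ?thesis by (simp add: closed_def)
qed

lemma AE_in_msupport:
  fixes M :: "'b::second_countable_topology measure"
  assumes sets: "sets M = sets borel"
  shows "AE x in M. x \<in> msupport M"
proof -
  obtain B :: "'b set set" where B: "countable B" "topological_basis B"
    using ex_countable_basis by blast
  let ?N = "\<Union>{b \<in> B. emeasure M b = 0}"
  have open_B: "b \<in> B \<Longrightarrow> open b" for b using B(2) topological_basis_open by blast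
  have "?N = (\<Union>b\<in>{b \<in> B. emeasure M b = 0}. b)" by auto
  also have "\<dots> \<in> null_sets M"
    using B(1) open_B by (intro null_sets_UN') (auto simp: sets intro!: null_setsI countable_subset[OF _ B(1)])
  finally have N: "?N \<in> null_sets M" .
  have "x \<in> ?N" if x: "x \<notin> msupport M" for x
  proof -
    obtain U where U: "open U" "x \<in> U" "emeasure M U = 0" using x by (auto simp: msupport_def zero_less_iff_neq_zero)
    obtain b where b: "b \<in> B" "x \<in> b" "b \<subseteq> U" using topological_basisE[OF B(2) U(1,2)] by blast
    have "emeasure M b \<le> emeasure M U" using b U by (intro emeasure_mono) (auto simp: sets)
    then show ?thesis using b U by auto
  qed
  then show ?thesis using AE_not_in[OF N] by (auto elim!: eventually_mono)
qed

lemma msupport_subset_closed: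
  assumes sets: "sets M = sets borel" and E: "closed E" "AE x in M. x \<in> E"
  shows "msupport M \<subseteq> E"
proof
  fix x assume x: "x \<in> msupport M"
  have "- E \<in> null_sets M"
    using E by (subst AE_iff_null_sets) (auto simp: sets)
  then have "emeasure M (- E) = 0" by auto
  then show "x \<in> E" using x E(1) by (auto simp: msupport_def open_Compl)
qed

context frostman_measure
begin

lemma absolutely_continuous_pinned_sqdist:
  assumes x: "good_pin x" and d: "DIM('a) \<ge> 3" and j: "j \<le> DIM('a) - 1"
  shows "absolutely_continuous (lborel_pairs j) (distr (Pi\<^sub>M {1..j} (\<lambda>_. \<mu>)) (lborel_pairs j) (pinned_sqdist j x))"
  unfolding absolutely_continuous_def
proof
  fix N assume N: "N \<in> null_sets (lborel_pairs j)"
  have m: "pinned_sqdist j x \<in> measurable (Pi\<^sub>M {1..j} (\<lambda>_. \<mu>)) (lborel_pairs j)"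
    by (rule measurable_pinned_sqdist[OF sets_mu])
  have [measurable]: "N \<in> sets (lborel_pairs j)" using N by auto
  have set: "{c \<in> space (lborel_pairs j). c \<notin> N} \<in> sets (lborel_pairs j)" by measurable
  have "AE c in distr (Pi\<^sub>M {1..j} (\<lambda>_. \<mu>)) (lborel_pairs j) (pinned_sqdist j x). c \<notin> N"
    unfolding AE_distr_iff[OF m set] by (rule AE_pinned_sqdist_notin_null[OF x d j N])
  then show "N \<in> null_sets (distr (Pi\<^sub>M {1..j} (\<lambda>_. \<mu>)) (lborel_pairs j) (pinned_sqdist j x))"
    by (subst AE_iff_null_sets) auto
qed

text \<open>Were the set null, so would be its preimage under the coordinatewise root, and the
  squared distances of almost every tuple would avoid that. But almost every tuple lies in E and is
  nondegenerate, so its distances belong to the set.\<close>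

lemma nondeg_pinned_dists_pos:
  assumes x: "good_pin x" and d: "DIM('a) \<ge> 3" and j: "j \<le> DIM('a) - 1"
    and E: "compact E" "AE w in \<mu>. w \<in> E"
  shows "emeasure (lborel_pairs j) (nondeg_pinned_dists j x E) > 0"
proof (rule ccontr)
  let ?D = "nondeg_pinned_dists j x E" and ?Z = "Pi\<^sub>M {1..j} (\<lambda>_. \<mu>)"
  assume "\<not> ?thesis"
  then have "?D \<in> null_sets (lborel_pairs j)"
    using nondeg_pinned_dists_measurable[OF E(1)] by (intro null_setsI) (auto simp: zero_less_iff_neq_zero)
  then have "AE c in Pi\<^sub>M (pairs j) (\<lambda>_. lborel). (\<lambda>k\<in>pairs j. sqrt (c k)) \<notin> ?D"
    unfolding lborel_pairs_def by (rule AE_PiM_sqrt[OF finite_pairs])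
  then obtain N where N: "N \<in> null_sets (lborel_pairs j)"
    "{c \<in> space (lborel_pairs j). \<not> (\<lambda>k\<in>pairs j. sqrt (c k)) \<notin> ?D} \<subseteq> N"
    by (auto simp: eventually_ae_filter lborel_pairs_def)
  interpret Z: prob_space ?Z by (rule prob_space_PiM) (rule prob_space_axioms)
  have "AE z in ?Z. \<forall>i\<in>{1..j}. z i \<in> E"
  proof (rule AE_finite_allI)
    fix i assume "i \<in> {1..j}"
    then show "AE z in ?Z. z i \<in> E" by (intro AE_PiM_component prob_space_axioms E(2))
  qed simp
  moreover have "AE z in ?Z. nondegenerate j (z(0 := x))" by (rule AE_nondegenerate[OF j])
  moreover have "AE z in ?Z. pinned_sqdist j x z \<notin> N" by (rule AE_pinned_sqdist_notin_null[OF x d j N(1)])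
  ultimately have "AE z in ?Z. False"
  proof eventually_elim
    case (elim z)
    let ?z = "z(0 := x)"
    have "pinned_sqdist j x z \<in> space (lborel_pairs j)" by (simp add: pinned_sqdist_def lborel_pairs_def space_PiM)
    then have "(\<lambda>k\<in>pairs j. sqrt (pinned_sqdist j x z k)) \<notin> ?D" using N(2) elim(3) by blast
    moreover have "(\<lambda>k\<in>pairs j. sqrt (pinned_sqdist j x z k)) = (\<lambda>(a, b)\<in>pairs j. dist (?z a) (?z b))"
      unfolding pinned_sqdist_def by (rule ext) (simp add: restrict_def split: prod.splits)
    moreover have "(\<lambda>(a, b)\<in>pairs j. dist (?z a) (?z b)) \<in> ?D"
      unfolding nondeg_pinned_dists_def
    proof (intro CollectI exI conjI)
      show "(\<lambda>(a, b)\<in>pairs j. dist (?z a) (?z b)) = (\<lambda>(a, b)\<in>pairs j. dist (?z a) (?z b))" ..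
      show "?z 0 = x" by simp
      show "\<forall>i\<in>{1..j}. ?z i \<in> E" using elim(1) by auto
      show "inj_on ?z {0..j}" "\<not> affine_dependent (?z ` {0..j})" using elim(2) unfolding nondegenerate_def by blast+
    qed
    ultimately show False by simp
  qed
  then show False by (simp add: Z.AE_False)
qed

end

lemma hausdorff_dim_gt_exponent:
  assumes "of_nat n < hausdorff_dim E"
  obtains s where "real n < s" "s < real n + 1" "hausdorff_measure s E \<noteq> 0"
proof -
  \<comment> \<open>The minimum with n + 1 keeps the exponent below the dimension of the space, as
    \<open>frostman_measure\<close> demands.\<close>
  have "of_nat n < min (hausdorff_dim E) (of_nat (Suc n))"
    using assms by (simp add: of_nat_less_ennreal_of_nat less_add_same_cancel1)
  then obtain e where e: "of_nat n < e" "e < min (hausdorff_dim E) (of_nat (Suc n))" using dense by blast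
  then have "e < \<top>" by (metis min_less_iff_conj of_nat_less_top order_less_trans)
  then obtain s where s: "e = ennreal s" "0 \<le> s" by (cases e) auto
  show ?thesis
  proof
    show "real n < s" using e(1) s by (simp add: ennreal_of_nat_eq_real_of_nat ennreal_less_iff)
    have "e < of_nat (Suc n)" using e(2) by (simp only: min_less_iff_conj)
    then have "ennreal s < ennreal (real (Suc n))" using s(1) by (simp only: ennreal_of_nat_eq_real_of_nat)
    then have "s < real (Suc n)" using s(2) by (simp only: ennreal_less_iff)
    then show "s < real n + 1" by simp
    show "hausdorff_measure s E \<noteq> 0"
    proof
      assume "hausdorff_measure s E = 0"
      then have "hausdorff_dim E \<le> ennreal s" unfolding hausdorff_dim_def using s(2) by (intro Inf_lower) auto
      moreover have "ennreal s < hausdorff_dim E" using e(2) s(1) by (simp only: min_less_iff_conj)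
      ultimately show False by (simp add: not_less[symmetric])
    qed
  qed
qed

theorem theorem1p2:
  fixes E :: "(real ^ 'n) set"
  assumes "CARD('n) \<ge> 3"
    and "compact E"
    and "hausdorff_dim E > of_nat (CARD('n) - 1)"
  shows "\<exists>\<mu> :: (real ^ 'n) measure.
           sets \<mu> = sets borel \<and> prob_space \<mu> \<and> msupport \<mu> \<subseteq> E \<and>
           (\<exists>E\<^sub>\<mu> \<in> sets borel. E\<^sub>\<mu> \<subseteq> msupport \<mu> \<and> emeasure \<mu> E\<^sub>\<mu> = 1 \<and>
             (\<forall>x\<in>E\<^sub>\<mu>.
                absolutely_continuous
                  (lborel_pairs (CARD('n) - 1))
                  (distr (Pi\<^sub>M {1..CARD('n) - 1} (\<lambda>_. \<mu>)) (lborel_pairs (CARD('n) - 1))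
                     (pinned_sqdist (CARD('n) - 1) x)) \<and>
                emeasure (lborel_pairs (CARD('n) - 1))
                  (nondeg_pinned_dists (CARD('n) - 1) x E) > 0))"
proof -
  obtain s where s: "real (CARD('n) - 1) < s" "s < real (CARD('n) - 1) + 1" "hausdorff_measure s E \<noteq> 0"
    by (rule hausdorff_dim_gt_exponent[OF assms(3)])
  have "0 < s" using s(1) by (rule le_less_trans[rotated]) simp
  then obtain \<mu> :: "(real ^ 'n) measure" and c where \<mu>: "sets \<mu> = sets borel" "prob_space \<mu>" "0 < c"
    "\<And>x r. 0 < r \<Longrightarrow> emeasure \<mu> (ball x r) \<le> ennreal (c * r powr s)" and \<mu>_E: "AE x in \<mu>. x \<in> E"
    by (rule frostman_exists[OF assms(2) _ s(3)]) (rule that)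
  obtain R where R: "0 < R" "\<And>x. x \<in> E \<Longrightarrow> norm x < R"
    using compact_imp_bounded[OF assms(2)] by (auto simp: bounded_pos_less)
  interpret frostman_measure \<mu> R s c
  proof (intro frostman_measure.intro frostman_measure_axioms.intro)
    show "real DIM(real ^ 'n) - 1 < s" "s < real DIM(real ^ 'n)" using s assms(1) by (simp_all add: of_nat_diff)
    show "AE x in \<mu>. norm x < R" using \<mu>_E by eventually_elim (rule R)
  qed (use \<mu> R in auto)
  have d: "DIM(real ^ 'n) \<ge> 3" using assms(1) by simp
  have supp: "AE x in \<mu>. x \<in> msupport \<mu>" by (rule AE_in_msupport[OF sets_mu])
  obtain N where N: "N \<in> null_sets \<mu>" "{x \<in> space \<mu>. \<not> good_pin x} \<subseteq> N"
    using AE_good_pin[OF d] by (auto simp: eventually_ae_filter)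
  \<comment> \<open>Removing a null set that covers all bad pins yields a Borel set of full measure
    without asking whether \<open>good_pin\<close> is measurable.\<close>
  let ?S = "msupport \<mu> - N"
  have S: "?S \<in> sets borel"
    using closed_msupport[of \<mu>] N(1) by (auto simp: sets_mu null_sets_def)
  have "AE x in \<mu>. x \<in> ?S"
    using supp AE_not_in[OF N(1)] by eventually_elim simp
  then have "emeasure \<mu> ?S = 1"
    using S by (intro emeasure_eq_1_AE) (simp_all add: sets_mu)
  moreover have "absolutely_continuous (lborel_pairs (CARD('n) - 1))
      (distr (Pi\<^sub>M {1..CARD('n) - 1} (\<lambda>_. \<mu>)) (lborel_pairs (CARD('n) - 1)) (pinned_sqdist (CARD('n) - 1) x)) \<and>
    emeasure (lborel_pairs (CARD('n) - 1)) (nondeg_pinned_dists (CARD('n) - 1) x E) > 0" if "x \<in> ?S" for x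
  proof -
    have "good_pin x" using that N(2) by auto
    then show ?thesis
      using d by (intro conjI absolutely_continuous_pinned_sqdist nondeg_pinned_dists_pos assms(2) \<mu>_E) auto
  qed
  ultimately show ?thesis
    using S \<mu>(1,2) msupport_subset_closed[OF \<mu>(1) compact_imp_closed[OF assms(2)] \<mu>_E]
    by (intro exI[of _ \<mu>] conjI bexI[of _ ?S] ballI) auto
qed

end
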